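(* For $r\ge 0$ and real $z$ let $$K_{BS}(r,z)=\frac{\sin z}{\pi z}-\frac1\pi\int_0^\infty\cos(z\cosh t)\left(\frac{\sinh t\cosh t}{\sinh^2 t+r^2}-1\right)\sinh t\,dt .$$ Then for every $r\ge 0$ and every $s>0$ $$\left|\delta(x-y)-K_{BS}(r,x-y)\right|_0^{2s}=e^{-s^2/2-2rs}(\cosh s+r\sinh s).$$ Moreover, for $r>0$ the kernel can be rewritten as $$K_{BS}(r,z)=\frac{1}{\pi z}\int_0^\infty\sin(z\cosh t)\,\frac{r^2\cosh^2 t+(r^2-1)\sinh^2 t}{(\sinh^2 t+r^2)^2}\,dt ,$$ and, for $r=1$, $$K_{BS}(1,z)=\int_{|z|}^\infty\frac{J_1(t)}{2t}\,dt,$$ where $J_1$ is the Bessel function of the first kind of order $1$.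
   Context: For a kernel $K(x-y)$, the symbol $|\delta(x-y)-K(x-y)|_0^{2s}$ denotes the Fredholm determinant $\det(I-\mathcal K)$, where $\mathcal K$ is the integral operator on $L_2(0,2s)$ given by $(\mathcal K g)(x)=\int_0^{2s}K(x-y)g(y)\,dy$. Expressions such as $\frac{\sin z}{\pi z}$ and $\frac1{\pi z}\int_0^\infty \sin(z\cosh t)(\cdots)\,dt$ are understood at $z=0$ by continuity. In the case $r=0$ the integrand factor $\left(\frac{\sinh t\cosh t}{\sinh^2 t}-1\right)\sinh t$ equals $e^{-t}$. *)

theory Defs
  imports "HOL-Analysis.Analysis" "Jordan_Normal_Form.Determinant"
begin

text \<open>
  Fredholm determinant \<open>det (I - K)\<close> of the integral operator on \<open>L\<^sup>2(A)\<close> with kernel \<open>K x y\<close>,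
  as Fredholm's series. The kernel has to be given pointwise, not just almost everywhere,
  because its values on the diagonal enter the series.
\<close>

definition fredholm_term :: "real set \<Rightarrow> (real \<Rightarrow> real \<Rightarrow> real) \<Rightarrow> nat \<Rightarrow> real" where
  "fredholm_term A K n = (- 1) ^ n / fact n *
     (LINT x | Pi\<^sub>M {..<n} (\<lambda>_. restrict_space lborel A).
        Determinant.det (Matrix.mat n n (\<lambda>(i, j). K (x i) (x j))))"

definition fredholm_det :: "real set \<Rightarrow> (real \<Rightarrow> real \<Rightarrow> real) \<Rightarrow> real" where
  "fredholm_det A K = (\<Sum>n. fredholm_term A K n)"

definition cont_at_0 :: "(real \<Rightarrow> real) \<Rightarrow> real \<Rightarrow> real" where
  "cont_at_0 f z = (if z = 0 then Lim (at 0) f else f z)"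

definition bessel_J :: "nat \<Rightarrow> real \<Rightarrow> real" where
  "bessel_J m x = (\<Sum>k. (- 1) ^ k / (fact k * fact (k + m)) * (x / 2) ^ (2 * k + m))"

text \<open>
  The open half-line matters only for \<open>r = 0\<close>, where the quotient is \<open>0 / 0\<close> at \<open>t = 0\<close>; for
  \<open>t > 0\<close> the factor multiplying the cosine is then \<open>exp (- t)\<close>.
\<close>

definition K_BS :: "real \<Rightarrow> real \<Rightarrow> real" where
  "K_BS r z = cont_at_0 (\<lambda>z. sin z / (pi * z)) z
     - 1 / pi * (LBINT t:{0<..}.
         cos (z * cosh t) * (sinh t * cosh t / ((sinh t)\<^sup>2 + r\<^sup>2) - 1) * sinh t)"

end

theory Submission
  imports Defs "HOL-Probability.Sinc_Integral" "HOL-Real_Asymp.Real_Asymp"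
begin

text \<open>
  The symbol of \<open>I - K\<close> vanishes for \<open>\<bar>k\<bar> < 1\<close> and equals \<open>k sqrt (k\<^sup>2 - 1) / (k\<^sup>2 - 1 + r\<^sup>2)\<close> for
  \<open>\<bar>k\<bar> > 1\<close>. Sampling the interval \<open>(0, 2s)\<close> at \<open>2M\<close> points of distance \<open>h = s / M\<close> replaces the
  Fredholm determinant by the determinant of a \<open>2M \<times> 2M\<close> Toeplitz matrix whose weight can be chosen
  to vanish on the arc \<open>\<bar>\<theta>\<bar> < h\<close> and to become, after \<open>cos (\<theta> / 2) = cos (h / 2) cos (\<phi> / 2)\<close>, a
  Bernstein-Szego weight in \<open>\<phi>\<close>. The matrix splits into a cosine and a sine block. In the orthogonal
  functions of the weight the first block is diagonal up to triangular factors and the second one is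
  tridiagonal with an elementary continuant, so the Toeplitz determinant is known in closed form.
  It tends to the Fredholm determinant, because a matrix determinant is the Fredholm series of a step
  kernel and Hadamard's inequality dominates the terms of these series.

  The sine form of the kernel is an integration by parts. For \<open>r = 1\<close> its numerator and the
  corresponding power series have the same Laplace transform, which identifies the derivative of the
  kernel with \<open>- J\<^sub>1(z) / (2z)\<close>; the kernel itself vanishes at infinity.
\<close>

section \<open>Hadamard's inequality\<close>

text \<open>Sampling \<open>K_BS\<close> itself would give Toeplitz matrices without a closed
  determinant. But the passage to the limit asks only for entries that are uniformly bounded and
  converge pointwise, so the discrete symbol can be chosen for solvability. With k^2 = 1 + p^2 the
  symbol times dk becomes p^2 / (p^2 + r^2) dp, a double zero and one pair of poles. Its periodic
  analogue is 4 \<beta> sin^2 (x / 2) / |1 - \<beta> e^(i x)|^2 dx, with \<beta> fixed by 1 -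
  \<beta> = r t (1 + \<beta>), t = sin (h / 2). The continuant has the characteristic roots (1 +
  t)^2 and (1 - t)^2, and this \<beta> shapes the corner entry so that their weights are (1 + r) / 2
  and (1 - r) / 2; in the limit these give cosh s + r sinh s. The Gaussian factor comes from the
  leading coefficients of the triangular factors, which are powers of cos (h / 2), and exp (- 2 r s)
  from the norms \<beta>^(2M). In the Bessel part the power series determines the function but hides
  its size at infinity. Integrability of J_1 (t) / t is therefore drawn from the oscillating sine
  integral.\<close>

abbreviation det_of :: "nat \<Rightarrow> (nat \<Rightarrow> nat \<Rightarrow> real) \<Rightarrow> real" where
  "det_of n f \<equiv> Determinant.det (Matrix.mat n n (\<lambda>(i, j). f i j))"

lemma det_of_cong:
  assumes "\<And>i j. i < n \<Longrightarrow> j < n \<Longrightarrow> f i j = g i j"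
  shows "det_of n f = det_of n g"
  using assms by (intro arg_cong[where f = Determinant.det]) (auto intro!: eq_matI)

lemma det_of_mult:
  "det_of n (\<lambda>i j. \<Sum>k<n. f i k * g k j) = det_of n f * det_of n g"
proof -
  have "Matrix.mat n n (\<lambda>(i, j). \<Sum>k<n. f i k * g k j)
      = Matrix.mat n n (\<lambda>(i, j). f i j) * Matrix.mat n n (\<lambda>(i, j). g i j)"
    by (rule eq_matI) (auto simp: scalar_prod_def lessThan_atLeast0)
  then show ?thesis
    by (simp add: det_mult[where n = n])
qed

lemma det_of_transpose: "det_of n (\<lambda>i j. f j i) = det_of n f"
proof -
  have "Matrix.mat n n (\<lambda>(i, j). f j i) = transpose_mat (Matrix.mat n n (\<lambda>(i, j). f i j))"
    by (rule eq_matI) auto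
  then show ?thesis
    by (simp add: Determinant.det_transpose[where n = n])
qed

lemma det_of_lower_triangular:
  assumes "\<And>i j. i < j \<Longrightarrow> j < n \<Longrightarrow> f i j = 0"
  shows "det_of n f = (\<Prod>i<n. f i i)"
proof -
  have "det_of n f = prod_list (diag_mat (Matrix.mat n n (\<lambda>(i, j). f i j)))"
    by (rule det_lower_triangular[where n = n]) (use assms in auto)
  also have "\<dots> = prod_list (map (\<lambda>i. f i i) [0..<n])"
    by (auto simp: diag_mat_def intro!: arg_cong[where f = prod_list])
  also have "\<dots> = (\<Prod>i<n. f i i)"
    by (simp add: prod.distinct_set_conv_list[symmetric] lessThan_atLeast0)
  finally show ?thesis .
qed

lemma det_of_upper_triangular:
  assumes "\<And>i j. i < j \<Longrightarrow> j < n \<Longrightarrow> f j i = 0"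
  shows "det_of n f = (\<Prod>i<n. f i i)"
  using det_of_lower_triangular[of n "\<lambda>i j. f j i"] assms det_of_transpose[of n f] by simp

lemma det_of_block_lower:
  assumes "\<And>i j. i < n \<Longrightarrow> j < m \<Longrightarrow> f i (n + j) = 0"
  shows "det_of (n + m) f = det_of n f * det_of m (\<lambda>i j. f (n + i) (n + j))"
proof -
  have "Matrix.mat (n + m) (n + m) (\<lambda>(i, j). f i j) =
     four_block_mat (Matrix.mat n n (\<lambda>(i, j). f i j)) (0\<^sub>m n m)
       (Matrix.mat m n (\<lambda>(i, j). f (n + i) j)) (Matrix.mat m m (\<lambda>(i, j). f (n + i) (n + j)))"
  proof (rule eq_matI)
    fix i j assume a: "i < dim_row (four_block_mat (Matrix.mat n n (\<lambda>(i, j). f i j)) (0\<^sub>m n m)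
       (Matrix.mat m n (\<lambda>(i, j). f (n + i) j)) (Matrix.mat m m (\<lambda>(i, j). f (n + i) (n + j))))"
      "j < dim_col (four_block_mat (Matrix.mat n n (\<lambda>(i, j). f i j)) (0\<^sub>m n m)
       (Matrix.mat m n (\<lambda>(i, j). f (n + i) j)) (Matrix.mat m m (\<lambda>(i, j). f (n + i) (n + j))))"
    show "Matrix.mat (n + m) (n + m) (\<lambda>(i, j). f i j) $$ (i, j) =
     four_block_mat (Matrix.mat n n (\<lambda>(i, j). f i j)) (0\<^sub>m n m)
       (Matrix.mat m n (\<lambda>(i, j). f (n + i) j)) (Matrix.mat m m (\<lambda>(i, j). f (n + i) (n + j))) $$ (i, j)"
      using a assms[of i "j - n"] by auto
  qed auto
  then show ?thesis
    by (simp add: det_four_block_mat_upper_right_zero[where n = n and m = m])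
qed

lemma det_of_1 [simp]: "det_of 1 f = f 0 0" "det_of (Suc 0) f = f 0 0"
  using det_of_lower_triangular[of 1 f] by auto

text \<open>Induction on the Schur complement of the last diagonal entry, which is again positive
  semidefinite and has a smaller diagonal. Nonnegativity of the diagonal is carried along so that
  the products compare factor by factor.\<close>

lemma psd_det_le_prod_diag:
  fixes B :: "nat \<Rightarrow> nat \<Rightarrow> real"
  assumes "\<And>i j. B i j = B j i"
    and "\<And>v. 0 \<le> (\<Sum>i<n. \<Sum>j<n. v i * v j * B i j)"
  shows "det_of n B \<le> (\<Prod>i<n. B i i) \<and> (\<forall>i<n. 0 \<le> B i i)"
  using assms
proof (induction n arbitrary: B)
  case 0
  then show ?case by (simp add: Determinant.det_def)
next
  case (Suc n)
  note sym = Suc.prems(1) and psd = Suc.prems(2)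
  have diag: "0 \<le> B i i" if "i < Suc n" for i
  proof -
    have "(\<Sum>k<Suc n. \<Sum>j<Suc n. (if k = i then 1 else 0) * (if j = i then 1 else 0) * B k j)
      = (\<Sum>k<Suc n. if k = i then \<Sum>j<Suc n. if j = i then B i i else 0 else 0)"
      by (intro sum.cong if_cong) (auto intro!: sum.cong simp: if_distrib[of "\<lambda>x. x * _"] cong: if_cong simp del: sum.lessThan_Suc)
    also have "\<dots> = B i i"
      using that by (simp add: sum.delta del: sum.lessThan_Suc)
    finally show ?thesis
      using psd[of "\<lambda>k. if k = i then 1 else 0"] by simp
  qed
  have quad: "(\<Sum>i<Suc n. \<Sum>j<Suc n. w i * w j * B i j)
      = (\<Sum>i<n. \<Sum>j<n. w i * w j * B i j) + 2 * w n * (\<Sum>i<n. w i * B i n) + (w n)\<^sup>2 * B n n" for w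
  proof -
    have "(\<Sum>i<Suc n. \<Sum>j<Suc n. w i * w j * B i j)
      = (\<Sum>i<n. \<Sum>j<n. w i * w j * B i j) + (\<Sum>i<n. w i * w n * B i n)
        + ((\<Sum>i<n. w n * w i * B n i) + w n * w n * B n n)"
      by (simp add: sum.distrib)
    moreover have "(\<Sum>i<n. w n * w i * B n i) = w n * (\<Sum>i<n. w i * B i n)"
      unfolding sum_distrib_left by (intro sum.cong) (auto simp: sym[of n])
    moreover have "(\<Sum>i<n. w i * w n * B i n) = w n * (\<Sum>i<n. w i * B i n)"
      unfolding sum_distrib_left by (intro sum.cong) auto
    ultimately show ?thesis by (simp add: power2_eq_square)
  qed
  show ?case
  proof (cases "B n n = 0")
    case True
    have "B i n = 0" if "i < n" for i
    proof (rule ccontr)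
      assume nz: "B i n \<noteq> 0"
      \<comment> \<open>With B n n = 0 the form at \<open>w\<close> is B i i + 2 x B i n; this
        \<open>x\<close> makes it - 1.\<close>
      define x where "x = - (B i i + 1) / (2 * B i n)"
      define w where "w = (\<lambda>k. if k = i then 1 else if k = n then x else (0::real))"
      have "(\<Sum>k<n. \<Sum>j<n. w k * w j * B k j) = (\<Sum>k<n. if k = i then \<Sum>j<n. if j = i then B i i else 0 else 0)"
        by (intro sum.cong if_cong) (auto simp: w_def if_distrib[of "\<lambda>x. x * _"] cong: if_cong intro!: sum.cong)
      also have "\<dots> = B i i" using that by simp
      finally have 1: "(\<Sum>k<n. \<Sum>j<n. w k * w j * B k j) = B i i" .
      have "(\<Sum>k<n. w k * B k n) = (\<Sum>k<n. if k = i then B i n else 0)"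
        by (intro sum.cong) (auto simp: w_def)
      also have "\<dots> = B i n" using that by simp
      finally have 2: "(\<Sum>k<n. w k * B k n) = B i n" .
      have "0 \<le> B i i + 2 * x * B i n"
        using psd[of w] that unfolding quad 1 2 True by (simp add: w_def)
      also have "\<dots> = - 1" using nz by (simp add: x_def field_simps)
      finally show False by simp
    qed
    then have "det_of (Suc n) B = det_of n B * det_of 1 (\<lambda>i j. B (n + i) (n + j))"
      using det_of_block_lower[of n 1 B] by simp
    then show ?thesis using True diag by simp
  next
    case False
    with diag[of n] have pos: "0 < B n n" by simp
    \<comment> \<open>\<open>C\<close> is the Schur complement. B = U X with \<open>U\<close> unit
      upper triangular, and the last column of \<open>X\<close> vanishes above the corner.\<close>
    define C where "C = (\<lambda>i j. B i j - B i n * B n j / B n n)"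
    define U where "U = (\<lambda>i k. if k = i then 1 else if k = n then B i n / B n n else (0::real))"
    define X where "X = (\<lambda>k j. if k = n then B n j else C k j)"
    have symC: "C i j = C j i" for i j
      using sym[of i j] sym[of i n] sym[of j n] by (simp add: C_def)
    have psdC: "0 \<le> (\<Sum>i<n. \<Sum>j<n. v i * v j * C i j)" for v
    proof -
      define S where "S = (\<Sum>i<n. v i * B i n)"
      \<comment> \<open>Minimising the form of \<open>B\<close> over the last coordinate leaves the
        form of \<open>C\<close> at \<open>v\<close>.\<close>
      define w where "w = (\<lambda>i. if i = n then - S / B n n else v i)"
      have "(\<Sum>i<n. \<Sum>j<n. w i * w j * B i j) = (\<Sum>i<n. \<Sum>j<n. v i * v j * B i j)"
        by (intro sum.cong) (auto simp: w_def)
      moreover have "(\<Sum>i<n. w i * B i n) = S"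
        unfolding S_def by (intro sum.cong) (auto simp: w_def)
      ultimately have "0 \<le> (\<Sum>i<n. \<Sum>j<n. v i * v j * B i j) - S * S / B n n"
        using psd[of w] pos unfolding quad by (simp add: w_def power2_eq_square field_simps)
      also have "S * S = (\<Sum>i<n. \<Sum>j<n. (v i * B i n) * (v j * B j n))"
        unfolding S_def sum_product by simp
      also have "(\<Sum>i<n. \<Sum>j<n. v i * v j * B i j) - (\<Sum>i<n. \<Sum>j<n. (v i * B i n) * (v j * B j n)) / B n n
         = (\<Sum>i<n. \<Sum>j<n. v i * v j * C i j)"
        unfolding sum_divide_distrib sum_subtractf[symmetric]
      proof (intro sum.cong refl)
        fix i j
        show "v i * v j * B i j - v i * B i n * (v j * B j n) / B n n = v i * v j * C i j"
          using sym[of n j] by (simp add: C_def right_diff_distrib)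
      qed
      finally show ?thesis .
    qed
    have "det_of (Suc n) B = det_of (Suc n) (\<lambda>i j. \<Sum>k<Suc n. U i k * X k j)"
    proof (rule det_of_cong)
      fix i j assume "i < Suc n" "j < Suc n"
      show "B i j = (\<Sum>k<Suc n. U i k * X k j)"
      proof (cases "i = n")
        case True
        then have "(\<Sum>k<n. U i k * X k j) = 0" by (intro sum.neutral) (auto simp: U_def)
        then show ?thesis using True by (simp add: U_def X_def)
      next
        case i: False
        have "(\<Sum>k<n. U i k * X k j) = (\<Sum>k<n. if k = i then C i j else 0)"
          by (intro sum.cong) (auto simp: U_def X_def)
        also have "\<dots> = C i j" using i \<open>i < Suc n\<close> by simp
        finally show ?thesis using i by (simp add: U_def X_def C_def)
      qed
    qed
    also have "\<dots> = det_of (Suc n) U * det_of (Suc n) X" by (rule det_of_mult)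
    also have "det_of (Suc n) U = 1"
      by (subst det_of_upper_triangular) (auto simp: U_def)
    also have "det_of (Suc n) X = det_of n X * det_of 1 (\<lambda>i j. X (n + i) (n + j))"
      using det_of_block_lower[of n 1 X] False by (simp add: X_def C_def)
    also have "det_of n X = det_of n C"
      by (rule det_of_cong) (auto simp: X_def)
    also have "1 * (det_of n C * det_of 1 (\<lambda>i j. X (n + i) (n + j))) = det_of n C * B n n"
      by (simp add: X_def)
    finally have "det_of (Suc n) B = det_of n C * B n n" .
    moreover have IH: "det_of n C \<le> (\<Prod>i<n. C i i)" "\<forall>i<n. 0 \<le> C i i"
      using Suc.IH[of C, OF symC psdC] by auto
    have "(\<Prod>i<n. C i i) \<le> (\<Prod>i<n. B i i)"
    proof (rule prod_mono)
      fix i assume "i \<in> {..<n}"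
      moreover have "0 \<le> B i n * B n i / B n n"
        using pos by (simp add: sym[of i n])
      ultimately show "0 \<le> C i i \<and> C i i \<le> B i i"
        using IH(2) by (simp add: C_def)
    qed
    ultimately show ?thesis
      using IH(1) pos diag by (auto intro!: mult_right_mono)
  qed
qed

text \<open>The Gram matrix of the rows has determinant (det)^2 and diagonal at most C^2 n. The
  resulting n^(n/2), against the n! of the Leibniz sum, is what the 1 / n! of the Fredholm series
  can absorb.\<close>

theorem Hadamard_bound:
  assumes "\<And>i j. i < n \<Longrightarrow> j < n \<Longrightarrow> \<bar>f i j\<bar> \<le> C"
  shows "\<bar>det_of n f\<bar> \<le> (C * sqrt n) ^ n"
proof (cases "n = 0")
  case True
  then show ?thesis by (simp add: Determinant.det_def)
next
  case False
  then have C: "0 \<le> C" using assms[of 0 0] by linarith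
  define B where "B = (\<lambda>i j. \<Sum>k<n. f i k * f j k)"
  have 1: "(det_of n f)\<^sup>2 = det_of n B"
    using det_of_mult[of n f "\<lambda>i j. f j i"] det_of_transpose[of n f]
    by (simp add: B_def power2_eq_square)
  have 2: "det_of n B \<le> (\<Prod>i<n. B i i)"
  proof (rule psd_det_le_prod_diag[THEN conjunct1])
    show "B i j = B j i" for i j by (simp add: B_def mult.commute)
    fix v
    have "(\<Sum>i<n. \<Sum>j<n. v i * v j * B i j) = (\<Sum>i<n. \<Sum>j<n. \<Sum>k<n. (v i * f i k) * (v j * f j k))"
      unfolding B_def sum_distrib_left by (intro sum.cong) auto
    also have "\<dots> = (\<Sum>i<n. \<Sum>k<n. \<Sum>j<n. (v i * f i k) * (v j * f j k))"
      by (intro sum.cong refl sum.swap)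
    also have "\<dots> = (\<Sum>k<n. \<Sum>i<n. \<Sum>j<n. (v i * f i k) * (v j * f j k))"
      by (rule sum.swap)
    also have "\<dots> = (\<Sum>k<n. (\<Sum>i<n. v i * f i k)\<^sup>2)"
      by (simp add: power2_eq_square sum_product)
    finally show "0 \<le> (\<Sum>i<n. \<Sum>j<n. v i * v j * B i j)"
      by (simp add: sum_nonneg)
  qed
  have 3: "(\<Prod>i<n. B i i) \<le> (\<Prod>i<n. C\<^sup>2 * n)"
  proof (rule prod_mono)
    fix i assume i: "i \<in> {..<n}"
    have "B i i \<le> (\<Sum>k<n. C\<^sup>2)"
      unfolding B_def
    proof (rule sum_mono)
      fix k assume "k \<in> {..<n}"
      then have "\<bar>f i k\<bar> \<le> C" using i assms by auto
      then have "\<bar>f i k\<bar>\<^sup>2 \<le> C\<^sup>2" by (intro power_mono) auto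
      then show "f i k * f i k \<le> C\<^sup>2" by (simp add: power2_eq_square)
    qed
    then show "0 \<le> B i i \<and> B i i \<le> C\<^sup>2 * n" by (auto simp: B_def mult.commute sum_nonneg)
  qed
  have 4: "((C * sqrt n) ^ n)\<^sup>2 = (C\<^sup>2 * n) ^ n"
  proof -
    have "((C * sqrt n) ^ n)\<^sup>2 = ((C * sqrt n)\<^sup>2) ^ n"
      by (simp only: power_mult[symmetric] mult.commute)
    then show ?thesis by (simp add: power_mult_distrib)
  qed
  have "(det_of n f)\<^sup>2 \<le> ((C * sqrt n) ^ n)\<^sup>2"
    using 2 3 unfolding 1 4 by simp
  then show ?thesis
    using power2_le_imp_le[of "\<bar>det_of n f\<bar>" "(C * sqrt n) ^ n"] C by (simp only: power2_abs) simp
qed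

section \<open>Principal minors\<close>

lemma det_of_Leibniz:
  "det_of n f = (\<Sum>p | p permutes {..<n}. of_int (sign p) * (\<Prod>i<n. f i (p i)))"
proof -
  have "det_of n f = (\<Sum>p | p permutes {0..<n}. of_int (sign p) *
      (\<Prod>i = 0..<n. Matrix.mat n n (\<lambda>(i, j). f i j) $$ (i, p i)))"
    by (rule det_def') auto
  also have "\<dots> = (\<Sum>p | p permutes {0..<n}. of_int (sign p) * (\<Prod>i = 0..<n. f i (p i)))"
  proof (intro sum.cong refl arg_cong[where f = "\<lambda>x. _ * x"] prod.cong)
    fix p i assume "p \<in> {p. p permutes {0..<n}}" "i \<in> {0..<n}"
    then show "Matrix.mat n n (\<lambda>(i, j). f i j) $$ (i, p i) = f i (p i)"
      using permutes_in_image[of p "{0..<n}" i] by auto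
  qed
  finally show ?thesis by (simp add: lessThan_atLeast0)
qed

text \<open>\<open>det_of\<close> is indexed by initial segments; the Leibniz sum makes sense for
  every finite \<open>S\<close> and avoids choosing an enumeration of it.\<close>

definition principal_minor :: "nat set \<Rightarrow> (nat \<Rightarrow> nat \<Rightarrow> real) \<Rightarrow> real" where
  "principal_minor S f = (\<Sum>p | p permutes S. of_int (sign p) * (\<Prod>i\<in>S. f i (p i)))"

text \<open>Conjugation by the enumeration carries permutations of {..<n} to permutations of
  \<open>S\<close> with the same sign, so the order of the enumeration does not matter.\<close>

lemma det_of_reindex:
  assumes x: "bij_betw x {..<n} S"
  shows "det_of n (\<lambda>i j. f (x i) (x j)) = principal_minor S f"
proof -
  define y where "y = inv_into {..<n} x"
  have y: "bij_betw y S {..<n}" unfolding y_def using x by (rule bij_betw_inv_into)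
  have inj: "inj_on x {..<n}" "inj_on y S" using x y by (auto simp: bij_betw_def)
  have yx: "y (x i) = i" if "i < n" for i
    using that inj by (simp add: y_def)
  have xy: "x (y i) = i" if "i \<in> S" for i
    using that x by (simp add: y_def bij_betw_inv_into_right)
  show ?thesis
    unfolding det_of_Leibniz principal_minor_def
  proof (rule sum.reindex_bij_witness[where j = "map_permutation {..<n} x" and i = "map_permutation S y"])
    fix p assume "p \<in> {p. p permutes {..<n}}"
    then have p: "p permutes {..<n}" by simp
    show "map_permutation S y (map_permutation {..<n} x p) = p"
      using x inj yx p by (intro map_permutation_compose_inv[of x "{..<n}" S]) auto
    show "map_permutation {..<n} x p \<in> {p. p permutes S}"
      using map_permutation_permutes[OF x p] by simp
    have "(\<Prod>i\<in>S. f i (map_permutation {..<n} x p i))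
        = (\<Prod>i<n. f (x i) (map_permutation {..<n} x p (x i)))"
      by (rule prod.reindex_bij_betw[OF x, symmetric])
    also have "\<dots> = (\<Prod>i<n. f (x i) (x (p i)))"
      using inj by (intro prod.cong) (auto simp: map_permutation_apply)
    finally show "of_int (sign (map_permutation {..<n} x p)) * (\<Prod>i\<in>S. f i (map_permutation {..<n} x p i))
        = of_int (sign p) * (\<Prod>i<n. f (x i) (x (p i)))"
      using inj p by (simp add: sign_map_permutation)
  next
    fix p assume "p \<in> {p. p permutes S}"
    then have p: "p permutes S" by simp
    show "map_permutation {..<n} x (map_permutation S y p) = p"
      using y inj xy p by (intro map_permutation_compose_inv[of y S "{..<n}"]) auto
    show "map_permutation S y p \<in> {p. p permutes {..<n}}"
      using map_permutation_permutes[OF y p] by simp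
  qed
qed

text \<open>Multiplying out each Leibniz product selects the set \<open>S\<close> of rows that take
  their entry from \<open>f\<close>. The other rows take the identity, which kills every permutation
  moving a point outside \<open>S\<close>.\<close>

lemma det_of_one_plus:
  "det_of N (\<lambda>i j. (if i = j then 1 else 0) + f i j) = (\<Sum>S\<in>Pow {..<N}. principal_minor S f)"
proof -
  have "det_of N (\<lambda>i j. (if i = j then 1 else 0) + f i j)
     = (\<Sum>p | p permutes {..<N}. of_int (sign p) * (\<Prod>i<N. f i (p i) + (if i = p i then 1 else 0)))"
    unfolding det_of_Leibniz by (simp add: add.commute)
  also have "\<dots> = (\<Sum>p | p permutes {..<N}. \<Sum>S\<in>Pow {..<N}.
      of_int (sign p) * ((\<Prod>i\<in>S. f i (p i)) * (\<Prod>i\<in>{..<N} - S. if i = p i then 1 else 0)))"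
    by (simp add: prod_add sum_distrib_left)
  also have "\<dots> = (\<Sum>S\<in>Pow {..<N}. \<Sum>p | p permutes {..<N}.
      of_int (sign p) * ((\<Prod>i\<in>S. f i (p i)) * (\<Prod>i\<in>{..<N} - S. if i = p i then 1 else 0)))"
    by (rule sum.swap)
  also have "\<dots> = (\<Sum>S\<in>Pow {..<N}. principal_minor S f)"
    unfolding principal_minor_def
  proof (intro sum.cong[OF refl] sum.mono_neutral_cong_right ballI)
    fix S assume S: "S \<in> Pow {..<N}"
    show "finite {p. p permutes {..<N}}" by (simp add: finite_permutations)
    show "{p. p permutes S} \<subseteq> {p. p permutes {..<N}}"
      using S by (auto intro: permutes_subset)
    fix p assume "p \<in> {p. p permutes {..<N}} - {p. p permutes S}"
    then have p: "p permutes {..<N}" "\<not> p permutes S" by auto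
    have "\<exists>i\<in>{..<N} - S. i \<noteq> p i"
      using permutes_superset[OF p(1), of S] p(2) by metis
    then have "(\<Prod>i\<in>{..<N} - S. if i = p i then 1 else 0) = (0::real)"
      by (intro prod_zero) auto
    then show "of_int (sign p) * ((\<Prod>i\<in>S. f i (p i)) * (\<Prod>i\<in>{..<N} - S. if i = p i then 1 else 0)) = 0"
      by simp
  next
    fix S :: "nat set" and p assume "p \<in> {p. p permutes S}"
    then have "(\<Prod>i\<in>{..<N} - S. if i = p i then 1 else 0) = (1::real)"
      by (intro prod.neutral) (auto simp: permutes_not_in)
    then show "of_int (sign p) * ((\<Prod>i\<in>S. f i (p i)) * (\<Prod>i\<in>{..<N} - S. if i = p i then 1 else 0))
      = of_int (sign p) * (\<Prod>i\<in>S. f i (p i))"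
      by simp
  qed
  finally show ?thesis .
qed

lemma det_of_eq_0_if_not_inj:
  assumes "\<not> inj_on x {..<n}"
  shows "det_of n (\<lambda>i j. f (x i) (x j)) = 0"
proof -
  obtain i j where ij: "i < n" "j < n" "i \<noteq> j" "x i = x j"
    using assms by (auto simp: inj_on_def)
  show ?thesis
    by (rule det_identical_rows[where n = n and i = i and j = j]) (use ij in \<open>auto simp: Matrix.row_def\<close>)
qed

text \<open>A set of size n has n! injective enumerations with equal determinants, and a repeated
  index gives equal rows. All tuples are kept because they index the cells of an n-dimensional
  grid.\<close>

lemma sum_principal_minors:
  "(\<Sum>x\<in>{..<n} \<rightarrow>\<^sub>E {..<N}. det_of n (\<lambda>i j. f (x i) (x j)))
     = fact n * (\<Sum>S | S \<subseteq> {..<N} \<and> card S = n. principal_minor S f)"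
proof -
  define X where "X = (\<lambda>S::nat set. {x \<in> {..<n} \<rightarrow>\<^sub>E S. inj_on x {..<n}})"
  define \<S> where "\<S> = {S. S \<subseteq> {..<N} \<and> card S = n}"
  have finS: "finite \<S>" unfolding \<S>_def by (rule finite_subset[of _ "Pow {..<N}"]) auto
  have finSS: "finite S" if "S \<in> \<S>" for S
    using that by (auto simp: \<S>_def intro: finite_subset)
  have bij: "bij_betw x {..<n} S" if "x \<in> X S" "S \<in> \<S>" for x S
  proof -
    have "x ` {..<n} \<subseteq> S" using that(1) by (auto simp: X_def)
    moreover have "card (x ` {..<n}) = card S"
      using that by (simp add: X_def \<S>_def card_image)
    ultimately have "x ` {..<n} = S" using finSS[OF that(2)] by (simp add: card_subset_eq)
    then show ?thesis using that(1) by (simp add: X_def bij_betw_def)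
  qed
  have "(\<Sum>x\<in>{..<n} \<rightarrow>\<^sub>E {..<N}. det_of n (\<lambda>i j. f (x i) (x j)))
      = (\<Sum>x\<in>(\<Union>S\<in>\<S>. X S). det_of n (\<lambda>i j. f (x i) (x j)))"
  proof (rule sum.mono_neutral_right)
    show "finite ({..<n} \<rightarrow>\<^sub>E {..<N})" by (intro finite_PiE) auto
    show "(\<Union>S\<in>\<S>. X S) \<subseteq> {..<n} \<rightarrow>\<^sub>E {..<N}"
    proof
      fix x assume "x \<in> (\<Union>S\<in>\<S>. X S)"
      then obtain S where "S \<subseteq> {..<N}" "x \<in> {..<n} \<rightarrow>\<^sub>E S" by (auto simp: \<S>_def X_def)
      then show "x \<in> {..<n} \<rightarrow>\<^sub>E {..<N}" using PiE_mono[of "{..<n}" "\<lambda>_. S" "\<lambda>_. {..<N}"] by auto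
    qed
    show "\<forall>x\<in>({..<n} \<rightarrow>\<^sub>E {..<N}) - (\<Union>S\<in>\<S>. X S). det_of n (\<lambda>i j. f (x i) (x j)) = 0"
    proof
      fix x assume x: "x \<in> ({..<n} \<rightarrow>\<^sub>E {..<N}) - (\<Union>S\<in>\<S>. X S)"
      have "\<not> inj_on x {..<n}"
      proof
        assume inj: "inj_on x {..<n}"
        then have "x \<in> X (x ` {..<n})" "x ` {..<n} \<in> \<S>"
          using x by (auto simp: X_def \<S>_def card_image PiE_iff)
        then show False using x by blast
      qed
      then show "det_of n (\<lambda>i j. f (x i) (x j)) = 0"
        by (rule det_of_eq_0_if_not_inj)
    qed
  qed
  also have "\<dots> = (\<Sum>S\<in>\<S>. \<Sum>x\<in>X S. det_of n (\<lambda>i j. f (x i) (x j)))"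
  proof (rule sum.UNION_disjoint[OF finS])
    show "\<forall>S\<in>\<S>. finite (X S)"
    proof
      fix S assume "S \<in> \<S>"
      then have "finite ({..<n} \<rightarrow>\<^sub>E S)" using finSS by (intro finite_PiE) auto
      then show "finite (X S)" by (rule rev_finite_subset) (auto simp: X_def)
    qed
    show "\<forall>S\<in>\<S>. \<forall>S'\<in>\<S>. S \<noteq> S' \<longrightarrow> X S \<inter> X S' = {}"
    proof (intro ballI impI)
      fix S S' assume S: "S \<in> \<S>" "S' \<in> \<S>" "S \<noteq> S'"
      show "X S \<inter> X S' = {}"
      proof (rule ccontr)
        assume "X S \<inter> X S' \<noteq> {}"
        then obtain x where "x \<in> X S" "x \<in> X S'" by auto
        then show False using bij[of x S] bij[of x S'] S by (auto simp: bij_betw_def)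
      qed
    qed
  qed
  also have "\<dots> = (\<Sum>S\<in>\<S>. fact n * principal_minor S f)"
  proof (rule sum.cong[OF refl])
    fix S assume S: "S \<in> \<S>"
    have "(\<Sum>x\<in>X S. det_of n (\<lambda>i j. f (x i) (x j))) = (\<Sum>x\<in>X S. principal_minor S f)"
      using bij S by (intro sum.cong refl det_of_reindex)
    moreover have "card (X S) = fact n"
      using card_inj_on_subset_funcset[of "{..<n}" S "{..<n}"] finSS[OF S] S
      by (simp add: X_def \<S>_def fact_prod_rev)
    ultimately show "(\<Sum>x\<in>X S. det_of n (\<lambda>i j. f (x i) (x j))) = fact n * principal_minor S f"
      by simp
  qed
  finally show ?thesis unfolding \<S>_def by (simp add: sum_distrib_left)
qed

lemma principal_minor_scale:
  "principal_minor S (\<lambda>i j. c * f i j) = c ^ card S * principal_minor S f"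
  unfolding principal_minor_def sum_distrib_left by (intro sum.cong) (auto simp: prod.distrib)

text \<open>The right-hand side is a Fredholm series read on a grid: h^n is the volume of a cell,
  and the sum runs over all cells.\<close>

theorem det_of_one_minus_expansion:
  "det_of N (\<lambda>i j. (if i = j then 1 else 0) - h * f i j)
   = (\<Sum>n\<le>N. (- 1) ^ n / fact n * (h ^ n * (\<Sum>x\<in>{..<n} \<rightarrow>\<^sub>E {..<N}. det_of n (\<lambda>i j. f (x i) (x j)))))"
proof -
  have "det_of N (\<lambda>i j. (if i = j then 1 else 0) - h * f i j)
      = (\<Sum>S\<in>Pow {..<N}. (- h) ^ card S * principal_minor S f)"
    using det_of_one_plus[of N "\<lambda>i j. - h * f i j"] by (simp only: principal_minor_scale) simp
  also have "\<dots> = (\<Sum>n\<le>N. \<Sum>S\<in>{S \<in> Pow {..<N}. card S = n}. (- h) ^ card S * principal_minor S f)"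
    by (rule sum.group[symmetric]) (auto intro: order.trans[OF card_mono[of "{..<N}"]])
  also have "\<dots> = (\<Sum>n\<le>N. (- h) ^ n * (\<Sum>S | S \<subseteq> {..<N} \<and> card S = n. principal_minor S f))"
    unfolding sum_distrib_left by (intro sum.cong) auto
  also have "\<dots> = (\<Sum>n\<le>N. (- 1) ^ n / fact n * (h ^ n * (\<Sum>x\<in>{..<n} \<rightarrow>\<^sub>E {..<N}. det_of n (\<lambda>i j. f (x i) (x j)))))"
  proof (intro sum.cong refl)
    fix n
    have "(- h) ^ n = (- 1) ^ n * h ^ n" by (rule power_minus)
    then show "(- h) ^ n * (\<Sum>S | S \<subseteq> {..<N} \<and> card S = n. principal_minor S f) =
      (- 1) ^ n / fact n * (h ^ n * (\<Sum>x\<in>{..<n} \<rightarrow>\<^sub>E {..<N}. det_of n (\<lambda>i j. f (x i) (x j))))"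
      unfolding sum_principal_minors by simp
  qed
  finally show ?thesis .
qed

section \<open>Fredholm determinants as limits of matrix determinants\<close>

definition grid_index :: "real \<Rightarrow> nat \<Rightarrow> real \<Rightarrow> nat" where
  "grid_index T N x = nat \<lfloor>x * N / T\<rfloor>"

definition grid_cell :: "real \<Rightarrow> nat \<Rightarrow> nat \<Rightarrow> real set" where
  "grid_cell T N i = {x \<in> {0<..<T}. grid_index T N x = i}"

lemma grid_index_less:
  assumes "0 < x" "x < T"
  shows "grid_index T N x < N \<or> N = 0"
proof (cases "N = 0")
  case False
  with assms have "x * N / T < N" by (simp add: field_simps)
  moreover have "0 \<le> x * N / T" using assms by simp
  ultimately show ?thesis unfolding grid_index_def by linarith
qed auto

lemma grid_index_bounds:
  assumes "0 < T" "0 < N" "0 < x"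
  shows "grid_index T N x * (T / N) \<le> x" "x < (real (grid_index T N x) + 1) * (T / N)"
proof -
  have "0 \<le> x * N / T" using assms by simp
  then have "real (grid_index T N x) \<le> x * N / T" "x * N / T < real (grid_index T N x) + 1"
    unfolding grid_index_def by linarith+
  then show "grid_index T N x * (T / N) \<le> x" "x < (real (grid_index T N x) + 1) * (T / N)"
    using assms by (simp_all add: field_simps)
qed

text \<open>The interval is open, so the cell at 0 lacks its left endpoint; its length is T / N like
  that of the others.\<close>

lemma grid_cell_eq:
  assumes "0 < T" "i < N"
  shows "grid_cell T N i = (if i = 0 then {0<..<T / N} else {real i * (T / N)..<(real i + 1) * (T / N)})"
proof -
  have N: "0 < real N" using assms by simp
  have iff: "grid_index T N x = i \<longleftrightarrow> real i * (T / N) \<le> x \<and> x < (real i + 1) * (T / N)" if "0 < x" for x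
  proof
    assume "grid_index T N x = i"
    then show "real i * (T / N) \<le> x \<and> x < (real i + 1) * (T / N)"
      using grid_index_bounds[of T N x] assms that by auto
  next
    assume "real i * (T / N) \<le> x \<and> x < (real i + 1) * (T / N)"
    then have "real i \<le> x * N / T" "x * N / T < real i + 1"
      using assms N by (simp_all add: field_simps)
    then show "grid_index T N x = i" unfolding grid_index_def by linarith
  qed
  have lt: "x < T" if "x < (real i + 1) * (T / N)" for x
  proof -
    have "(real i + 1) * (T / N) \<le> N * (T / N)"
      using assms by (intro mult_right_mono) auto
    then show ?thesis using that N by simp
  qed
  have gt: "0 < x" if "i \<noteq> 0" "real i * (T / N) \<le> x" for x
  proof -
    have "0 < real i * (T / N)" using assms that N by simp
    then show ?thesis using that by linarith
  qed
  show ?thesis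
  proof (rule Set.set_eqI)
    fix x
    show "x \<in> grid_cell T N i \<longleftrightarrow> x \<in> (if i = 0 then {0<..<T / N} else {real i * (T / N)..<(real i + 1) * (T / N)})"
      using iff[of x] lt[of x] gt[of x] unfolding grid_cell_def by (cases "0 < x"; cases "i = 0") auto
  qed
qed

context
  fixes T :: real and M :: "real measure"
  assumes T: "0 < T" and M_def: "M = restrict_space lborel {0<..<T}"
begin

lemma finite_measure_M: "finite_measure M"
  unfolding M_def by (intro finite_measureI) (use T in \<open>simp add: emeasure_restrict_space space_restrict_space\<close>)

lemma product_M: "product_sigma_finite (\<lambda>_::nat. M)"
  using finite_measure_M by (intro product_sigma_finite.intro) (simp add: finite_measure.axioms)

lemma finite_measure_PiM: "finite_measure (Pi\<^sub>M {..<n::nat} (\<lambda>_. M))"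
proof (intro finite_measureI)
  have "emeasure (Pi\<^sub>M {..<n} (\<lambda>_. M)) (space (Pi\<^sub>M {..<n} (\<lambda>_. M))) = (\<Prod>i<n. emeasure M (space M))"
    unfolding space_PiM by (rule product_sigma_finite.emeasure_PiM[OF product_M]) auto
  then show "emeasure (Pi\<^sub>M {..<n} (\<lambda>_. M)) (space (Pi\<^sub>M {..<n} (\<lambda>_. M))) \<noteq> \<infinity>"
    using finite_measure.emeasure_finite[OF finite_measure_M] by (simp add: power_eq_top_ennreal)
qed

lemma grid_cell_measure:
  assumes "i < N"
  shows "grid_cell T N i \<in> sets M" "emeasure M (grid_cell T N i) = ennreal (T / N)"
proof -
  have sub: "grid_cell T N i \<subseteq> {0<..<T}" by (auto simp: grid_cell_def)
  have meas: "grid_cell T N i \<in> sets lborel" using assms T by (simp add: grid_cell_eq)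
  show "grid_cell T N i \<in> sets M"
    unfolding M_def using sub meas by (simp add: sets_restrict_space_iff)
  have "emeasure M (grid_cell T N i) = emeasure lborel (grid_cell T N i)"
    unfolding M_def using sub by (intro emeasure_restrict_space) auto
  also have "\<dots> = ennreal (T / N)"
  proof -
    have "real i * (T / N) \<le> (real i + 1) * (T / N)" using T by (intro mult_right_mono) auto
    then show ?thesis using assms T by (auto simp: grid_cell_eq algebra_simps add_divide_distrib)
  qed
  finally show "emeasure M (grid_cell T N i) = ennreal (T / N)" .
qed

lemma grid_box_measure:
  assumes "c \<in> {..<n} \<rightarrow>\<^sub>E {..<N}"
  shows "Pi\<^sub>E {..<n} (\<lambda>i. grid_cell T N (c i)) \<in> sets (Pi\<^sub>M {..<n} (\<lambda>_. M))"
    "emeasure (Pi\<^sub>M {..<n} (\<lambda>_. M)) (Pi\<^sub>E {..<n} (\<lambda>i. grid_cell T N (c i))) = ennreal ((T / N) ^ n)"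
proof -
  have c: "c i < N" if "i < n" for i using assms that by auto
  show "Pi\<^sub>E {..<n} (\<lambda>i. grid_cell T N (c i)) \<in> sets (Pi\<^sub>M {..<n} (\<lambda>_. M))"
    using c grid_cell_measure by (intro sets_PiM_I_finite) auto
  have "emeasure (Pi\<^sub>M {..<n} (\<lambda>_. M)) (Pi\<^sub>E {..<n} (\<lambda>i. grid_cell T N (c i)))
      = (\<Prod>i<n. emeasure M (grid_cell T N (c i)))"
    using c grid_cell_measure by (intro product_sigma_finite.emeasure_PiM[OF product_M]) auto
  also have "\<dots> = (\<Prod>i<n. ennreal (T / N))"
    using c grid_cell_measure by (intro prod.cong) auto
  finally show "emeasure (Pi\<^sub>M {..<n} (\<lambda>_. M)) (Pi\<^sub>E {..<n} (\<lambda>i. grid_cell T N (c i))) = ennreal ((T / N) ^ n)"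
    using T by (simp add: ennreal_power)
qed

text \<open>The integrand is constant on each product cell; as a finite combination of indicators it
  is measurable and is integrated by adding volumes.\<close>

lemma step_function_eq:
  assumes N: "0 < N" and x: "x \<in> space (Pi\<^sub>M {..<n} (\<lambda>_. M))"
  shows "det_of n (\<lambda>i j. f (grid_index T N (x i)) (grid_index T N (x j)))
    = (\<Sum>c\<in>{..<n} \<rightarrow>\<^sub>E {..<N}. det_of n (\<lambda>i j. f (c i) (c j)) *
         indicator (Pi\<^sub>E {..<n} (\<lambda>i. grid_cell T N (c i))) x)"
proof -
  define c0 where "c0 = (\<lambda>i\<in>{..<n}. grid_index T N (x i))"
  have x': "x i \<in> {0<..<T}" if "i < n" for i
    using x that by (auto simp: space_PiM M_def space_restrict_space PiE_iff)
  have ext: "x \<in> extensional {..<n}" using x by (auto simp: space_PiM PiE_iff)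
  have c0: "c0 \<in> {..<n} \<rightarrow>\<^sub>E {..<N}"
  proof (rule PiE_I)
    fix i assume "i \<in> {..<n}"
    then show "c0 i \<in> {..<N}"
      using x'[of i] grid_index_less[of "x i" T N] N by (simp add: c0_def)
  qed (simp add: c0_def)
  have ind: "x \<in> Pi\<^sub>E {..<n} (\<lambda>i. grid_cell T N (c i)) \<longleftrightarrow> c = c0" if "c \<in> {..<n} \<rightarrow>\<^sub>E {..<N}" for c
  proof
    assume "x \<in> Pi\<^sub>E {..<n} (\<lambda>i. grid_cell T N (c i))"
    then have "c i = c0 i" if "i < n" for i
      using that by (auto simp: PiE_iff grid_cell_def c0_def)
    then show "c = c0" using that c0 by (intro PiE_ext) auto
  next
    assume "c = c0"
    then show "x \<in> Pi\<^sub>E {..<n} (\<lambda>i. grid_cell T N (c i))"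
      using x' ext by (auto simp: PiE_iff grid_cell_def c0_def)
  qed
  have fin: "finite ({..<n} \<rightarrow>\<^sub>E {..<N})" by (intro finite_PiE) auto
  have "(\<Sum>c\<in>{..<n} \<rightarrow>\<^sub>E {..<N}. det_of n (\<lambda>i j. f (c i) (c j)) *
         indicator (Pi\<^sub>E {..<n} (\<lambda>i. grid_cell T N (c i))) x)
      = (\<Sum>c\<in>{..<n} \<rightarrow>\<^sub>E {..<N}. if c = c0 then det_of n (\<lambda>i j. f (c0 i) (c0 j)) else 0)"
    using ind by (intro sum.cong) (auto simp: indicator_def)
  also have "\<dots> = det_of n (\<lambda>i j. f (c0 i) (c0 j))"
    using fin c0 by simp
  also have "\<dots> = det_of n (\<lambda>i j. f (grid_index T N (x i)) (grid_index T N (x j)))"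
    by (rule det_of_cong) (simp add: c0_def)
  finally show ?thesis by simp
qed

lemma step_function_measurable:
  assumes "0 < N"
  shows "(\<lambda>x. det_of n (\<lambda>i j. f (grid_index T N (x i)) (grid_index T N (x j))))
     \<in> borel_measurable (Pi\<^sub>M {..<n} (\<lambda>_. M))"
proof (subst measurable_cong[OF step_function_eq[OF assms]])
  show "(\<lambda>x. \<Sum>c\<in>{..<n} \<rightarrow>\<^sub>E {..<N}. det_of n (\<lambda>i j. f (c i) (c j)) *
         indicator (Pi\<^sub>E {..<n} (\<lambda>i. grid_cell T N (c i))) x) \<in> borel_measurable (Pi\<^sub>M {..<n} (\<lambda>_. M))"
    using grid_box_measure(1) by (intro borel_measurable_sum borel_measurable_times borel_measurable_const borel_measurable_indicator)
qed

lemma fredholm_term_step: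
  assumes N: "0 < N"
  shows "fredholm_term {0<..<T} (\<lambda>x y. f (grid_index T N x) (grid_index T N y)) n
    = (- 1) ^ n / fact n * ((T / N) ^ n * (\<Sum>c\<in>{..<n} \<rightarrow>\<^sub>E {..<N}. det_of n (\<lambda>i j. f (c i) (c j))))"
proof -
  let ?P = "Pi\<^sub>M {..<n} (\<lambda>_. M)"
  have "(LINT x|?P. det_of n (\<lambda>i j. f (grid_index T N (x i)) (grid_index T N (x j))))
     = (LINT x|?P. (\<Sum>c\<in>{..<n} \<rightarrow>\<^sub>E {..<N}. det_of n (\<lambda>i j. f (c i) (c j)) *
         indicator (Pi\<^sub>E {..<n} (\<lambda>i. grid_cell T N (c i))) x))"
    by (rule Bochner_Integration.integral_cong[OF refl step_function_eq[OF N]])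
  also have "\<dots> = (\<Sum>c\<in>{..<n} \<rightarrow>\<^sub>E {..<N}. (LINT x|?P. det_of n (\<lambda>i j. f (c i) (c j)) *
         indicator (Pi\<^sub>E {..<n} (\<lambda>i. grid_cell T N (c i))) x))"
    by (intro Bochner_Integration.integral_sum integrable_mult_right integrable_real_indicator)
       (simp_all add: grid_box_measure)
  also have "\<dots> = (\<Sum>c\<in>{..<n} \<rightarrow>\<^sub>E {..<N}. det_of n (\<lambda>i j. f (c i) (c j)) * (T / N) ^ n)"
  proof (intro sum.cong refl)
    fix c assume c: "c \<in> {..<n} \<rightarrow>\<^sub>E {..<N}"
    show "(LINT x|?P. det_of n (\<lambda>i j. f (c i) (c j)) *
         indicator (Pi\<^sub>E {..<n} (\<lambda>i. grid_cell T N (c i))) x) = det_of n (\<lambda>i j. f (c i) (c j)) * (T / N) ^ n"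
      using grid_box_measure[OF c] T by (simp add: measure_def)
  qed
  finally show ?thesis
    unfolding fredholm_term_def M_def[symmetric] by (simp add: sum_distrib_left mult.commute)
qed

end

text \<open>From n^n / n! \<le> e^n the term is at most (C e / sqrt n)^n, and this is at most 2^(-n)
  once sqrt n exceeds 2 C e.\<close>

lemma summable_Hadamard_series:
  fixes C :: real
  assumes C: "0 \<le> C"
  shows "summable (\<lambda>n. (C * sqrt n) ^ n / fact n)"
proof (rule summable_comparison_test_ev)
  show "summable (\<lambda>n. (1 / 2 :: real) ^ n)" by (rule summable_geometric) simp
  have bound: "(C * sqrt n) ^ n / fact n \<le> (1 / 2) ^ n" if n: "(2 * C * exp 1)\<^sup>2 < n" for n :: nat
  proof -
    have n0: "0 < real n" using n by (meson le_less_trans zero_le_power2)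
    have "exp (real n) = (\<Sum>k. real n ^ k /\<^sub>R fact k)" by (simp add: exp_def)
    moreover have "(\<Sum>k\<in>{n}. real n ^ k /\<^sub>R fact k) \<le> (\<Sum>k. real n ^ k /\<^sub>R fact k)"
      by (intro sum_le_suminf) (auto intro: summable_exp)
    ultimately have e: "real n ^ n / fact n \<le> exp 1 ^ n"
      using exp_of_nat_mult[of n "1 :: real"] by (simp add: divide_inverse mult.commute del: exp_of_nat_mult)
    have "(C * sqrt n) ^ n / fact n = (C / sqrt n) ^ n * (real n ^ n / fact n)"
    proof -
      have "C / sqrt n * n = C * (n / sqrt n)" by simp
      also have "\<dots> = C * sqrt n" by (simp only: real_div_sqrt of_nat_0_le_iff)
      finally have "C * sqrt n = C / sqrt n * n" by simp
      then have "(C * sqrt n) ^ n = (C / sqrt n) ^ n * real n ^ n" by (simp only: power_mult_distrib)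
      then show ?thesis by simp
    qed
    also have "\<dots> \<le> (C / sqrt n) ^ n * exp 1 ^ n"
      using e C by (intro mult_left_mono) auto
    also have "\<dots> = (C * exp 1 / sqrt n) ^ n"
      by (simp add: power_mult_distrib[symmetric])
    also have "\<dots> \<le> (1 / 2) ^ n"
    proof (rule power_mono)
      have "2 * C * exp 1 \<le> sqrt n"
        using n by (intro real_le_rsqrt) auto
      then show "C * exp 1 / sqrt n \<le> 1 / 2" using n0 by (simp add: field_simps)
    qed (use C in auto)
    finally show ?thesis .
  qed
  have "\<forall>\<^sub>F n in sequentially. (2 * C * exp 1)\<^sup>2 < real n"
    by (rule filterlim_at_top_dense[THEN iffD1, rule_format]) (rule filterlim_real_sequentially)
  then show "\<forall>\<^sub>F n in sequentially. norm ((C * sqrt n) ^ n / fact n) \<le> (1 / 2) ^ n"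
    by eventually_elim (use bound C in auto)
qed

text \<open>Two interchanges of limits: dominated convergence inside each term, where the majorant
  is constant in x, and Tannery's theorem over n, where it is independent of m.\<close>

theorem det_tendsto_fredholm_det:
  assumes T: "0 < T" and N: "\<And>m::nat. 0 < N m"
    and bound: "\<And>m i j. i < N m \<Longrightarrow> j < N m \<Longrightarrow> \<bar>A m i j\<bar> \<le> C"
    and lim: "\<And>x y. x \<in> {0<..<T} \<Longrightarrow> y \<in> {0<..<T} \<Longrightarrow>
       (\<lambda>m. A m (grid_index T (N m) x) (grid_index T (N m) y)) \<longlonglongrightarrow> K x y"
  shows "(\<lambda>m. det_of (N m) (\<lambda>i j. (if i = j then 1 else 0) - T / N m * A m i j))
     \<longlonglongrightarrow> fredholm_det {0<..<T} K"
proof -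
  define M where "M = restrict_space lborel {0<..<T}"
  note ctx = T M_def
  have C: "0 \<le> C" using bound[of 0 0 0] N[of 0] by (meson abs_ge_zero order.trans)
  define a where "a = (\<lambda>n m. fredholm_term {0<..<T}
     (\<lambda>x y. A m (grid_index T (N m) x) (grid_index T (N m) y)) n)"
  have a_eq: "a n m = (- 1) ^ n / fact n * ((T / N m) ^ n *
      (\<Sum>c\<in>{..<n} \<rightarrow>\<^sub>E {..<N m}. det_of n (\<lambda>i j. A m (c i) (c j))))" for n m
    unfolding a_def by (rule fredholm_term_step[OF ctx N])
  have "det_of (N m) (\<lambda>i j. (if i = j then 1 else 0) - T / N m * A m i j) = (\<Sum>n. a n m)" for m
  proof -
    \<comment> \<open>A tuple longer than \<open>N m\<close> repeats an index, so the series of the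
      step kernel is a finite sum.\<close>
    have "a n m = 0" if "n \<notin> {..N m}" for n
    proof -
      have "det_of n (\<lambda>i j. A m (c i) (c j)) = 0" if c: "c \<in> {..<n} \<rightarrow>\<^sub>E {..<N m}" for c
      proof (rule det_of_eq_0_if_not_inj)
        show "\<not> inj_on c {..<n}"
        proof
          assume "inj_on c {..<n}"
          then have "card {..<n} \<le> card {..<N m}"
            using c by (intro card_inj_on_le[of c]) auto
          then show False using \<open>n \<notin> {..N m}\<close> by simp
        qed
      qed
      then show ?thesis by (simp add: a_eq)
    qed
    then have "(\<Sum>n. a n m) = (\<Sum>n\<le>N m. a n m)"
      by (intro suminf_finite) auto
    then show ?thesis unfolding det_of_one_minus_expansion a_eq by simp
  qed
  moreover have "(\<lambda>m. \<Sum>n. a n m) \<longlonglongrightarrow> (\<Sum>n. fredholm_term {0<..<T} K n)"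
  proof (rule tannerys_theorem[THEN conjunct2, THEN conjunct2])
    show "summable (\<lambda>n. (C * T * sqrt n) ^ n / fact n)"
      using summable_Hadamard_series[of "C * T"] C T by simp
    have a_le: "norm (a n m) \<le> (C * T * sqrt n) ^ n / fact n" for n m
    proof -
      have "\<bar>\<Sum>c\<in>{..<n} \<rightarrow>\<^sub>E {..<N m}. det_of n (\<lambda>i j. A m (c i) (c j))\<bar>
         \<le> (\<Sum>c\<in>{..<n} \<rightarrow>\<^sub>E {..<N m}. (C * sqrt n) ^ n)"
      proof (rule order.trans[OF sum_abs sum_mono])
        fix c assume "c \<in> {..<n} \<rightarrow>\<^sub>E {..<N m}"
        then have "c i < N m" if "i < n" for i using that by auto
        then show "\<bar>det_of n (\<lambda>i j. A m (c i) (c j))\<bar> \<le> (C * sqrt n) ^ n"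
          by (intro Hadamard_bound bound)
      qed
      also have "\<dots> = real (N m) ^ n * (C * sqrt n) ^ n"
        by (simp add: card_funcsetE)
      finally have "(T / N m) ^ n * \<bar>\<Sum>c\<in>{..<n} \<rightarrow>\<^sub>E {..<N m}. det_of n (\<lambda>i j. A m (c i) (c j))\<bar>
          \<le> (T / N m) ^ n * (real (N m) ^ n * (C * sqrt n) ^ n)"
        using T by (intro mult_left_mono) auto
      also have "\<dots> = (C * T * sqrt n) ^ n"
        using N[of m] by (simp add: power_mult_distrib[symmetric] mult_ac)
      finally show ?thesis
        using T by (simp add: a_eq abs_mult divide_right_mono power_abs)
    qed
    show "\<forall>\<^sub>F (n, m) in sequentially \<times>\<^sub>F sequentially. norm (a n m) \<le> (C * T * sqrt n) ^ n / fact n"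
      using a_le by (intro always_eventually) auto
    show "a n \<longlonglongrightarrow> fredholm_term {0<..<T} K n" for n
      unfolding a_def fredholm_term_def M_def[symmetric]
    proof (intro tendsto_intros integral_dominated_convergence)
      let ?P = "Pi\<^sub>M {..<n} (\<lambda>_. M)"
      have x: "x i \<in> {0<..<T}" if "x \<in> space ?P" "i < n" for x i
        using that by (auto simp: space_PiM M_def space_restrict_space PiE_iff)
      have pt: "(\<lambda>m. det_of n (\<lambda>i j. A m (grid_index T (N m) (x i)) (grid_index T (N m) (x j))))
         \<longlonglongrightarrow> det_of n (\<lambda>i j. K (x i) (x j))" if "x \<in> space ?P" for x
        unfolding det_of_Leibniz
      proof (intro tendsto_intros lim x[OF that])
        fix p i assume p: "p \<in> {p. p permutes {..<n}}" and i: "i \<in> {..<n}"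
        show "i < n" using i by simp
        show "p i < n" using p i permutes_in_image[of p "{..<n}" i] by simp
      qed
      show meas: "(\<lambda>x. det_of n (\<lambda>i j. A m (grid_index T (N m) (x i)) (grid_index T (N m) (x j))))
         \<in> borel_measurable ?P" for m
        by (rule step_function_measurable[OF ctx N])
      \<comment> \<open>Measurability is inherited from the step functions through their pointwise
        limit.\<close>
      show "(\<lambda>x. det_of n (\<lambda>i j. K (x i) (x j))) \<in> borel_measurable ?P"
        by (rule borel_measurable_LIMSEQ_real[OF pt meas])
      show "integrable ?P (\<lambda>_. (C * sqrt n) ^ n)"
        using finite_measure_PiM[OF ctx] by (intro finite_measure.integrable_const)
      show "AE x in ?P. (\<lambda>m. det_of n (\<lambda>i j. A m (grid_index T (N m) (x i)) (grid_index T (N m) (x j))))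
         \<longlonglongrightarrow> det_of n (\<lambda>i j. K (x i) (x j))"
        using pt by (intro AE_I2)
      show "AE x in ?P. norm (det_of n (\<lambda>i j. A m (grid_index T (N m) (x i)) (grid_index T (N m) (x j))))
         \<le> (C * sqrt n) ^ n" for m
      proof (intro AE_I2)
        fix x' assume x': "x' \<in> space ?P"
        have "grid_index T (N m) (x' i) < N m" if "i < n" for i
          using x[OF x' that] grid_index_less[of "x' i" T "N m"] N[of m] by auto
        then show "norm (det_of n (\<lambda>i j. A m (grid_index T (N m) (x' i)) (grid_index T (N m) (x' j))))
         \<le> (C * sqrt n) ^ n"
          unfolding real_norm_def by (intro Hadamard_bound bound)
      qed
    qed
  qed simp
  ultimately show ?thesis unfolding fredholm_det_def by simp
qed

section \<open>Reflection and triangular changes of basis\<close>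

lemma sum_lessThan_add: "(\<Sum>i<m + n. f i) = (\<Sum>i<m. f i) + (\<Sum>i<n. f (m + i :: nat))"
  for f :: "nat \<Rightarrow> 'a::comm_monoid_add"
  by (induction n) (simp_all add: add.assoc)

lemma det_of_congruence:
  assumes "\<And>i k. i < k \<Longrightarrow> B i k = 0"
  shows "det_of n (\<lambda>i j. \<Sum>k<n. \<Sum>l<n. B i k * X k l * B j l) = (\<Prod>i<n. B i i)\<^sup>2 * det_of n X"
proof -
  have "det_of n (\<lambda>i j. \<Sum>k<n. \<Sum>l<n. B i k * X k l * B j l)
      = det_of n (\<lambda>i j. \<Sum>k<n. B i k * (\<Sum>l<n. X k l * B j l))"
    by (intro det_of_cong) (simp add: sum_distrib_left mult.assoc)
  also have "\<dots> = det_of n B * (det_of n X * det_of n (\<lambda>i j. B j i))"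
    by (simp only: det_of_mult)
  finally show ?thesis
    using assms det_of_transpose[of n B] det_of_lower_triangular[of n B]
    by (simp add: power2_eq_square)
qed

lemma det_of_congruence_general:
  "det_of n (\<lambda>i j. \<Sum>k<n. \<Sum>l<n. U k i * X k l * U l j) = (det_of n U)\<^sup>2 * det_of n X"
proof -
  have "det_of n (\<lambda>i j. \<Sum>k<n. \<Sum>l<n. U k i * X k l * U l j)
      = det_of n (\<lambda>i j. \<Sum>k<n. U k i * (\<Sum>l<n. X k l * U l j))"
    by (intro det_of_cong) (simp add: sum_distrib_left mult.assoc)
  also have "\<dots> = det_of n (\<lambda>i j. U j i) * (det_of n X * det_of n U)"
    by (simp only: det_of_mult)
  finally show ?thesis
    using det_of_transpose[of n U] by (simp add: power2_eq_square)
qed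

text \<open>
  Indices centred at \<open>M - 1/2\<close> are written as \<open>fold_sign M i * (fold_index M i + 1/2)\<close>; this
  splits a symmetric Toeplitz matrix into a cosine block \<open>E\<close> and a sine block \<open>D\<close>.
\<close>

definition fold_index :: "nat \<Rightarrow> nat \<Rightarrow> nat" where
  "fold_index M i = (if i < M then M - 1 - i else i - M)"

definition fold_sign :: "nat \<Rightarrow> nat \<Rightarrow> real" where
  "fold_sign M i = (if i < M then - 1 else 1)"

text \<open>The rows of \<open>U\<close> are the symmetric and antisymmetric combinations of an
  index and its mirror image. They are orthogonal of squared length 2, and in this basis the matrix
  is block diagonal.\<close>

lemma det_of_reflection:
  "det_of (M + M) (\<lambda>i j. E (fold_index M i) (fold_index M j)
       + fold_sign M i * fold_sign M j * D (fold_index M i) (fold_index M j))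
   = 4 ^ M * det_of M E * det_of M D"
proof -
  define U where "U = (\<lambda>a i. if a < M then (if fold_index M i = a then 1 else 0)
     else (if fold_index M i = a - M then fold_sign M i else 0))"
  define X where "X = (\<lambda>a b. if a < M then (if b < M then E a b else 0)
     else (if b < M then 0 else D (a - M) (b - M)))"
  have fold: "fold_index M i < M" if "i < M + M" for i
    using that by (auto simp: fold_index_def)
  have delta: "(\<Sum>k<M. (if n = k then x else 0) * f k) = x * f n" if "n < M" for n f and x :: real
  proof -
    have "(\<Sum>k<M. (if n = k then x else 0) * f k) = (\<Sum>k<M. if n = k then x * f k else 0)"
      by (intro sum.cong) auto
    then show ?thesis using that by simp
  qed
  have "det_of (M + M) (\<lambda>i j. E (fold_index M i) (fold_index M j)
       + fold_sign M i * fold_sign M j * D (fold_index M i) (fold_index M j))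
      = det_of (M + M) (\<lambda>i j. \<Sum>k<M + M. \<Sum>l<M + M. U k i * X k l * U l j)"
  proof (rule det_of_cong)
    fix i j assume ij: "i < M + M" "j < M + M"
    have 1: "(\<Sum>l<M. X k l * U l j) = E k (fold_index M j)" if "k < M" for k
      using that delta[OF fold[OF ij(2)], of 1 "E k"] by (simp add: X_def U_def mult.commute)
    have 2: "(\<Sum>l<M. X k (M + l) * U (M + l) j) = 0" "(\<Sum>l<M. X (M + k) l * U l j) = 0" if "k < M" for k
      using that by (simp_all add: X_def)
    have 3: "(\<Sum>l<M. X (M + k) (M + l) * U (M + l) j) = fold_sign M j * D k (fold_index M j)" if "k < M" for k
      using that delta[OF fold[OF ij(2)], of "fold_sign M j" "D k"] by (simp add: X_def U_def mult.commute)
    have "(\<Sum>k<M + M. \<Sum>l<M + M. U k i * X k l * U l j)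
       = (\<Sum>k<M + M. U k i * (\<Sum>l<M + M. X k l * U l j))"
      by (simp add: sum_distrib_left mult.assoc)
    also have "\<dots> = (\<Sum>k<M. U k i * E k (fold_index M j))
       + (\<Sum>k<M. U (M + k) i * (fold_sign M j * D k (fold_index M j)))"
      unfolding sum_lessThan_add by (simp add: 1 2 3)
    also have "\<dots> = E (fold_index M i) (fold_index M j)
       + fold_sign M i * (fold_sign M j * D (fold_index M i) (fold_index M j))"
      using delta[OF fold[OF ij(1)], of 1 "\<lambda>k. E k (fold_index M j)"]
        delta[OF fold[OF ij(1)], of "fold_sign M i" "\<lambda>k. fold_sign M j * D k (fold_index M j)"]
      by (simp add: U_def)
    finally show "E (fold_index M i) (fold_index M j)
       + fold_sign M i * fold_sign M j * D (fold_index M i) (fold_index M j)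
       = (\<Sum>k<M + M. \<Sum>l<M + M. U k i * X k l * U l j)" by (simp add: mult.assoc)
  qed
  also have "\<dots> = (det_of (M + M) U)\<^sup>2 * det_of (M + M) X"
    by (rule det_of_congruence_general)
  \<comment> \<open>Only the square of det U occurs, and U^T U = 2 I has determinant 2^(2M).\<close>
  also have "(det_of (M + M) U)\<^sup>2 = det_of (M + M) (\<lambda>i j. \<Sum>k<M + M. U k i * U k j)"
    using det_of_transpose[of "M + M" U] by (simp add: det_of_mult power2_eq_square)
  also have "\<dots> = det_of (M + M) (\<lambda>i j. if i = j then 2 else 0)"
  proof (rule det_of_cong)
    fix i j assume ij: "i < M + M" "j < M + M"
    have "(\<Sum>k<M + M. U k i * U k j) = (if fold_index M i = fold_index M j then 1 + fold_sign M i * fold_sign M j else 0)"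
      using delta[OF fold[OF ij(1)], of 1 "\<lambda>k. U k j"]
        delta[OF fold[OF ij(1)], of "fold_sign M i" "\<lambda>k. U (M + k) j"] fold[OF ij(1)]
      unfolding sum_lessThan_add by (auto simp: U_def)
    also have "\<dots> = (if i = j then 2 else 0)"
      using ij by (auto simp: fold_index_def fold_sign_def)
    finally show "(\<Sum>k<M + M. U k i * U k j) = (if i = j then 2 else 0)" .
  qed
  also have "\<dots> = 4 ^ M"
    by (subst det_of_lower_triangular) (auto simp: power_add power_mult_distrib[symmetric])
  also have "det_of (M + M) X = det_of M E * det_of M D"
    by (subst det_of_block_lower)
       (auto simp: X_def intro!: arg_cong2[where f = "(*)"] det_of_cong)
  finally show ?thesis by simp
qed

text \<open>Degree at most \<open>i\<close> with leading coefficient \<open>l\<close>, measured in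
  the family \<open>q\<close> instead of powers. Coefficients beyond \<open>i\<close> are set to
  zero so that one sequence serves sums of any greater length.\<close>

definition trunc_span :: "(nat \<Rightarrow> real \<Rightarrow> real) \<Rightarrow> nat \<Rightarrow> (real \<Rightarrow> real) \<Rightarrow> real \<Rightarrow> bool" where
  "trunc_span q i g l \<longleftrightarrow> (\<exists>b. (\<forall>k>i. b k = 0) \<and> b i = l \<and> (\<forall>x. g x = (\<Sum>k\<le>i. b k * q k x)))"

lemma trunc_span_basis: "k \<le> i \<Longrightarrow> trunc_span q i (q k) (if k = i then 1 else 0)"
  unfolding trunc_span_def
  by (rule exI[of _ "\<lambda>j. if j = k then 1 else 0"]) (auto simp: if_distrib[of "\<lambda>x. x * _"] cong: if_cong)

lemma trunc_span_add:
  assumes "trunc_span q i f a" "trunc_span q i g b"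
  shows "trunc_span q i (\<lambda>x. f x + g x) (a + b)"
proof -
  obtain u v where "\<forall>k>i. u k = 0" "u i = a" "\<forall>x. f x = (\<Sum>k\<le>i. u k * q k x)"
    "\<forall>k>i. v k = 0" "v i = b" "\<forall>x. g x = (\<Sum>k\<le>i. v k * q k x)"
    using assms unfolding trunc_span_def by auto
  then show ?thesis
    unfolding trunc_span_def
    by (intro exI[of _ "\<lambda>k. u k + v k"]) (simp add: distrib_right sum.distrib)
qed

lemma trunc_span_scale:
  assumes "trunc_span q i f a"
  shows "trunc_span q i (\<lambda>x. c * f x) (c * a)"
proof -
  obtain u where "\<forall>k>i. u k = 0" "u i = a" "\<forall>x. f x = (\<Sum>k\<le>i. u k * q k x)"
    using assms unfolding trunc_span_def by auto
  then show ?thesis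
    unfolding trunc_span_def
    by (intro exI[of _ "\<lambda>k. c * u k"]) (simp add: sum_distrib_left mult.assoc)
qed

lemma trunc_span_Suc:
  assumes "trunc_span q i f a"
  shows "trunc_span q (Suc i) f 0"
proof -
  obtain u where "\<forall>k>i. u k = 0" "u i = a" "\<forall>x. f x = (\<Sum>k\<le>i. u k * q k x)"
    using assms unfolding trunc_span_def by auto
  then show ?thesis
    unfolding trunc_span_def by (intro exI[of _ u]) simp
qed

lemma trunc_span_sum:
  assumes "finite S" "\<And>k. k \<in> S \<Longrightarrow> trunc_span q i (f k) (a k)"
  shows "trunc_span q i (\<lambda>x. \<Sum>k\<in>S. f k x) (\<Sum>k\<in>S. a k)"
  using assms
proof (induction S)
  case empty
  show ?case unfolding trunc_span_def by (intro exI[of _ "\<lambda>_. 0"]) simp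
next
  case (insert k S)
  then show ?case using trunc_span_add[of q i "f k" "a k"] by simp
qed

text \<open>By the three-term recurrence, multiplication by \<open>X\<close> raises the degree by
  one and keeps the leading coefficient. At k = 0 the term \<open>q (k - 1)\<close> is
  \<open>q 0\<close> itself; the families used below have b 0 = 0.\<close>

lemma trunc_span_mult:
  assumes rec: "\<And>k x. X x * q k x = q (Suc k) x + a k * q k x + b k * q (k - 1) x"
    and "trunc_span q i f l"
  shows "trunc_span q (Suc i) (\<lambda>x. X x * f x) l"
proof -
  obtain u where u: "u i = l" "\<forall>x. f x = (\<Sum>k\<le>i. u k * q k x)"
    using assms unfolding trunc_span_def by auto
  have "trunc_span q (Suc i) (\<lambda>x. X x * q k x) (if k = i then 1 else 0)" if "k \<le> i" for k
  proof -
    have "trunc_span q (Suc i) (q (Suc k)) (if k = i then 1 else 0)"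
      using trunc_span_basis[of "Suc k" "Suc i" q] that by simp
    moreover have "trunc_span q (Suc i) (q k) 0" "trunc_span q (Suc i) (q (k - 1)) 0"
      using trunc_span_basis[of k "Suc i" q] trunc_span_basis[of "k - 1" "Suc i" q]
        le_SucI[OF le_trans[OF diff_le_self that], of 1] le_imp_less_Suc[OF le_trans[OF diff_le_self that], of 1]
        that by simp_all
    ultimately show ?thesis
      unfolding rec
      using trunc_span_add[OF trunc_span_add[OF _ trunc_span_scale[of q "Suc i" "q k" 0 "a k"]]
          trunc_span_scale[of q "Suc i" "q (k - 1)" 0 "b k"]] by fastforce
  qed
  then have "trunc_span q (Suc i) (\<lambda>x. \<Sum>k\<le>i. u k * (X x * q k x)) (\<Sum>k\<le>i. u k * (if k = i then 1 else 0))"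
    by (intro trunc_span_sum trunc_span_scale) auto
  moreover have "(\<lambda>x. \<Sum>k\<le>i. u k * (X x * q k x)) = (\<lambda>x. X x * f x)"
    using u by (auto simp: sum_distrib_left mult_ac)
  moreover have "(\<Sum>k\<le>i. u k * (if k = i then 1 else 0)) = l"
    using u by (simp add: if_distrib[of "\<lambda>x. _ * x"] cong: if_cong)
  ultimately show ?thesis by simp
qed

text \<open>\<open>f\<close> is a Chebyshev family in \<alpha> X + \<delta>, and \<open>q\<close>
  has a three-term recurrence in X. Both have one element per degree, so the change of basis is
  triangular and its determinant is read off the leading coefficients. The separate \<delta>' allows
  for the first step of half-angle families.\<close>

lemma triangular_expansion:
  fixes q f :: "nat \<Rightarrow> real \<Rightarrow> real"
  assumes rec: "\<And>k x. X x * q k x = q (Suc k) x + a k * q k x + b k * q (k - 1) x"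
    and f0: "\<And>x. f 0 x = l * q 0 x"
    and f1: "\<And>x. f 1 x = (\<alpha> * X x + \<delta>') * f 0 x"
    and f2: "\<And>i x. f (Suc (Suc i)) x = (\<alpha> * X x + \<delta>) * f (Suc i) x - f i x"
  obtains B where "\<And>i k. i < k \<Longrightarrow> B i k = 0" "\<And>i. B i i = l * \<alpha> ^ i"
    "\<And>n i x. i < n \<Longrightarrow> f i x = (\<Sum>k<n. B i k * q k x)"
proof -
  have step: "trunc_span q (Suc i) (\<lambda>x. (\<alpha> * X x + d) * g x) (\<alpha> * u)" if "trunc_span q i g u" for i g u d
  proof -
    have "trunc_span q (Suc i) (\<lambda>x. \<alpha> * (X x * g x) + d * g x) (\<alpha> * u + d * 0)"
      using that by (intro trunc_span_add trunc_span_scale trunc_span_mult[OF rec] trunc_span_Suc)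
    then show ?thesis by (simp add: algebra_simps)
  qed
  have "trunc_span q i (f i) (l * \<alpha> ^ i) \<and> trunc_span q (Suc i) (f (Suc i)) (l * \<alpha> ^ Suc i)" for i
  proof (induction i)
    case 0
    have "trunc_span q 0 (\<lambda>x. l * q 0 x) (l * 1)"
      using trunc_span_basis[of 0 0 q] by (intro trunc_span_scale) auto
    then have *: "trunc_span q 0 (f 0) l" by (simp add: f0[abs_def])
    then have "trunc_span q (Suc 0) (f 1) (\<alpha> * l)"
      unfolding f1[abs_def] by (rule step)
    with * show ?case by (simp add: mult.commute)
  next
    case (Suc i)
    have "trunc_span q (Suc (Suc i)) (\<lambda>x. (\<alpha> * X x + \<delta>) * f (Suc i) x + (- 1) * f i x)
       (\<alpha> * (l * \<alpha> ^ Suc i) + (- 1) * 0)"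
      using Suc trunc_span_Suc[of q "Suc i" "f i" 0] trunc_span_Suc[of q i "f i"]
      by (intro trunc_span_add step trunc_span_scale) auto
    then have "trunc_span q (Suc (Suc i)) (f (Suc (Suc i))) (\<alpha> * (l * \<alpha> ^ Suc i))"
      by (simp add: f2[abs_def])
    then show ?case using Suc by (simp add: mult_ac)
  qed
  then have "\<forall>i. \<exists>b. (\<forall>k>i. b k = 0) \<and> b i = l * \<alpha> ^ i \<and> (\<forall>x. f i x = (\<Sum>k\<le>i. b k * q k x))"
    unfolding trunc_span_def by blast
  then obtain B where B: "\<And>i k. k > i \<Longrightarrow> B i k = 0" "\<And>i. B i i = l * \<alpha> ^ i"
      "\<And>i x. f i x = (\<Sum>k\<le>i. B i k * q k x)"
    by metis
  have eq: "f i x = (\<Sum>k<n. B i k * q k x)" if "i < n" for n i x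
    unfolding B(3) using that by (intro sum.mono_neutral_left) (auto simp: B(1))
  show ?thesis by (rule that[OF B(1) B(2) eq])
qed

section \<open>Bernstein-Szego orthogonality\<close>

text \<open>|1 - \<beta> e^(i x)|^2, the denominator of the Poisson kernel.\<close>

definition poisson_den :: "real \<Rightarrow> real \<Rightarrow> real" where
  "poisson_den \<beta> x = 1 + \<beta>\<^sup>2 - 2 * \<beta> * cos x"

text \<open>Equal to 4 \<beta> sin^2 (x / 2) / |1 - \<beta> e^(i x)|^2 wherever the denominator is
  nonzero. Written as a defect from 1 it is the constant 1 for \<beta> = 1, even at x = 0 where the
  fraction is 0 / 0, and it shows the analogy with 1 - r^2 / (p^2 + r^2).\<close>

definition bs_weight :: "real \<Rightarrow> real \<Rightarrow> real" where
  "bs_weight \<beta> x = 1 - (1 - \<beta>)\<^sup>2 / poisson_den \<beta> x"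

lemma poisson_den_alt: "poisson_den \<beta> x = (1 - \<beta>)\<^sup>2 + 2 * \<beta> * (1 - cos x)"
  by (simp add: poisson_den_def power2_eq_square algebra_simps)

lemma poisson_den_pos:
  assumes "0 < \<beta>" "\<beta> \<noteq> 1 \<or> cos x \<noteq> 1"
  shows "0 < poisson_den \<beta> x"
proof (cases "\<beta> \<noteq> 1")
  case True
  then have "0 < (1 - \<beta>)\<^sup>2" by simp
  moreover have "0 \<le> 2 * \<beta> * (1 - cos x)" using assms by simp
  ultimately show ?thesis unfolding poisson_den_alt by linarith
next
  case False
  then have "cos x < 1" using assms(2) by (simp add: less_le)
  then have "0 < 2 * \<beta> * (1 - cos x)" using assms by simp
  then show ?thesis unfolding poisson_den_alt
    by (metis add_nonneg_pos zero_le_power2)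
qed

lemma continuous_bs_weight:
  assumes "0 < \<beta>" "\<beta> \<le> 1"
  shows "continuous_on A (bs_weight \<beta>)"
proof (cases "\<beta> = 1")
  case True
  then have "bs_weight \<beta> = (\<lambda>_. 1)" by (auto simp: bs_weight_def)
  then show ?thesis by simp
next
  case False
  then have "poisson_den \<beta> x \<noteq> 0" for x using poisson_den_pos[of \<beta> x] assms by force
  then show ?thesis
    unfolding bs_weight_def poisson_den_def[abs_def]
    by (intro continuous_intros) (auto simp: poisson_den_def)
qed

lemma cos_neq_1: "0 < x \<Longrightarrow> x \<le> pi \<Longrightarrow> cos x \<noteq> 1"
  using cos_monotone_0_pi[of 0 x] by auto

lemma bs_weight_eq:
  assumes "0 < \<beta>" "0 < x" "x \<le> pi"
  shows "bs_weight \<beta> x * poisson_den \<beta> x = 4 * \<beta> * (sin (x / 2))\<^sup>2"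
proof -
  have "poisson_den \<beta> x > 0" using assms cos_neq_1 by (intro poisson_den_pos) auto
  then have "bs_weight \<beta> x * poisson_den \<beta> x = 2 * \<beta> * (1 - cos x)"
    by (simp add: bs_weight_def field_simps) (simp add: poisson_den_alt algebra_simps)
  also have "cos x = 1 - 2 * (sin (x / 2))\<^sup>2" using cos_double_sin[of "x / 2"] by simp
  finally show ?thesis by simp
qed

section \<open>Means of cosines and of Blaschke quotients\<close>

lemma has_integral_cos_mult:
  "((\<lambda>x. cos (k * x)) has_integral (if k = 0 then pi else sin (k * pi) / k)) {0..pi}"
proof (cases "k = 0")
  case True
  then show ?thesis using has_integral_const_real[of "1 :: real" 0 pi] by simp
next
  case False
  have "((\<lambda>x. cos (k * x)) has_integral (sin (k * pi) / k - sin (k * 0) / k)) {0..pi}"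
  proof (rule fundamental_theorem_of_calculus)
    fix x assume "x \<in> {0..pi}"
    have "((\<lambda>x. sin (k * x) / k) has_real_derivative cos (k * x)) (at x within {0..pi})"
      using False by (auto intro!: derivative_eq_intros)
    then show "((\<lambda>x. sin (k * x) / k) has_vector_derivative cos (k * x)) (at x within {0..pi})"
      by (simp add: has_real_derivative_iff_has_vector_derivative)
  qed simp
  then show ?thesis using False by simp
qed

lemma has_integral_cos_nat:
  "((\<lambda>x. cos (real k * x)) has_integral (if k = 0 then pi else 0)) {0..pi}"
  using has_integral_cos_mult[of "real k"] sin_npi[of k] by (cases "k = 0") (auto simp: mult.commute)

lemma has_integral_cos_int:
  "((\<lambda>x. cos (of_int k * x)) has_integral (if k = 0 then pi else 0)) {0..pi}"
proof -
  have "cos (of_int k * x) = cos (real (nat \<bar>k\<bar>) * x)" for x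
    by (cases "0 \<le> k") (auto simp: cos_minus[of "of_int k * x", symmetric] simp del: cos_minus)
  then show ?thesis using has_integral_cos_nat[of "nat \<bar>k\<bar>"] by simp
qed

text \<open>With w = e^(i x) this is the real part of w^n (w - \<beta>) / (1 - \<beta> w), a power
  times a Blaschke factor. For \<beta> < 1 its mean is the value at w = 0, which is - \<beta> for n
  = 0 and 0 otherwise.\<close>

definition skew_poisson :: "real \<Rightarrow> nat \<Rightarrow> real \<Rightarrow> real" where
  "skew_poisson \<beta> n x = (cos ((real n + 1) * x) - 2 * \<beta> * cos (real n * x)
      + \<beta>\<^sup>2 * cos ((real n - 1) * x)) / poisson_den \<beta> x"

text \<open>Multiplication by 1 - \<beta> w cancels the denominator of the Blaschke factor.\<close>

lemma skew_poisson_step: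
  assumes "poisson_den \<beta> x \<noteq> 0"
  shows "skew_poisson \<beta> n x - \<beta> * skew_poisson \<beta> (Suc n) x
    = cos (real (Suc n) * x) - \<beta> * cos (real n * x)"
proof -
  have p: "2 * cos x * cos (y * x) = cos ((y + 1) * x) + cos ((y - 1) * x)" for y
    by (simp add: distrib_right left_diff_distrib cos_add cos_diff)
  define y where "y = real n"
  have "cos ((y + 1) * x) - 2 * \<beta> * cos (y * x) + \<beta>\<^sup>2 * cos ((y - 1) * x)
     - \<beta> * (cos ((y + 2) * x) - 2 * \<beta> * cos ((y + 1) * x) + \<beta>\<^sup>2 * cos (y * x))
     = (1 + \<beta>\<^sup>2) * (cos ((y + 1) * x) - \<beta> * cos (y * x))
       - \<beta> * (2 * cos x * cos ((y + 1) * x) - \<beta> * (2 * cos x * cos (y * x)))"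
    unfolding p by (simp add: algebra_simps power2_eq_square)
  also have "\<dots> = poisson_den \<beta> x * (cos ((y + 1) * x) - \<beta> * cos (y * x))"
    by (simp add: poisson_den_def algebra_simps)
  finally have *: "cos ((y + 1) * x) - 2 * \<beta> * cos (y * x) + \<beta>\<^sup>2 * cos ((y - 1) * x)
     - \<beta> * (cos ((y + 2) * x) - 2 * \<beta> * cos ((y + 1) * x) + \<beta>\<^sup>2 * cos (y * x))
     = poisson_den \<beta> x * (cos ((y + 1) * x) - \<beta> * cos (y * x))" .
  have "(cos ((y + 1) * x) - 2 * \<beta> * cos (y * x) + \<beta>\<^sup>2 * cos ((y - 1) * x)) / poisson_den \<beta> x
     - \<beta> * ((cos ((y + 2) * x) - 2 * \<beta> * cos ((y + 1) * x) + \<beta>\<^sup>2 * cos (y * x)) / poisson_den \<beta> x)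
     = cos ((y + 1) * x) - \<beta> * cos (y * x)"
    unfolding times_divide_eq_right diff_divide_distrib[symmetric] * using assms by simp
  moreover have "skew_poisson \<beta> (Suc n) x
      = (cos ((y + 2) * x) - 2 * \<beta> * cos ((y + 1) * x) + \<beta>\<^sup>2 * cos (y * x)) / poisson_den \<beta> x"
    by (simp add: skew_poisson_def y_def add_ac)
  ultimately show ?thesis by (simp add: skew_poisson_def y_def add_ac)
qed

text \<open>
  The integrals form a geometric progression with ratio \<open>1 / \<beta>\<close> for \<open>n > 0\<close>; being bounded,
  they vanish.
\<close>

lemma has_integral_skew_poisson:
  assumes \<beta>: "0 < \<beta>" "\<beta> \<le> 1"
  shows "(skew_poisson \<beta> n has_integral (if n = 0 then - \<beta> * pi else 0)) {0..pi}"
proof (cases "\<beta> = 1")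
  case True
  \<comment> \<open>At \<beta> = 1 the progression has ratio 1 and the denominator vanishes at x =
    0, but the Blaschke factor is the constant - 1.\<close>
  have i: "((\<lambda>x. - cos (real n * x)) has_integral - (if n = 0 then pi else 0)) {0..pi}"
    by (intro has_integral_neg has_integral_cos_nat)
  have eq: "skew_poisson \<beta> n x = - cos (real n * x)" if "x \<in> {0..pi} - {0}" for x
  proof -
    have den: "poisson_den \<beta> x = 2 - 2 * cos x" using True by (simp add: poisson_den_def)
    have "poisson_den \<beta> x > 0" using that cos_neq_1[of x] \<beta> by (intro poisson_den_pos) auto
    moreover have "cos ((real n + 1) * x) + cos ((real n - 1) * x) = 2 * cos x * cos (real n * x)"
      by (simp add: distrib_right left_diff_distrib cos_add cos_diff)
    moreover have "a - 2 * \<beta> * y + \<beta>\<^sup>2 * b = - y * (2 - 2 * c)" if "a + b = 2 * c * y" for a b c y :: real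
    proof -
      have a: "a = 2 * c * y - b" using that by linarith
      show ?thesis unfolding a True by (simp add: algebra_simps)
    qed
    ultimately have "cos ((real n + 1) * x) - 2 * \<beta> * cos (real n * x) + \<beta>\<^sup>2 * cos ((real n - 1) * x)
        = - cos (real n * x) * poisson_den \<beta> x"
      unfolding den by blast
    with \<open>poisson_den \<beta> x > 0\<close> show ?thesis
      by (simp add: skew_poisson_def)
  qed
  have "(skew_poisson \<beta> n has_integral - (if n = 0 then pi else 0)) {0..pi}"
    by (rule has_integral_spike[OF negligible_sing eq i])
  moreover have "- (if n = 0 then pi else 0) = (if n = 0 then - \<beta> * pi else 0)" using True by simp
  ultimately show ?thesis by metis
next
  case False
  with \<beta> have lt: "\<beta> < 1" by simp
  have den: "(1 - \<beta>)\<^sup>2 \<le> poisson_den \<beta> x" for x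
    using lt \<beta> unfolding poisson_den_alt by auto
  have sq_pos: "0 < (1 - \<beta>)\<^sup>2" using lt by simp
  have den_pos: "0 < poisson_den \<beta> x" for x using den[of x] sq_pos by linarith
  define I where "I n = integral {0..pi} (skew_poisson \<beta> n)" for n
  have int: "skew_poisson \<beta> n integrable_on {0..pi}" for n
  proof (intro integrable_continuous_real)
    have "1 + \<beta>\<^sup>2 - 2 * \<beta> * cos x \<noteq> 0" for x
      using den_pos[of x] by (simp add: poisson_den_def)
    then show "continuous_on {0..pi} (skew_poisson \<beta> n)"
      unfolding skew_poisson_def[abs_def] poisson_den_def by (intro continuous_intros) blast
  qed
  then have I: "(skew_poisson \<beta> n has_integral I n) {0..pi}" for n
    unfolding I_def by (rule integrable_integral)
  have step: "I n - \<beta> * I (Suc n) = (if n = 0 then - \<beta> * pi else 0)" for n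
  proof -
    have eq: "skew_poisson \<beta> n x - \<beta> * skew_poisson \<beta> (Suc n) x = cos (real (Suc n) * x) - \<beta> * cos (real n * x)" for x
      using den_pos[of x] by (intro skew_poisson_step) auto
    have "((\<lambda>x. skew_poisson \<beta> n x - \<beta> * skew_poisson \<beta> (Suc n) x) has_integral I n - \<beta> * I (Suc n)) {0..pi}"
      by (intro has_integral_diff has_integral_mult_right I)
    then have lhs: "((\<lambda>x. cos (real (Suc n) * x) - \<beta> * cos (real n * x)) has_integral I n - \<beta> * I (Suc n)) {0..pi}"
      unfolding eq .
    have "((\<lambda>x. cos (real (Suc n) * x) - \<beta> * cos (real n * x)) has_integral
       (if Suc n = 0 then pi else 0) - \<beta> * (if n = 0 then pi else 0)) {0..pi}"
      by (intro has_integral_diff has_integral_mult_right has_integral_cos_nat)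
    from has_integral_unique[OF lhs this] show ?thesis by simp
  qed
  define C where "C = 4 / (1 - \<beta>)\<^sup>2"
  have bound: "\<bar>I n\<bar> \<le> C * pi" for n
  proof -
    have "norm (I n) \<le> C * measure lborel (cbox 0 pi)"
    proof (rule has_integral_bound)
      show "0 \<le> C" by (simp add: C_def)
      show "(skew_poisson \<beta> n has_integral I n) (cbox 0 pi)" using I[of n] by simp
      fix x :: real
      have "\<bar>cos ((real n + 1) * x) - 2 * \<beta> * cos (real n * x) + \<beta>\<^sup>2 * cos ((real n - 1) * x)\<bar>
        \<le> \<bar>cos ((real n + 1) * x)\<bar> + \<bar>2 * \<beta> * cos (real n * x)\<bar> + \<bar>\<beta>\<^sup>2 * cos ((real n - 1) * x)\<bar>"
        by linarith
      also have "\<dots> \<le> 1 + 2 * 1 + 1 * 1"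
        using \<beta> unfolding abs_mult
        by (intro add_mono mult_mono) (auto simp: power_le_one)
      finally have "\<bar>cos ((real n + 1) * x) - 2 * \<beta> * cos (real n * x) + \<beta>\<^sup>2 * cos ((real n - 1) * x)\<bar> \<le> 4"
        by simp
      then show "norm (skew_poisson \<beta> n x) \<le> C"
        unfolding skew_poisson_def C_def real_norm_def abs_divide
        using den[of x] sq_pos by (intro frac_le) auto
    qed
    then show ?thesis by simp
  qed
  have pos: "I n = 0" if "n > 0" for n
  proof -
    have rep: "I n = \<beta> ^ k * I (n + k)" for k
    proof (induction k)
      case (Suc k)
      have "I (n + k) = \<beta> * I (Suc (n + k))" using step[of "n + k"] that by simp
      then show ?case using Suc by simp
    qed simp
    have "\<bar>I n\<bar> \<le> \<beta> ^ k * (C * pi)" for k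
      using rep[of k] bound[of "n + k"] \<beta> by (simp add: abs_mult)
    moreover have "(\<lambda>k. \<beta> ^ k * (C * pi)) \<longlonglongrightarrow> 0 * (C * pi)"
      using \<beta> lt by (intro tendsto_intros LIMSEQ_power_zero) auto
    ultimately have "\<bar>I n\<bar> \<le> 0 * (C * pi)"
      by (intro LIMSEQ_le_const[of _ _ "\<bar>I n\<bar>"]) auto
    then show ?thesis by simp
  qed
  show ?thesis
  proof (cases "n = 0")
    case True
    then show ?thesis using I[of 0] step[of 0] pos[of 1] by simp
  next
    case False
    then show ?thesis using I[of n] pos[of n] by simp
  qed
qed

definition bs_mean :: "real \<Rightarrow> (real \<Rightarrow> real) \<Rightarrow> real" where
  "bs_mean \<beta> f = integral {0..pi} (\<lambda>x. f x * bs_weight \<beta> x) / pi"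

text \<open>
  The Bernstein-Szego orthogonal functions of \<^const>\<open>bs_weight\<close> among \<open>cos (x / 2)\<close> times the
  polynomials in \<open>cos x\<close>, and among the polynomials in \<open>cos x\<close>. They are defined by recursion and
  not as quotients by \<open>sin (x / 2)\<close>, so that they are continuous at 0.
\<close>

fun odd_basis :: "real \<Rightarrow> nat \<Rightarrow> real \<Rightarrow> real" where
  "odd_basis \<beta> 0 x = cos (x / 2)"
| "odd_basis \<beta> (Suc 0) x = (2 * cos x - \<beta>) * cos (x / 2)"
| "odd_basis \<beta> (Suc (Suc k)) x = 2 * cos x * odd_basis \<beta> (Suc k) x - odd_basis \<beta> k x"

fun even_basis :: "real \<Rightarrow> nat \<Rightarrow> real \<Rightarrow> real" where
  "even_basis \<beta> 0 x = 1"
| "even_basis \<beta> (Suc 0) x = 2 * cos x + 1 - \<beta>"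
| "even_basis \<beta> (Suc (Suc k)) x = 2 * cos x * even_basis \<beta> (Suc k) x
     - (if k = 0 then 1 + \<beta> else 1) * even_basis \<beta> k x"

text \<open>The imaginary part of w^(a - 1/2) (w - \<beta>), w = e^(i x), which is sin (x / 2) times
  a Bernstein-Szego function. \<open>a\<close> runs over the integers for the even family and over
  the half-integers for the odd one.\<close>

definition half_wave :: "real \<Rightarrow> real \<Rightarrow> real \<Rightarrow> real" where
  "half_wave \<beta> a x = sin ((a + 1 / 2) * x) - \<beta> * sin ((a - 1 / 2) * x)"

lemma half_wave_rec: "half_wave \<beta> (a + 2) x = 2 * cos x * half_wave \<beta> (a + 1) x - half_wave \<beta> a x"
proof -
  have "sin (u + x) = 2 * cos x * sin u - sin (u - x)" for u
    by (simp add: sin_add sin_diff)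
  note sin_rec = this
  have 1: "sin ((a + 2 + 1 / 2) * x) = 2 * cos x * sin ((a + 1 + 1 / 2) * x) - sin ((a + 1 / 2) * x)"
    using sin_rec[of "(a + 1 + 1 / 2) * x"] by (simp add: algebra_simps)
  have 2: "sin ((a + 2 - 1 / 2) * x) = 2 * cos x * sin ((a + 1 - 1 / 2) * x) - sin ((a - 1 / 2) * x)"
    using sin_rec[of "(a + 1 - 1 / 2) * x"] by (simp add: algebra_simps)
  show ?thesis
    unfolding half_wave_def 1 2 by (simp add: right_diff_distrib)
qed

lemma odd_basis_eq: "sin (x / 2) * (2 * odd_basis \<beta> k x) = half_wave \<beta> (real k + 1 / 2) x"
proof (induction \<beta> k x rule: odd_basis.induct)
  case (1 \<beta> x)
  then show ?case using sin_double[of "x / 2"] by (simp add: half_wave_def)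
next
  case (2 \<beta> x)
  have "sin (x / 2) * (2 * odd_basis \<beta> (Suc 0) x) = (2 * cos x - \<beta>) * sin x"
    using sin_double[of "x / 2"] by simp
  also have "\<dots> = half_wave \<beta> (real (Suc 0) + 1 / 2) x"
    using sin_double[of x] by (simp add: half_wave_def algebra_simps)
  finally show ?case .
next
  case (3 \<beta> k x)
  have "sin (x / 2) * (2 * odd_basis \<beta> (Suc (Suc k)) x)
      = 2 * cos x * (sin (x / 2) * (2 * odd_basis \<beta> (Suc k) x)) - sin (x / 2) * (2 * odd_basis \<beta> k x)"
    by (simp add: algebra_simps)
  then show ?case
    unfolding 3 using half_wave_rec[of \<beta> "real k + 1 / 2" x] by (simp add: add_ac)
qed

text \<open>The origin of the exceptional factor 1 + \<beta> at index 0, in the recursion and in the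
  norms of the even family.\<close>

lemma half_wave_0: "half_wave \<beta> 0 x = sin (x / 2) * (1 + \<beta>)"
  by (simp add: half_wave_def algebra_simps)

text \<open>Strong induction with k = 1 apart, where wave 0 absorbs the exceptional coefficient of
  the recursion.\<close>

lemma even_basis_eq: "sin (x / 2) * even_basis \<beta> (Suc k) x = half_wave \<beta> (real (Suc k)) x"
proof (induction k rule: less_induct)
  case (less k)
  have wave_1: "sin (x / 2) * even_basis \<beta> (Suc 0) x = half_wave \<beta> 1 x"
  proof -
    have "sin (x + x / 2) = 2 * cos x * sin (x / 2) + sin (x / 2)"
      using sin_add[of x "x / 2"] sin_diff[of x "x / 2"] by simp
    then show ?thesis by (simp add: half_wave_def algebra_simps)
  qed
  consider "k = 0" | "k = 1" | j where "k = Suc (Suc j)"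
    by (metis One_nat_def old.nat.exhaust)
  then show ?case
  proof cases
    case 1
    then show ?thesis using wave_1 by simp
  next
    case 2
    then have "sin (x / 2) * even_basis \<beta> (Suc k) x
        = 2 * cos x * (sin (x / 2) * even_basis \<beta> (Suc 0) x) - half_wave \<beta> 0 x"
      by (simp add: half_wave_0 algebra_simps)
    then show ?thesis
      unfolding wave_1 using half_wave_rec[of \<beta> 0 x] 2 by simp
  next
    case 3
    then have "sin (x / 2) * even_basis \<beta> (Suc k) x
        = 2 * cos x * (sin (x / 2) * even_basis \<beta> (Suc (Suc j)) x) - sin (x / 2) * even_basis \<beta> (Suc j) x"
      by (simp add: algebra_simps)
    then show ?thesis
      using less[of "Suc j"] less[of j] half_wave_rec[of \<beta> "real (Suc j)" x] 3 by (simp add: add_ac)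
  qed
qed

text \<open>Product to sum: the difference frequency carries the factor \<open>poisson_den\<close>,
  which cancels against the weight, and the sum frequency carries the numerator of
  \<open>skew_poisson\<close>.\<close>

lemma half_wave_mult:
  "half_wave \<beta> a x * half_wave \<beta> b x = (cos ((a - b) * x) * poisson_den \<beta> x
     - (cos ((a + b + 1) * x) - 2 * \<beta> * cos ((a + b) * x) + \<beta>\<^sup>2 * cos ((a + b - 1) * x))) / 2"
proof -
  have p: "sin u * sin v = (cos (u - v) - cos (u + v)) / 2" for u v :: real
    by (simp add: cos_diff cos_add)
  define u where "u = (a + 1 / 2) * x"
  define v where "v = (b + 1 / 2) * x"
  have "half_wave \<beta> a x * half_wave \<beta> b x
     = sin u * sin v - \<beta> * (sin u * sin (v - x)) - \<beta> * (sin (u - x) * sin v)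
       + \<beta>\<^sup>2 * (sin (u - x) * sin (v - x))"
    by (simp add: half_wave_def u_def v_def algebra_simps power2_eq_square)
  also have "\<dots> = ((1 + \<beta>\<^sup>2) * cos (u - v) - \<beta> * (cos (u - v + x) + cos (u - v - x))
       - (cos (u + v) - 2 * \<beta> * cos (u + v - x) + \<beta>\<^sup>2 * cos (u + v - 2 * x))) / 2"
  proof -
    have args: "u - (v - x) = u - v + x" "u - x - v = u - v - x" "u + (v - x) = u + v - x"
      "u - x + v = u + v - x" "u - x - (v - x) = u - v" "u - x + (v - x) = u + v - 2 * x" by simp_all
    have "(A - B) / 2 - \<beta> * ((C - D) / 2) - \<beta> * ((E - D) / 2) + \<beta>\<^sup>2 * ((A - F) / 2)
      = ((1 + \<beta>\<^sup>2) * A - \<beta> * (C + E) - (B - 2 * \<beta> * D + \<beta>\<^sup>2 * F)) / 2" for A B C D E F :: real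
      by (simp add: field_simps)
    then show ?thesis unfolding p args by blast
  qed
  also have "cos (u - v + x) + cos (u - v - x) = 2 * cos x * cos (u - v)"
    unfolding cos_add[of "u - v" x] cos_diff[of "u - v" x] by simp
  also have "(1 + \<beta>\<^sup>2) * cos (u - v) - \<beta> * (2 * cos x * cos (u - v)) = cos (u - v) * poisson_den \<beta> x"
    by (simp add: poisson_den_def algebra_simps)
  also have "u - v = (a - b) * x" by (simp add: u_def v_def algebra_simps)
  also have "u + v = (a + b + 1) * x" by (simp add: u_def v_def algebra_simps)
  also have "(a + b + 1) * x - x = (a + b) * x" by (simp add: algebra_simps)
  also have "(a + b + 1) * x - 2 * x = (a + b - 1) * x" by (simp add: algebra_simps)
  finally show ?thesis .
qed

text \<open>The sin^2 (x / 2) in the weight turns both functions into waves, so away from x = 0 the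
  weighted product is 2 \<beta> (cos (d x) - \<open>skew_poisson \<beta> n x\<close>). The second
  part has a nonzero mean only for n = 0.\<close>

lemma bs_mean_half_waves:
  assumes \<beta>: "0 < \<beta>" "\<beta> \<le> 1"
    and f: "\<And>x. sin (x / 2) * f x = half_wave \<beta> a x"
    and g: "\<And>x. sin (x / 2) * g x = half_wave \<beta> b x"
    and ab: "a + b = real n" "a - b = of_int d"
  shows "bs_mean \<beta> (\<lambda>x. f x * g x) = 2 * \<beta> * ((if d = 0 then 1 else 0) + (if n = 0 then \<beta> else 0))"
proof -
  have eq: "f x * g x * bs_weight \<beta> x = 2 * \<beta> * (cos (of_int d * x) - skew_poisson \<beta> n x)"
    if x: "x \<in> {0..pi} - {0}" for x
  proof -
    have pos: "poisson_den \<beta> x > 0" using x cos_neq_1[of x] \<beta> by (intro poisson_den_pos) auto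
    have s: "sin (x / 2) > 0" using x by (intro sin_gt_zero) auto
    have "f x * g x * bs_weight \<beta> x = f x * g x * (4 * \<beta> * (sin (x / 2))\<^sup>2) / poisson_den \<beta> x"
      using bs_weight_eq[of \<beta> x] \<beta> x pos by (simp add: field_simps)
    also have "f x * g x * (4 * \<beta> * (sin (x / 2))\<^sup>2)
       = 4 * \<beta> * ((sin (x / 2) * f x) * (sin (x / 2) * g x))"
      by (simp add: power2_eq_square)
    also have "\<dots> = 2 * \<beta> * (cos (of_int d * x) * poisson_den \<beta> x
      - (cos ((real n + 1) * x) - 2 * \<beta> * cos (real n * x) + \<beta>\<^sup>2 * cos ((real n - 1) * x)))"
      unfolding f g half_wave_mult ab by simp
    also have "\<dots> / poisson_den \<beta> x = 2 * \<beta> * (cos (of_int d * x) - skew_poisson \<beta> n x)"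
      using pos by (simp add: skew_poisson_def diff_divide_distrib right_diff_distrib)
    finally show ?thesis .
  qed
  have "((\<lambda>x. 2 * \<beta> * (cos (of_int d * x) - skew_poisson \<beta> n x)) has_integral
      2 * \<beta> * ((if d = 0 then pi else 0) - (if n = 0 then - \<beta> * pi else 0))) {0..pi}"
    by (intro has_integral_mult_right has_integral_diff has_integral_cos_int has_integral_skew_poisson \<beta>)
  from has_integral_spike[OF negligible_sing eq this]
  have "integral {0..pi} (\<lambda>x. f x * g x * bs_weight \<beta> x)
      = 2 * \<beta> * ((if d = 0 then pi else 0) - (if n = 0 then - \<beta> * pi else 0))"
    by (rule integral_unique)
  then show ?thesis by (auto simp: bs_mean_def field_simps)
qed

text \<open>The orders k + 1/2 and l + 1/2 have a positive sum, so the correction term never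
  occurs.\<close>

lemma bs_mean_odd_basis:
  assumes \<beta>: "0 < \<beta>" "\<beta> \<le> 1"
  shows "bs_mean \<beta> (\<lambda>x. odd_basis \<beta> k x * odd_basis \<beta> l x) = (if k = l then \<beta> / 2 else 0)"
proof -
  have "bs_mean \<beta> (\<lambda>x. (2 * odd_basis \<beta> k x) * (2 * odd_basis \<beta> l x))
      = 2 * \<beta> * ((if int k - int l = 0 then 1 else 0) + (if k + l + 1 = 0 then \<beta> else 0))"
    by (rule bs_mean_half_waves[OF \<beta> odd_basis_eq odd_basis_eq]) auto
  moreover have "bs_mean \<beta> (\<lambda>x. (2 * odd_basis \<beta> k x) * (2 * odd_basis \<beta> l x))
      = 4 * bs_mean \<beta> (\<lambda>x. odd_basis \<beta> k x * odd_basis \<beta> l x)"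
    unfolding bs_mean_def times_divide_eq_right integral_mult_right[symmetric]
    by (simp add: mult_ac)
  ultimately show ?thesis by auto
qed

lemma bs_mean_even_basis:
  assumes \<beta>: "0 < \<beta>" "\<beta> \<le> 1"
  shows "bs_mean \<beta> (\<lambda>x. even_basis \<beta> k x * even_basis \<beta> l x)
     = (if k = l then 2 * \<beta> / (if k = 0 then 1 + \<beta> else 1) else 0)"
proof -
  \<comment> \<open>Normalises index 0, where the wave is 1 + \<beta> times the basis
    function.\<close>
  define e where "e k = (if k = 0 then 1 + \<beta> else 1)" for k :: nat
  have wave: "sin (x / 2) * (e k * even_basis \<beta> k x) = half_wave \<beta> (real k) x" for k x
    using even_basis_eq[of x \<beta>] half_wave_0[of \<beta> x] by (cases k) (auto simp: e_def)
  have "bs_mean \<beta> (\<lambda>x. (e k * even_basis \<beta> k x) * (e l * even_basis \<beta> l x))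
      = 2 * \<beta> * ((if int k - int l = 0 then 1 else 0) + (if k + l = 0 then \<beta> else 0))"
    by (rule bs_mean_half_waves[OF \<beta> wave wave]) auto
  moreover have "bs_mean \<beta> (\<lambda>x. (e k * even_basis \<beta> k x) * (e l * even_basis \<beta> l x))
      = e k * e l * bs_mean \<beta> (\<lambda>x. even_basis \<beta> k x * even_basis \<beta> l x)"
    unfolding bs_mean_def times_divide_eq_right integral_mult_right[symmetric]
    by (simp add: mult_ac)
  ultimately have *: "e k * e l * bs_mean \<beta> (\<lambda>x. even_basis \<beta> k x * even_basis \<beta> l x)
      = 2 * \<beta> * ((if k = l then 1 else 0) + (if k + l = 0 then \<beta> else 0))" by simp
  have e: "e k \<noteq> 0" "e l \<noteq> 0" using \<beta> by (auto simp: e_def)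
  have "bs_mean \<beta> (\<lambda>x. even_basis \<beta> k x * even_basis \<beta> l x)
     = 2 * \<beta> * ((if k = l then 1 else 0) + (if k + l = 0 then \<beta> else 0)) / (e k * e l)"
    using e unfolding *[symmetric] by simp
  moreover have "2 * \<beta> * ((if k = l then 1 else 0) + (if k + l = 0 then \<beta> else 0)) / (e k * e l)
     = (if k = l then 2 * \<beta> / (if k = 0 then 1 + \<beta> else 1) else 0)"
    using \<beta> by (auto simp: e_def divide_simps)
  ultimately show ?thesis by simp
qed

lemma continuous_odd_basis: "continuous_on A (odd_basis \<beta> k)"
proof (induction k rule: less_induct)
  case (less k)
  consider "k = 0" | "k = Suc 0" | j where "k = Suc (Suc j)"
    by (metis old.nat.exhaust)
  then show ?case
  proof cases
    case 3
    then show ?thesis using less[of j] less[of "Suc j"]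
      by (simp add: odd_basis.simps[abs_def] continuous_intros)
  qed (simp_all add: odd_basis.simps[abs_def] continuous_intros)
qed

lemma continuous_even_basis: "continuous_on A (even_basis \<beta> k)"
proof (induction k rule: less_induct)
  case (less k)
  consider "k = 0" | "k = Suc 0" | j where "k = Suc (Suc j)"
    by (metis old.nat.exhaust)
  then show ?case
  proof cases
    case 3
    then show ?thesis using less[of j] less[of "Suc j"]
      by (simp add: even_basis.simps[abs_def] continuous_intros)
  qed (simp_all add: even_basis.simps[abs_def] continuous_intros)
qed

section \<open>Linearity of the weighted mean\<close>

context
  fixes \<beta> :: real
  assumes \<beta>: "0 < \<beta>" "\<beta> \<le> 1"
begin

lemma bs_mean_integrable:
  "continuous_on {0..pi} f \<Longrightarrow> (\<lambda>x. f x * bs_weight \<beta> x) integrable_on {0..pi}"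
  by (intro integrable_continuous_real continuous_intros continuous_bs_weight \<beta>)

lemma bs_mean_add:
  assumes "continuous_on {0..pi} f" "continuous_on {0..pi} g"
  shows "bs_mean \<beta> (\<lambda>x. f x + g x) = bs_mean \<beta> f + bs_mean \<beta> g"
  using integral_add[OF bs_mean_integrable[OF assms(1)] bs_mean_integrable[OF assms(2)]]
  by (simp add: bs_mean_def distrib_right add_divide_distrib)

lemma bs_mean_scale: "bs_mean \<beta> (\<lambda>x. k * f x) = k * bs_mean \<beta> f"
  unfolding bs_mean_def times_divide_eq_right integral_mult_right[symmetric] by (simp add: mult_ac)

lemma bs_mean_sum:
  assumes "finite S" "\<And>k. k \<in> S \<Longrightarrow> continuous_on {0..pi} (f k)"
  shows "bs_mean \<beta> (\<lambda>x. \<Sum>k\<in>S. f k x) = (\<Sum>k\<in>S. bs_mean \<beta> (f k))"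
proof -
  have "integral {0..pi} (\<lambda>x. \<Sum>k\<in>S. f k x * bs_weight \<beta> x) = (\<Sum>k\<in>S. integral {0..pi} (\<lambda>x. f k x * bs_weight \<beta> x))"
    using assms by (intro integral_sum bs_mean_integrable)
  then show ?thesis by (simp add: bs_mean_def sum_distrib_right sum_divide_distrib)
qed

text \<open>Presents a Gram matrix as B G B^T, the shape to which \<open>det_of_congruence\<close>
  applies.\<close>

lemma bs_mean_expand:
  fixes n :: nat
  assumes w: "continuous_on {0..pi} w" and q: "\<And>k. continuous_on {0..pi} (q k)"
    and u: "\<And>x. u x = (\<Sum>k<n. a k * q k x)" and v: "\<And>x. v x = (\<Sum>k<n. b k * q k x)"
  shows "bs_mean \<beta> (\<lambda>x. w x * (u x * v x))
    = (\<Sum>k<n. \<Sum>l<n. a k * bs_mean \<beta> (\<lambda>x. w x * (q k x * q l x)) * b l)"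
proof -
  have "w x * (u x * v x) = (\<Sum>k<n. \<Sum>l<n. (a k * b l) * (w x * (q k x * q l x)))" for x
    unfolding u v unfolding sum_product unfolding sum_distrib_left
    by (intro sum.cong refl) (simp add: mult_ac)
  then have "bs_mean \<beta> (\<lambda>x. w x * (u x * v x))
     = bs_mean \<beta> (\<lambda>x. \<Sum>k<n. \<Sum>l<n. (a k * b l) * (w x * (q k x * q l x)))"
    by simp
  also have "\<dots> = (\<Sum>k<n. bs_mean \<beta> (\<lambda>x. \<Sum>l<n. (a k * b l) * (w x * (q k x * q l x))))"
    using w q by (intro bs_mean_sum continuous_intros) auto
  also have "\<dots> = (\<Sum>k<n. \<Sum>l<n. bs_mean \<beta> (\<lambda>x. (a k * b l) * (w x * (q k x * q l x))))"
    using w q by (intro sum.cong refl bs_mean_sum continuous_intros) auto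
  finally show ?thesis unfolding bs_mean_scale by (simp add: mult_ac)
qed

end

section \<open>Toeplitz determinants on an arc\<close>

lemma prod_power_sum: "(\<Prod>i<(M::nat). c ^ f i) = (c :: real) ^ (\<Sum>i<M. f i)"
  by (induction M) (simp_all add: power_add)

lemma sum_odd_numbers: "(\<Sum>i<M. 2 * i + 1) = M * (M :: nat)"
  by (induction M) simp_all

lemma sum_even_numbers: "(\<Sum>i<M. 2 * i) = M * (M - 1 :: nat)"
  by (induction M) (auto simp: algebra_simps)

text \<open>\<open>d\<close> is the continuant. The factorisation L X L^T has the pivots d (k + 1) /
  d k, whose product telescopes to d n; this is where d k \<noteq> 0 enters.\<close>

lemma det_of_tridiagonal:
  assumes d0: "d 0 = 1" and dpos: "\<And>k. d k \<noteq> 0"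
    and d1: "d 1 = a0"
    and rec: "\<And>k. d (Suc (Suc k)) = a * d (Suc k) - b\<^sup>2 * d k"
    and W: "\<And>k l. W k l = (if k = l then (if k = 0 then a0 else a) else if k = Suc l \<or> l = Suc k then - b else 0)"
  shows "det_of n W = d n"
proof -
  define L where "L k j = (if j = k then 1 else if k = Suc j then - b * d j / d k else 0)" for k j
  define X where "X k l = (if k = l then d (Suc k) / d k else 0)" for k l :: nat
  have "det_of n W = det_of n (\<lambda>i j. \<Sum>k<n. \<Sum>l<n. L i k * X k l * L j l)"
  proof (rule det_of_cong)
    fix i j assume ij: "i < n" "j < n"
    have 1: "(\<Sum>l<n. L i k * X k l * L j l) = L i k * (d (Suc k) / d k) * L j k" if "k < n" for k
    proof -
      have "(\<Sum>l<n. L i k * X k l * L j l) = (\<Sum>l<n. if l = k then L i k * (d (Suc k) / d k) * L j k else 0)"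
        by (intro sum.cong) (auto simp: X_def)
      then show ?thesis using that by simp
    qed
    have "(\<Sum>k<n. \<Sum>l<n. L i k * X k l * L j l) = (\<Sum>k<n. L i k * (d (Suc k) / d k) * L j k)"
      using 1 by simp
    also have "\<dots> = (\<Sum>k\<in>(if i = 0 then {0} else {i, i - 1}). L i k * (d (Suc k) / d k) * L j k)"
      using ij by (intro sum.mono_neutral_right) (auto simp: L_def)
    also have "\<dots> = W i j"
    proof (cases i)
      case 0
      then show ?thesis using d0 d1 dpos by (auto simp: W L_def)
    next
      case (Suc m)
      have "a = d (Suc (Suc m)) / d (Suc m) + b * b * d m / d (Suc m)"
        using rec[of m] dpos[of "Suc m"] by (simp add: field_simps power2_eq_square)
      then show ?thesis using Suc dpos dpos[of m] dpos[of "Suc m"]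
        by (auto simp: W L_def field_simps)
    qed
    finally show "W i j = (\<Sum>k<n. \<Sum>l<n. L i k * X k l * L j l)" by simp
  qed
  also have "\<dots> = (\<Prod>i<n. L i i)\<^sup>2 * det_of n X"
    by (rule det_of_congruence) (auto simp: L_def)
  also have "(\<Prod>i<n. L i i) = 1" by (simp add: L_def)
  also have "det_of n X = (\<Prod>i<n. d (Suc i) / d i)"
    by (subst det_of_lower_triangular) (auto simp: X_def)
  also have "\<dots> = d n" using dpos d0 by (induction n) auto
  finally show ?thesis by simp
qed

text \<open>\<open>c\<close> and \<open>t\<close> stand for cos (h / 2) and sin (h / 2). In the
  result the two powers of \<open>c\<close> are the squared products of the leading coefficients in
  the cosine and the sine block, \<beta>^(2M) collects the norms, and the bracket is the continuant
  of the sine block.\<close>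

theorem toeplitz_det:
  fixes \<theta> :: "real \<Rightarrow> real"
  assumes \<beta>: "0 < \<beta>" "\<beta> \<le> 1" and ct: "c\<^sup>2 + t\<^sup>2 = 1" and t: "0 < t" "t < 1"
    and r: "0 \<le> r" "1 - \<beta> = r * t * (1 + \<beta>)"
    and \<theta>: "\<And>x. cos (\<theta> x / 2) = c * cos (x / 2)"
  shows "det_of (M + M) (\<lambda>i j. bs_mean \<beta> (\<lambda>x. cos ((real i - real j) * \<theta> x)))
    = c ^ (2 * (M * M)) * c ^ (2 * (M * (M - 1))) * \<beta> ^ (2 * M)
      * ((1 + r) / 2 * (1 + t) ^ (2 * M) + (1 - r) / 2 * (1 - t) ^ (2 * M))"
proof -
  have cos_sq: "(cos (x / 2))\<^sup>2 = (1 + cos x) / 2" for x :: real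
    using cos_double_cos[of "x / 2"] by simp
  \<comment> \<open>2 cos \<theta> is affine in 2 cos x with slope c^2; this makes Chebyshev
    functions of \<theta> triangular in the families in x.\<close>
  have cos\<theta>: "2 * cos (\<theta> x) = c\<^sup>2 * (2 * cos x) + (2 * c\<^sup>2 - 2)" for x
  proof -
    have "cos (\<theta> x) = 2 * (c * cos (x / 2))\<^sup>2 - 1"
      using cos_double_cos[of "\<theta> x / 2"] \<theta>[of x] by simp
    then show ?thesis unfolding power_mult_distrib cos_sq by (simp add: algebra_simps)
  qed
  have sin\<theta>: "(sin (\<theta> x / 2))\<^sup>2 = (1 + t\<^sup>2) / 2 + (- c\<^sup>2 / 4) * (2 * cos x)" for x
  proof -
    have "(sin (\<theta> x / 2))\<^sup>2 = (1 - cos (\<theta> x)) / 2"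
      using cos_double_sin[of "\<theta> x / 2"] by simp
    then show ?thesis using cos\<theta>[of x] ct by (simp add: field_simps)
  qed
  define C where "C i x = cos ((real i + 1 / 2) * \<theta> x)" for i x
  \<comment> \<open>The even basis for \<beta> = 0 is sin ((i + 1/2) \<theta>) / sin (\<theta> / 2),
    here as a polynomial in cos \<theta> without a division.\<close>
  define S where "S i x = even_basis 0 i (\<theta> x)" for i x
  \<comment> \<open>sin^2 (\<theta> / 2) as a function of x, produced by the factors sin (\<theta> /
    2) split off from two sines.\<close>
  define w where "w x = (1 + t\<^sup>2) / 2 + (- c\<^sup>2 / 4) * (2 * cos x)" for x :: real
  define a where "a k = (if k = 0 then \<beta> - 1 else 0)" for k :: nat
  define b where "b k = (if k = 0 then 0 else if k = 1 then 1 + \<beta> else 1)" for k :: nat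
  have even_rec: "2 * cos x * even_basis \<beta> k x
     = even_basis \<beta> (Suc k) x + a k * even_basis \<beta> k x + b k * even_basis \<beta> (k - 1) x" for k x
    by (cases k) (auto simp: a_def b_def)
  have odd_rec: "2 * cos x * odd_basis \<beta> k x
     = odd_basis \<beta> (Suc k) x + (if k = 0 then \<beta> else 0) * odd_basis \<beta> k x
       + (if k = 0 then 0 else 1) * odd_basis \<beta> (k - 1) x" for k x
    by (cases k) (auto simp: algebra_simps)
  have cos_rec: "cos (u + y) = 2 * cos y * cos u - cos (u - y)" for u y :: real
    by (simp add: cos_add cos_diff)
  obtain B where B: "\<And>i k. i < k \<Longrightarrow> B i k = 0" "\<And>i. B i i = c * (c\<^sup>2) ^ i"
    "\<And>n i x. i < n \<Longrightarrow> C i x = (\<Sum>k<n. B i k * odd_basis \<beta> k x)"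
  \<comment> \<open>The first step is cos (3 \<theta> / 2) = (2 cos \<theta> - 1) cos (\<theta> /
    2), which lowers the shift by 1.\<close>
  proof (rule triangular_expansion[where X = "\<lambda>x. 2 * cos x" and f = C and q = "odd_basis \<beta>"
        and l = c and \<alpha> = "c\<^sup>2" and \<delta> = "2 * c\<^sup>2 - 2" and \<delta>' = "2 * c\<^sup>2 - 3"])
    show "C 0 x = c * odd_basis \<beta> 0 x" for x using \<theta>[of x] by (simp add: C_def)
    show "C 1 x = (c\<^sup>2 * (2 * cos x) + (2 * c\<^sup>2 - 3)) * C 0 x" for x
    proof -
      have "C 1 x = (2 * cos (\<theta> x) - 1) * C 0 x"
        using cos_rec[of "\<theta> x / 2" "\<theta> x"] by (simp add: C_def algebra_simps)
      then show ?thesis unfolding cos\<theta> by simp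
    qed
    show "C (Suc (Suc i)) x = (c\<^sup>2 * (2 * cos x) + (2 * c\<^sup>2 - 2)) * C (Suc i) x - C i x" for i x
      unfolding cos\<theta>[symmetric]
      using cos_rec[of "(real i + 3 / 2) * \<theta> x" "\<theta> x"] by (simp add: C_def algebra_simps)
  qed (use odd_rec in blast)+
  obtain B' where B': "\<And>i k. i < k \<Longrightarrow> B' i k = 0" "\<And>i. B' i i = 1 * (c\<^sup>2) ^ i"
    "\<And>n i x. i < n \<Longrightarrow> S i x = (\<Sum>k<n. B' i k * even_basis \<beta> k x)"
  \<comment> \<open>Here sin (3 \<theta> / 2) = (2 cos \<theta> + 1) sin (\<theta> / 2) raises the
    first shift by 1.\<close>
  proof (rule triangular_expansion[where X = "\<lambda>x. 2 * cos x" and f = S and q = "even_basis \<beta>"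
        and l = 1 and \<alpha> = "c\<^sup>2" and \<delta> = "2 * c\<^sup>2 - 2" and \<delta>' = "2 * c\<^sup>2 - 1"])
    show "S 0 x = 1 * even_basis \<beta> 0 x" for x by (simp add: S_def)
    show "S 1 x = (c\<^sup>2 * (2 * cos x) + (2 * c\<^sup>2 - 1)) * S 0 x" for x
      using cos\<theta>[of x] by (simp add: S_def)
    show "S (Suc (Suc i)) x = (c\<^sup>2 * (2 * cos x) + (2 * c\<^sup>2 - 2)) * S (Suc i) x - S i x" for i x
      unfolding cos\<theta>[symmetric] by (simp add: S_def)
  qed (use even_rec in blast)+
  have S_eq: "sin (\<theta> x / 2) * S i x = sin ((real i + 1 / 2) * \<theta> x)" for i x
    using even_basis_eq[of "\<theta> x" 0] by (cases i) (auto simp: S_def half_wave_def)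
  have cont_w: "continuous_on {0..pi} w" unfolding w_def by (intro continuous_intros)
  have cont_odd: "continuous_on {0..pi} (odd_basis \<beta> k)" for k by (rule continuous_odd_basis)
  have cont_even: "continuous_on {0..pi} (even_basis \<beta> k)" for k by (rule continuous_even_basis)
  define E where "E i j = bs_mean \<beta> (\<lambda>x. C i x * C j x)" for i j
  define D where "D i j = bs_mean \<beta> (\<lambda>x. w x * (S i x * S j x))" for i j
  have contC: "continuous_on {0..pi} (C i)" for i
  proof -
    have "C i = (\<lambda>x. \<Sum>k<Suc i. B i k * odd_basis \<beta> k x)" using B(3)[of i "Suc i"] by auto
    then show ?thesis by (simp only:) (intro continuous_intros cont_odd)
  qed
  have contS: "continuous_on {0..pi} (S i)" for i
  proof -
    have "S i = (\<lambda>x. \<Sum>k<Suc i. B' i k * even_basis \<beta> k x)" using B'(3)[of i "Suc i"] by auto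
    then show ?thesis by (simp only:) (intro continuous_intros cont_even)
  qed

  have "det_of M E = det_of M (\<lambda>i j. \<Sum>k<M. \<Sum>l<M. B i k * (if k = l then \<beta> / 2 else 0) * B j l)"
  proof (rule det_of_cong)
    fix i j assume ij: "i < M" "j < M"
    show "E i j = (\<Sum>k<M. \<Sum>l<M. B i k * (if k = l then \<beta> / 2 else 0) * B j l)"
      using bs_mean_expand[OF \<beta> continuous_on_const cont_odd B(3)[OF ij(1)] B(3)[OF ij(2)], of 1]
      by (simp add: E_def bs_mean_odd_basis[OF \<beta>])
  qed
  also have "\<dots> = (\<Prod>i<M. B i i)\<^sup>2 * det_of M (\<lambda>k l. if k = l then \<beta> / 2 else 0)"
    by (rule det_of_congruence[OF B(1)])
  also have "det_of M (\<lambda>k l. if k = l then \<beta> / 2 else 0) = (\<beta> / 2) ^ M"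
    by (subst det_of_lower_triangular) auto
  also have "(\<Prod>i<M. B i i) = (\<Prod>i<M. c ^ (2 * i + 1))"
    by (intro prod.cong) (auto simp: B(2) power_mult)
  also have "\<dots> = c ^ (M * M)" unfolding prod_power_sum sum_odd_numbers ..
  finally have detE: "det_of M E = c ^ (2 * (M * M)) * (\<beta> / 2) ^ M"
    by (simp add: power_mult[symmetric] mult.commute)

  \<comment> \<open>The additional factor \<open>w\<close> is linear in \<open>cos x\<close>, so the Gram matrix of the even basis becomes tridiagonal.\<close>
  define W where "W k l = bs_mean \<beta> (\<lambda>x. w x * (even_basis \<beta> k x * even_basis \<beta> l x))" for k l
  have W_eq: "W k l = (if k = l then (if k = 0 then \<beta> * (1 + t\<^sup>2 + 2 * r * t) / 2 else \<beta> * (1 + t\<^sup>2))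
      else if k = Suc l \<or> l = Suc k then - (\<beta> * c\<^sup>2 / 2) else 0)" for k l
  proof -
    define N where "N k l = bs_mean \<beta> (\<lambda>x. even_basis \<beta> k x * even_basis \<beta> l x)" for k l
    have "w x * (even_basis \<beta> k x * even_basis \<beta> l x)
      = (1 + t\<^sup>2) / 2 * (even_basis \<beta> k x * even_basis \<beta> l x) + (- c\<^sup>2 / 4) *
        (even_basis \<beta> (Suc k) x * even_basis \<beta> l x + (a k * (even_basis \<beta> k x * even_basis \<beta> l x)
         + b k * (even_basis \<beta> (k - 1) x * even_basis \<beta> l x)))" for x
    proof -
      have "w x * (even_basis \<beta> k x * even_basis \<beta> l x)
        = (1 + t\<^sup>2) / 2 * (even_basis \<beta> k x * even_basis \<beta> l x)
         + (- c\<^sup>2 / 4) * ((2 * cos x * even_basis \<beta> k x) * even_basis \<beta> l x)"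
        by (simp add: w_def algebra_simps)
      then show ?thesis unfolding even_rec[of x k] by (simp add: algebra_simps)
    qed
    then have "W k l = bs_mean \<beta> (\<lambda>x. (1 + t\<^sup>2) / 2 * (even_basis \<beta> k x * even_basis \<beta> l x) + (- c\<^sup>2 / 4) *
        (even_basis \<beta> (Suc k) x * even_basis \<beta> l x + (a k * (even_basis \<beta> k x * even_basis \<beta> l x)
         + b k * (even_basis \<beta> (k - 1) x * even_basis \<beta> l x))))"
      unfolding W_def by presburger
    also have "\<dots> = (1 + t\<^sup>2) / 2 * N k l + (- c\<^sup>2 / 4) * (N (Suc k) l + (a k * N k l + b k * N (k - 1) l))"
      unfolding N_def
      by (simp only: bs_mean_add[OF \<beta>] bs_mean_scale[OF \<beta>] continuous_intros cont_even)
    finally have W: "W k l = (1 + t\<^sup>2) / 2 * N k l + (- c\<^sup>2 / 4) * (N (Suc k) l + (a k * N k l + b k * N (k - 1) l))" .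
    have N: "N k l = (if k = l then 2 * \<beta> / (if k = 0 then 1 + \<beta> else 1) else 0)" for k l
      unfolding N_def by (rule bs_mean_even_basis[OF \<beta>])
    have c2: "c\<^sup>2 = 1 - t\<^sup>2" using ct by simp
    \<comment> \<open>The relation between \<beta>, r and t enters here, through the corner entry
      alone.\<close>
    have rt: "r * t = (1 - \<beta>) / (1 + \<beta>)" using r \<beta> by (simp add: field_simps)
    consider "k = l" "k = 0" | "k = l" "k \<noteq> 0" | "k = Suc l" | "l = Suc k" | "k \<noteq> l" "k \<noteq> Suc l" "l \<noteq> Suc k"
      by blast
    then show ?thesis
    proof cases
      case 1
      have "W k l = \<beta> * ((1 + t\<^sup>2) + (1 - t\<^sup>2) * (1 - \<beta>) / 2) / (1 + \<beta>)"
      proof -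
        have "N k l = 2 * \<beta> / (1 + \<beta>)" "N (Suc k) l = 0" using 1 by (simp_all add: N)
        then have "W k l = (1 + t\<^sup>2) / 2 * (2 * \<beta> / (1 + \<beta>)) + (- (1 - t\<^sup>2) / 4) * ((\<beta> - 1) * (2 * \<beta> / (1 + \<beta>)))"
          using 1 unfolding W c2 by (simp add: a_def b_def)
        also have "\<dots> = ((1 + t\<^sup>2) / 2 + (- (1 - t\<^sup>2) / 4) * (\<beta> - 1)) * (2 * \<beta>) / (1 + \<beta>)"
        proof -
          have "p * (q / d) + s * (e * (q / d)) = (p + s * e) * q / d" for p q d s e :: real
            by (simp add: distrib_right add_divide_distrib)
          then show ?thesis .
        qed
        also have "((1 + t\<^sup>2) / 2 + (- (1 - t\<^sup>2) / 4) * (\<beta> - 1)) * (2 * \<beta>)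
            = \<beta> * ((1 + t\<^sup>2) + (1 - t\<^sup>2) * (1 - \<beta>) / 2)"
          by (simp add: field_simps)
        finally show ?thesis .
      qed
      also have "\<dots> = \<beta> * (1 + t\<^sup>2 + 2 * (r * t)) / 2"
        unfolding rt using \<beta> by (simp add: divide_simps) (simp add: algebra_simps)
      finally show ?thesis using 1 by (simp add: mult.assoc)
    next
      case 2
      then show ?thesis unfolding W N by (cases k) (auto simp: a_def b_def)
    next
      case 3
      \<comment> \<open>For l = 0 the recursion coefficient 1 + \<beta> cancels the exceptional
        norm, so the off-diagonal entries are uniform.\<close>
      then show ?thesis unfolding W N using \<beta> by (auto simp: a_def b_def field_simps)
    next
      case 4
      then show ?thesis unfolding W N by (auto simp: a_def b_def field_simps)
    next
      case 5
      then show ?thesis unfolding W N by (cases k) (auto simp: a_def b_def)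
    qed
  qed
  \<comment> \<open>Up to (\<beta> / 2)^k the continuant has the characteristic equation A^2 = 2 (1
    + t^2) A - (1 - t^2)^2 with roots (1 + t)^2 and (1 - t)^2; the weights fit P 0 = 1 and P 1 = 1 +
    t^2 + 2 r t.\<close>
  define P where "P k = (1 + r) / 2 * ((1 + t)\<^sup>2) ^ k + (1 - r) / 2 * ((1 - t)\<^sup>2) ^ k" for k
  \<comment> \<open>For r > 1 the second weight is negative; comparing the two powers still shows
    that no pivot vanishes.\<close>
  have P_pos: "0 < P k" for k
  proof -
    have "((1 - t)\<^sup>2) ^ k \<le> ((1 + t)\<^sup>2) ^ k"
      using t by (intro power_mono) auto
    then have "0 \<le> r * (((1 + t)\<^sup>2) ^ k - ((1 - t)\<^sup>2) ^ k)" using r by simp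
    moreover have "0 < ((1 - t)\<^sup>2) ^ k" "0 < ((1 + t)\<^sup>2) ^ k" using t by auto
    ultimately show ?thesis unfolding P_def by (simp add: field_simps)
  qed
  have P_rec: "P (Suc (Suc k)) = 2 * (1 + t\<^sup>2) * P (Suc k) - (c\<^sup>2)\<^sup>2 * P k" for k
  proof -
    have c2: "c\<^sup>2 = 1 - t\<^sup>2" using ct by simp
    have "A ^ Suc (Suc k) = 2 * (1 + t\<^sup>2) * A ^ Suc k - (c\<^sup>2)\<^sup>2 * A ^ k"
      if "A * A = 2 * (1 + t\<^sup>2) * A - (c\<^sup>2)\<^sup>2" for A :: real
    proof -
      have "A ^ Suc (Suc k) = A * A * A ^ k" by simp
      then show ?thesis unfolding that by (simp add: left_diff_distrib)
    qed
    moreover have "(1 + t)\<^sup>2 * (1 + t)\<^sup>2 = 2 * (1 + t\<^sup>2) * (1 + t)\<^sup>2 - (c\<^sup>2)\<^sup>2"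
      "(1 - t)\<^sup>2 * (1 - t)\<^sup>2 = 2 * (1 + t\<^sup>2) * (1 - t)\<^sup>2 - (c\<^sup>2)\<^sup>2"
      unfolding c2 by (simp_all add: power2_eq_square algebra_simps)
    ultimately have "((1 + t)\<^sup>2) ^ Suc (Suc k) = 2 * (1 + t\<^sup>2) * ((1 + t)\<^sup>2) ^ Suc k - (c\<^sup>2)\<^sup>2 * ((1 + t)\<^sup>2) ^ k"
      "((1 - t)\<^sup>2) ^ Suc (Suc k) = 2 * (1 + t\<^sup>2) * ((1 - t)\<^sup>2) ^ Suc k - (c\<^sup>2)\<^sup>2 * ((1 - t)\<^sup>2) ^ k"
      by blast+
    then show ?thesis unfolding P_def by (simp only: right_diff_distrib distrib_left mult_ac)
  qed
  have "det_of M D = det_of M (\<lambda>i j. \<Sum>k<M. \<Sum>l<M. B' i k * W k l * B' j l)"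
    unfolding D_def W_def
    by (intro det_of_cong bs_mean_expand[OF \<beta> cont_w cont_even] B'(3))
  also have "\<dots> = (\<Prod>i<M. B' i i)\<^sup>2 * det_of M W"
    by (rule det_of_congruence[OF B'(1)])
  also have "det_of M W = (\<beta> / 2) ^ M * P M"
  proof (rule det_of_tridiagonal[where d = "\<lambda>k. (\<beta> / 2) ^ k * P k" and b = "\<beta> * c\<^sup>2 / 2" and a = "\<beta> * (1 + t\<^sup>2)"
        and a0 = "\<beta> * (1 + t\<^sup>2 + 2 * r * t) / 2"])
    show "(\<beta> / 2) ^ 0 * P 0 = 1" by (simp add: P_def field_simps)
    show "(\<beta> / 2) ^ k * P k \<noteq> 0" for k using P_pos[of k] \<beta> by simp
    show "(\<beta> / 2) ^ 1 * P 1 = \<beta> * (1 + t\<^sup>2 + 2 * r * t) / 2"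
      by (simp add: P_def power2_eq_square field_simps)
    show "(\<beta> / 2) ^ Suc (Suc k) * P (Suc (Suc k))
       = \<beta> * (1 + t\<^sup>2) * ((\<beta> / 2) ^ Suc k * P (Suc k)) - (\<beta> * c\<^sup>2 / 2)\<^sup>2 * ((\<beta> / 2) ^ k * P k)" for k
      unfolding P_rec by (simp add: power2_eq_square algebra_simps)
  qed (rule W_eq)
  also have "(\<Prod>i<M. B' i i) = (\<Prod>i<M. c ^ (2 * i))"
    by (intro prod.cong) (auto simp: B'(2) power_mult)
  also have "\<dots> = c ^ (M * (M - 1))" unfolding prod_power_sum sum_even_numbers ..
  finally have detD: "det_of M D = c ^ (2 * (M * (M - 1))) * ((\<beta> / 2) ^ M * P M)"
    by (simp add: power_mult[symmetric] mult.commute)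

  have "bs_mean \<beta> (\<lambda>x. cos ((real i - real j) * \<theta> x)) = E (fold_index M i) (fold_index M j)
       + fold_sign M i * fold_sign M j * D (fold_index M i) (fold_index M j)" if "i < M + M" "j < M + M" for i j
  proof -
    define I J where "I = fold_index M i" and "J = fold_index M j"
    define u v where "u = fold_sign M i" and "v = fold_sign M j"
    have uv: "u = 1 \<or> u = - 1" "v = 1 \<or> v = - 1" by (auto simp: u_def v_def fold_sign_def)
    have "real i - real j = u * (real I + 1 / 2) - v * (real J + 1 / 2)"
      using that by (auto simp: u_def v_def I_def J_def fold_sign_def fold_index_def of_nat_diff)
    then have "cos ((real i - real j) * \<theta> x) = C I x * C J x + u * v * (w x * (S I x * S J x))" for x
    proof -
      assume *: "real i - real j = u * (real I + 1 / 2) - v * (real J + 1 / 2)"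
      have "cos ((real i - real j) * \<theta> x)
        = cos (u * ((real I + 1 / 2) * \<theta> x) - v * ((real J + 1 / 2) * \<theta> x))"
        unfolding * by (simp add: algebra_simps)
      \<comment> \<open>cos is even and sin is odd, so the signs survive only in the product of
        sines.\<close>
      also have "\<dots> = C I x * C J x + u * v * (sin ((real I + 1 / 2) * \<theta> x) * sin ((real J + 1 / 2) * \<theta> x))"
        using uv by (auto simp: cos_diff cos_add C_def)
      also have "sin ((real I + 1 / 2) * \<theta> x) * sin ((real J + 1 / 2) * \<theta> x) = w x * (S I x * S J x)"
        unfolding S_eq[symmetric] w_def sin\<theta>[symmetric] by (simp add: power2_eq_square)
      finally show ?thesis .
    qed
    then have "bs_mean \<beta> (\<lambda>x. cos ((real i - real j) * \<theta> x))
       = bs_mean \<beta> (\<lambda>x. C I x * C J x + u * v * (w x * (S I x * S J x)))" by presburger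
    also have "\<dots> = E I J + u * v * D I J"
      unfolding E_def D_def bs_mean_scale[OF \<beta>, symmetric]
      by (intro bs_mean_add[OF \<beta>] continuous_intros contC contS cont_w)
    finally show ?thesis by (simp add: I_def J_def u_def v_def)
  qed
  then have "det_of (M + M) (\<lambda>i j. bs_mean \<beta> (\<lambda>x. cos ((real i - real j) * \<theta> x)))
     = 4 ^ M * det_of M E * det_of M D"
    unfolding det_of_reflection[symmetric] by (rule det_of_cong)
  also have "\<dots> = c ^ (2 * (M * M)) * c ^ (2 * (M * (M - 1))) * (4 * (\<beta> / 2) * (\<beta> / 2)) ^ M * P M"
    unfolding detE detD power_mult_distrib by simp
  also have "(4 * (\<beta> / 2) * (\<beta> / 2)) ^ M = \<beta> ^ (2 * M)"
    by (simp add: power_mult power2_eq_square)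
  also have "P M = (1 + r) / 2 * (1 + t) ^ (2 * M) + (1 - r) / 2 * (1 - t) ^ (2 * M)"
    by (simp add: P_def power_mult)
  finally show ?thesis .
qed

section \<open>Convergence of the discretised kernel\<close>

text \<open>
  Grid spacing \<open>h\<close> turns the gap \<open>(-1, 1)\<close> of the symbol into the arc \<open>\<bar>\<theta>\<bar> < h\<close>. The complementary
  arc is parametrised by \<open>cos (\<theta> / 2) = cos (h / 2) * cos (x / 2)\<close> with \<open>0 < x < \<pi>\<close>, the analogue
  of \<open>k\<^sup>2 = 1 + p\<^sup>2\<close>, and \<open>bs_weight (bs_beta r h) x dx\<close> replaces \<open>p\<^sup>2 / (p\<^sup>2 + r\<^sup>2) dp\<close>.
\<close>

definition bs_beta :: "real \<Rightarrow> real \<Rightarrow> real" where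
  "bs_beta r h = (1 - r * sin (h / 2)) / (1 + r * sin (h / 2))"

definition bs_angle :: "real \<Rightarrow> real \<Rightarrow> real" where
  "bs_angle h x = 2 * arccos (cos (h / 2) * cos (x / 2))"

definition bs_angle' :: "real \<Rightarrow> real \<Rightarrow> real" where
  "bs_angle' h x = cos (h / 2) * sin (x / 2) / sqrt (1 - (cos (h / 2) * cos (x / 2))\<^sup>2)"

text \<open>Division by \<open>h\<close> makes this a kernel value: the identity minus
  \<open>h\<close> times these entries is the Toeplitz matrix of the weighted means.\<close>

definition bs_entry :: "real \<Rightarrow> real \<Rightarrow> int \<Rightarrow> real" where
  "bs_entry r h k = ((if k = 0 then 1 else 0)
     - bs_mean (bs_beta r h) (\<lambda>x. cos (of_int k * bs_angle h x))) / h"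

text \<open>Defect of the weight against arc length d\<theta> on the complementary arc, with its
  oscillating factor.\<close>

definition bs_integrand :: "real \<Rightarrow> real \<Rightarrow> int \<Rightarrow> real \<Rightarrow> real" where
  "bs_integrand r h k x =
     cos (of_int k * bs_angle h x) * (bs_angle' h x - bs_weight (bs_beta r h) x)"

text \<open>Halving the angle: sin y = 2 sin u cos u \<ge> 2 u cos^2 u with u = y / 2 \<le> pi / 4,
  where cos^2 u \<ge> 1/2. It supplies the lower bound for sin^2 (x / 2) in the domination
  below.\<close>

lemma sin_ge_half:
  assumes "0 \<le> y" "y \<le> pi / 2"
  shows "y / 2 \<le> sin y"
proof -
  define u where "u = y / 2"
  have u: "0 \<le> u" "u \<le> pi / 4" using assms by (auto simp: u_def)
  have "sin 0 - 0 * cos 0 \<le> sin u - u * cos u"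
  proof (rule DERIV_nonneg_imp_nondecreasing[OF u(1), of "\<lambda>u. sin u - u * cos u"])
    fix x assume x: "0 \<le> x" "x \<le> u"
    have "((\<lambda>u. sin u - u * cos u) has_real_derivative x * sin x) (at x)"
      by (auto intro!: derivative_eq_intros)
    moreover have "0 \<le> x * sin x" using x u by (intro mult_nonneg_nonneg sin_ge_zero) auto
    ultimately show "\<exists>y. ((\<lambda>u. sin u - u * cos u) has_real_derivative y) (at x) \<and> 0 \<le> y" by blast
  qed
  then have 1: "u * cos u \<le> sin u" by simp
  have c: "sqrt 2 / 2 \<le> cos u"
    using u cos_monotone_0_pi_le[of u "pi / 4"] by (simp add: cos_45)
  then have "(sqrt 2 / 2)\<^sup>2 \<le> (cos u)\<^sup>2" by (intro power_mono) auto
  then have c2: "1 / 2 \<le> (cos u)\<^sup>2" by (simp add: power_divide)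
  have c0: "0 \<le> cos u" using c by (meson order.trans real_sqrt_ge_zero zero_le_divide_iff zero_le_numeral)
  have "y / 2 = 2 * u * (1 / 2)" by (simp add: u_def)
  also have "\<dots> \<le> 2 * u * (cos u)\<^sup>2" using c2 u by (intro mult_left_mono) auto
  also have "\<dots> = 2 * (u * cos u) * cos u" by (simp add: power2_eq_square)
  also have "\<dots> \<le> 2 * sin u * cos u" using 1 c0 by (intro mult_right_mono) auto
  also have "\<dots> = sin y" using sin_double[of u] by (simp add: u_def)
  finally show ?thesis .
qed

context
  fixes r h :: real
  assumes r: "0 \<le> r" and h: "0 < h" "h \<le> 1" "r * h \<le> 1"
begin

lemma sin_half_bounds: "0 < sin (h / 2)" "sin (h / 2) \<le> h / 2" "sin (h / 2) < 1"
proof -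
  show "0 < sin (h / 2)" using h pi_gt3 by (intro sin_gt_zero) auto
  show "sin (h / 2) \<le> h / 2" using h by (intro sin_x_le_x) auto
  then show "sin (h / 2) < 1" using h by linarith
qed

lemma cos_half_bounds: "0 < cos (h / 2)" "cos (h / 2) < 1" "3 / 4 \<le> (cos (h / 2))\<^sup>2"
proof -
  show "0 < cos (h / 2)" using h pi_gt3 by (intro cos_gt_zero) auto
  show "cos (h / 2) < 1" using h pi_gt3 cos_monotone_0_pi[of 0 "h / 2"] by simp
  have "(sin (h / 2))\<^sup>2 \<le> (1 / 2)\<^sup>2"
    using sin_half_bounds h by (intro power_mono) auto
  then show "3 / 4 \<le> (cos (h / 2))\<^sup>2" by (simp add: cos_squared_eq power_divide)
qed

lemma r_sin_half: "0 \<le> r * sin (h / 2)" "r * sin (h / 2) \<le> 1 / 2" "r * sin (h / 2) \<le> r * h / 2"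
proof -
  show "0 \<le> r * sin (h / 2)" using r sin_half_bounds by simp
  show *: "r * sin (h / 2) \<le> r * h / 2" using mult_left_mono[OF sin_half_bounds(2) r] by simp
  show "r * sin (h / 2) \<le> 1 / 2" using * h by linarith
qed

lemma bs_beta_bounds: "0 < bs_beta r h" "bs_beta r h \<le> 1"
  using r_sin_half by (auto simp: bs_beta_def divide_simps)

text \<open>\<open>bs_beta\<close> is the solution of this equation, the compatibility condition of
  \<open>toeplitz_det\<close> for t = sin (h / 2).\<close>

lemma bs_beta_eq: "1 - bs_beta r h = r * sin (h / 2) * (1 + bs_beta r h)"
  using r_sin_half by (simp add: bs_beta_def field_simps)

lemma cos_prod_bounds: "\<bar>cos (h / 2) * cos (x / 2)\<bar> < 1"
proof -
  have "\<bar>cos (h / 2)\<bar> * \<bar>cos (x / 2)\<bar> \<le> \<bar>cos (h / 2)\<bar> * 1"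
    by (intro mult_left_mono) auto
  then show ?thesis using cos_half_bounds(1,2) unfolding abs_mult by linarith
qed

lemma cos_bs_angle: "cos (bs_angle h x / 2) = cos (h / 2) * cos (x / 2)"
  using cos_prod_bounds[of x] by (simp add: bs_angle_def abs_le_iff less_imp_le)

lemma bs_angle_deriv: "(bs_angle h has_real_derivative bs_angle' h x) (at x within A)"
proof -
  have "-1 < cos (h / 2) * cos (x / 2)" "cos (h / 2) * cos (x / 2) < 1"
    using cos_prod_bounds[of x] by linarith+
  then show ?thesis
    unfolding bs_angle_def[abs_def] bs_angle'_def
    by (auto intro!: derivative_eq_intros simp: field_simps)
qed

lemma bs_angle_at_ends: "bs_angle h 0 = h" "bs_angle h pi = pi"
  using h pi_gt3 arccos_cos[of "h / 2"] by (auto simp: bs_angle_def)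

lemma sqrt_arg_pos: "0 < 1 - (cos (h / 2) * cos (x / 2))\<^sup>2"
  using cos_prod_bounds[of x] by (simp add: abs_square_less_1)

text \<open>sin^2 (\<theta> / 2) as a sum of two squares, the periodic form of k^2 = 1 +
  p^2.\<close>

lemma sqrt_arg_eq: "1 - (cos (h / 2) * cos (x / 2))\<^sup>2
    = (sin (h / 2))\<^sup>2 + (cos (h / 2))\<^sup>2 * (sin (x / 2))\<^sup>2"
  by (simp add: power_mult_distrib cos_squared_eq[of "x / 2"] sin_squared_eq[of "h / 2"] algebra_simps)

lemma continuous_bs_angle': "continuous_on A (bs_angle' h)"
proof -
  have "sqrt (1 - (cos (h / 2) * cos (x / 2))\<^sup>2) \<noteq> 0" for x
    using sqrt_arg_pos[of x] by simp
  then show ?thesis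
    unfolding bs_angle'_def[abs_def] by (intro continuous_intros ballI) simp_all
qed

lemma continuous_bs_angle: "continuous_on A (bs_angle h)"
  by (rule DERIV_continuous_on[OF bs_angle_deriv])

text \<open>Substitution \<theta> = \<open>bs_angle h x\<close>, which carries [0, pi] to [h, pi].
  For k \<noteq> 0 the upper end contributes nothing because \<open>k\<close> is an integer.\<close>

lemma has_integral_cos_bs_angle:
  "((\<lambda>x. cos (of_int k * bs_angle h x) * bs_angle' h x) has_integral
     (if k = 0 then pi - h else - sin (of_int k * h) / of_int k)) {0..pi}"
proof (cases "k = 0")
  case True
  have "(bs_angle' h has_integral bs_angle h pi - bs_angle h 0) {0..pi}"
    using bs_angle_deriv
    by (intro fundamental_theorem_of_calculus) (auto simp: has_real_derivative_iff_has_vector_derivative)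
  then show ?thesis using True by (simp add: bs_angle_at_ends)
next
  case False
  have "((\<lambda>x. cos (of_int k * bs_angle h x) * bs_angle' h x) has_integral
     (sin (of_int k * bs_angle h pi) / of_int k - sin (of_int k * bs_angle h 0) / of_int k)) {0..pi}"
  proof (rule fundamental_theorem_of_calculus)
    fix x
    have "((\<lambda>x. sin (of_int k * bs_angle h x) / of_int k) has_real_derivative
       cos (of_int k * bs_angle h x) * bs_angle' h x) (at x within {0..pi})"
      using False by (auto intro!: derivative_eq_intros bs_angle_deriv)
    then show "((\<lambda>x. sin (of_int k * bs_angle h x) / of_int k) has_vector_derivative
       cos (of_int k * bs_angle h x) * bs_angle' h x) (at x within {0..pi})"
      by (simp add: has_real_derivative_iff_has_vector_derivative)
  qed simp
  moreover have "sin (of_int k * pi) = (0::real)" by (simp add: sin_times_pi_eq_0)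
  ultimately show ?thesis using False by (simp add: bs_angle_at_ends)
qed

lemma continuous_bs_integrand: "continuous_on A (bs_integrand r h k)"
  unfolding bs_integrand_def[abs_def]
  by (intro continuous_intros continuous_bs_angle continuous_bs_angle' continuous_bs_weight bs_beta_bounds)

text \<open>Integrating cos (k \<theta>) over the whole half-circle gives the identity. The arc
  \<theta> < h accounts for the sinc term, and on the rest only the defect of the weight against
  d\<theta> remains.\<close>

lemma bs_entry_eq_integral:
  "pi * bs_entry r h k = sinc (of_int k * h) + integral {0..pi} (bs_integrand r h k) / h"
proof -
  let ?w = "bs_weight (bs_beta r h)"
  have int: "(\<lambda>x. cos (of_int k * bs_angle h x) * ?w x) integrable_on {0..pi}"
    by (intro integrable_continuous_real continuous_intros continuous_bs_angle continuous_bs_weight bs_beta_bounds)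
  have "((\<lambda>x. cos (of_int k * bs_angle h x) * bs_angle' h x - cos (of_int k * bs_angle h x) * ?w x) has_integral
     (if k = 0 then pi - h else - sin (of_int k * h) / of_int k)
     - integral {0..pi} (\<lambda>x. cos (of_int k * bs_angle h x) * ?w x)) {0..pi}"
    by (intro has_integral_diff has_integral_cos_bs_angle integrable_integral int)
  then have "integral {0..pi} (bs_integrand r h k) = (if k = 0 then pi - h else - sin (of_int k * h) / of_int k)
     - integral {0..pi} (\<lambda>x. cos (of_int k * bs_angle h x) * ?w x)"
    unfolding bs_integrand_def[abs_def] right_diff_distrib by (rule integral_unique)
  moreover have "h * sinc (of_int k * h) = (if k = 0 then h else sin (of_int k * h) / of_int k)"
    using h by simp
  moreover have "h * (pi * bs_entry r h k) = (if k = 0 then pi else 0)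
     - integral {0..pi} (\<lambda>x. cos (of_int k * bs_angle h x) * ?w x)"
    using h by (simp add: bs_entry_def bs_mean_def field_simps)
  ultimately have "h * (pi * bs_entry r h k) = h * (sinc (of_int k * h) + integral {0..pi} (bs_integrand r h k) / h)"
    using h by (auto simp: distrib_left)
  then show ?thesis using h by simp
qed

text \<open>Counterpart of r^2 / (p^2 + r^2), with r sin (h / 2) for r and sin (x / 2) for p.
  Scaling by (1 + g)^2 clears the fraction in \<beta>.\<close>

lemma bs_weight_defect:
  "1 - bs_weight (bs_beta r h) x = (r * sin (h / 2))\<^sup>2 /
     ((r * sin (h / 2))\<^sup>2 + (sin (x / 2))\<^sup>2 * (1 - (r * sin (h / 2))\<^sup>2))"
proof -
  define g where "g = r * sin (h / 2)"
  define s where "s = (sin (x / 2))\<^sup>2"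
  have g: "0 \<le> g" "g \<le> 1 / 2" using r_sin_half by (auto simp: g_def)
  have b: "bs_beta r h = (1 - g) / (1 + g)" by (simp add: bs_beta_def g_def)
  have c: "cos x = 1 - 2 * s" using cos_double_sin[of "x / 2"] by (simp add: s_def)
  have 1: "(1 + g) * (1 - bs_beta r h) = 2 * g" using g by (simp add: b field_simps)
  have "(1 + g)\<^sup>2 * (1 - bs_beta r h)\<^sup>2 = 4 * g\<^sup>2"
    unfolding power_mult_distrib[symmetric] 1 by (simp add: power2_eq_square)
  moreover have "(1 + g)\<^sup>2 * poisson_den (bs_beta r h) x = 4 * (g\<^sup>2 + s * (1 - g\<^sup>2))"
  proof -
    have "(1 + g) * bs_beta r h = 1 - g" using g by (simp add: b)
    then have "(1 + g)\<^sup>2 * (2 * bs_beta r h * (1 - cos x)) = 4 * s * ((1 + g) * (1 - g))"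
      by (simp add: power2_eq_square c mult_ac)
    moreover have "(1 + g)\<^sup>2 * poisson_den (bs_beta r h) x
       = (1 + g)\<^sup>2 * (1 - bs_beta r h)\<^sup>2 + (1 + g)\<^sup>2 * (2 * bs_beta r h * (1 - cos x))"
      unfolding poisson_den_alt by (simp add: distrib_left)
    ultimately show ?thesis
      using \<open>(1 + g)\<^sup>2 * (1 - bs_beta r h)\<^sup>2 = 4 * g\<^sup>2\<close> by (simp add: algebra_simps power2_eq_square)
  qed
  moreover have "1 - bs_weight (bs_beta r h) x
     = ((1 + g)\<^sup>2 * (1 - bs_beta r h)\<^sup>2) / ((1 + g)\<^sup>2 * poisson_den (bs_beta r h) x)"
    using g by (simp add: bs_weight_def)
  ultimately have "1 - bs_weight (bs_beta r h) x = 4 * g\<^sup>2 / (4 * (g\<^sup>2 + s * (1 - g\<^sup>2)))"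
    by (simp only:)
  also have "\<dots> = g\<^sup>2 / (g\<^sup>2 + s * (1 - g\<^sup>2))"
    by (rule mult_divide_mult_cancel_left) simp
  finally show ?thesis by (simp add: g_def s_def)
qed

text \<open>The majorant must be independent of \<open>h\<close> and \<open>k\<close>. Up to a
  square root, both 1 - \<theta>' and 1 - weight have the form u / (u + v), with u of order at most
  h^2 and v of order at least x^2 = h^2 a^2.\<close>

lemma bs_integrand_bound:
  assumes a: "0 \<le> a" "h * a \<le> pi"
  shows "\<bar>bs_integrand r h k (h * a)\<bar> \<le> (9 + 8 * r\<^sup>2) / (1 + a\<^sup>2)"
proof -
  define x where "x = h * a"
  define t where "t = (sin (h / 2))\<^sup>2"
  define c where "c = (cos (h / 2))\<^sup>2"
  define s where "s = (sin (x / 2))\<^sup>2"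
  define g where "g = (r * sin (h / 2))\<^sup>2"
  have pos: "0 < 1 + a\<^sup>2" using zero_le_power2[of a] by linarith
  have x: "0 \<le> x" "x \<le> pi" using a h by (auto simp: x_def)
  have t: "0 < t" "t \<le> h\<^sup>2 / 4"
    using sin_half_bounds power_mono[of "sin (h / 2)" "h / 2" 2] by (auto simp: t_def power_divide)
  have c: "3 / 4 \<le> c" using cos_half_bounds by (simp add: c_def)
  have s: "0 \<le> s" by (simp add: s_def)
  have s_ge: "x\<^sup>2 / 16 \<le> s"
    using power_mono[OF sin_ge_half[of "x / 2"], of 2] x by (simp add: s_def power_divide)
  have g: "0 \<le> g" "g \<le> r\<^sup>2 * h\<^sup>2 / 4" "g \<le> 1 / 4"
    using power_mono[of "r * sin (h / 2)" "r * h / 2" 2] power_mono[of "r * sin (h / 2)" "1 / 2" 2] r_sin_half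
    by (auto simp: g_def power_divide power_mult_distrib)
  have bound: "u / (u + v) \<le> C / (1 + a\<^sup>2)" if "0 \<le> u" "0 \<le> v" "1 \<le> C" "u * a\<^sup>2 \<le> C * v" for u v C
  proof (cases "u + v = 0")
    case True
    then show ?thesis using that pos by simp
  next
    case False
    then have uv: "0 < u + v" using that by simp
    have "u * (1 + a\<^sup>2) = u * 1 + u * a\<^sup>2" by (simp add: distrib_left)
    also have "\<dots> \<le> u * C + C * v"
      using that by (intro add_mono mult_left_mono) auto
    finally have "u \<le> C * (u + v) / (1 + a\<^sup>2)" using pos by (simp add: pos_le_divide_eq algebra_simps)
    then show ?thesis using uv by (simp add: pos_divide_le_eq)
  qed
  have ang: "0 \<le> 1 - bs_angle' h x \<and> 1 - bs_angle' h x \<le> 8 / (1 + a\<^sup>2)"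
  proof -
    define q where "q = c * s / (t + c * s)"
    have cs: "0 \<le> c * s" using c s by simp
    have q: "0 \<le> q" "q \<le> 1" using cs t by (auto simp: q_def divide_simps)
    have sx: "0 \<le> sin (x / 2)" using x by (intro sin_ge_zero) auto
    have "bs_angle' h x = sqrt q"
      unfolding bs_angle'_def sqrt_arg_eq q_def real_sqrt_divide real_sqrt_mult
      using sx cos_half_bounds by (simp add: t_def c_def s_def)
    moreover have "sqrt q \<le> 1" using q by simp
    \<comment> \<open>Hence 1 - sqrt q \<le> 1 - q, which removes the root.\<close>
    moreover have "q \<le> sqrt q" using q by (intro real_le_rsqrt) (auto simp: power2_eq_square mult_left_le)
    moreover have "1 - q = t / (t + c * s)" using cs t by (simp add: q_def field_simps)
    \<comment> \<open>t \<le> h^2 / 4 against c s \<ge> (3/4) (x^2 / 16) gives the ratio 16/3,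
      rounded up to 8.\<close>
    moreover have "t / (t + c * s) \<le> 8 / (1 + a\<^sup>2)"
    proof (rule bound)
      have "t * a\<^sup>2 \<le> h\<^sup>2 / 4 * a\<^sup>2" using t by (intro mult_right_mono) auto
      also have "\<dots> = x\<^sup>2 / 4" by (simp add: x_def power_mult_distrib)
      also have "\<dots> \<le> 8 * (3 / 4 * (x\<^sup>2 / 16))" by simp
      also have "\<dots> \<le> 8 * (c * s)" using c s_ge by (intro mult_left_mono mult_mono) auto
      finally show "t * a\<^sup>2 \<le> 8 * (c * s)" .
    qed (use t cs in auto)
    ultimately show ?thesis by linarith
  qed
  have wt: "0 \<le> 1 - bs_weight (bs_beta r h) x \<and> 1 - bs_weight (bs_beta r h) x \<le> (1 + 8 * r\<^sup>2) / (1 + a\<^sup>2)"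
  proof -
    have eq: "1 - bs_weight (bs_beta r h) x = g / (g + s * (1 - g))"
      unfolding bs_weight_defect by (simp add: g_def s_def)
    \<comment> \<open>The same ratio times r^2; the summand 1 covers small r, since
      \<open>bound\<close> asks for C \<ge> 1.\<close>
    have "g / (g + s * (1 - g)) \<le> (1 + 8 * r\<^sup>2) / (1 + a\<^sup>2)"
    proof (rule bound)
      have "g * a\<^sup>2 \<le> r\<^sup>2 * h\<^sup>2 / 4 * a\<^sup>2" using g by (intro mult_right_mono) auto
      also have "\<dots> = r\<^sup>2 * x\<^sup>2 / 4" by (simp add: x_def power_mult_distrib)
      also have "\<dots> \<le> 8 * r\<^sup>2 * (x\<^sup>2 / 16 * (3 / 4))" by simp
      also have "\<dots> \<le> (1 + 8 * r\<^sup>2) * (s * (1 - g))"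
        using s_ge g s by (intro mult_mono) auto
      finally show "g * a\<^sup>2 \<le> (1 + 8 * r\<^sup>2) * (s * (1 - g))" .
    qed (use g s in auto)
    moreover have "0 \<le> g / (g + s * (1 - g))" using g s by auto
    ultimately show ?thesis unfolding eq by simp
  qed
  have "\<bar>bs_integrand r h k x\<bar> \<le> \<bar>bs_angle' h x - bs_weight (bs_beta r h) x\<bar>"
    unfolding bs_integrand_def abs_mult by (intro mult_left_le_one_le) auto
  also have "\<dots> \<le> 8 / (1 + a\<^sup>2) + (1 + 8 * r\<^sup>2) / (1 + a\<^sup>2)" using ang wt by linarith
  also have "\<dots> = (9 + 8 * r\<^sup>2) / (1 + a\<^sup>2)" by (simp add: add_divide_distrib[symmetric])
  finally show ?thesis by (simp add: x_def)
qed

text \<open>The range [0, pi] becomes [0, arsinh (pi / h)], which exhausts the half-line as h tends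
  to 0.\<close>

lemma integral_bs_integrand_substitution:
  "integral {0..pi} (bs_integrand r h k) / h
    = (LINT u|lborel. bs_integrand r h k (h * sinh u) * cosh u * indicator {0..arsinh (pi / h)} u)"
proof -
  have int: "set_integrable lborel {0..pi} (bs_integrand r h k)"
    by (intro borel_integrable_atLeastAtMost' continuous_bs_integrand)
  define b where "b = arsinh (pi / h)"
  have b: "0 \<le> b" "sinh b = pi / h"
  proof -
    have "0 \<le> pi / h" using h by simp
    then have "sinh 0 \<le> sinh b" by (simp add: b_def)
    then show "0 \<le> b" by (simp only: sinh_real_le_iff)
  qed (simp add: b_def)
  have "integral {0..pi} (bs_integrand r h k) = (LINT x|lborel. bs_integrand r h k x * indicator {h * sinh 0..h * sinh b} x)"
    using set_borel_integral_eq_integral(2)[OF int] h b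
    by (simp add: set_lebesgue_integral_def mult.commute)
  also have "\<dots> = (LINT u|lborel. bs_integrand r h k (h * sinh u) * (h * cosh u) * indicator {0..b} u)"
  proof (rule integral_substitution)
    show "set_integrable lborel {h * sinh 0..h * sinh b} (bs_integrand r h k)" using int b h by simp
    show "((\<lambda>a. h * sinh a) has_real_derivative h * cosh x) (at x)" for x
      by (auto intro!: derivative_eq_intros)
    show "continuous_on {0..b} (\<lambda>x. h * cosh x)" by (intro continuous_intros)
  qed (use h b in auto)
  also have "\<dots> = (LINT u|lborel. h * (bs_integrand r h k (h * sinh u) * cosh u * indicator {0..b} u))"
    by (simp add: mult_ac)
  also have "\<dots> = h * (LINT u|lborel. bs_integrand r h k (h * sinh u) * cosh u * indicator {0..b} u)"
    by simp
  finally show ?thesis using h by (simp add: b_def)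
qed

end

section \<open>Domination and limits of the matrix entries\<close>

lemma cosh_measurable [measurable]: "cosh \<in> borel_measurable (borel :: real measure)"
  by (intro borel_measurable_continuous_onI continuous_intros)

lemma cosh_integrable: "integrable lborel (\<lambda>u. indicator {0<..} u / cosh u :: real)"
proof (rule Bochner_Integration.integrable_bound)
  show "integrable lborel (\<lambda>u. indicator {0<..} u *\<^sub>R (2 * exp (- (u * 1))) :: real)"
    using set_integrable_mult_right[OF integrable_I0i_exp_mscale[of 1], of 2]
    by (simp add: set_integrable_def mult_ac)
  show "(\<lambda>u. indicator {0<..} u / cosh u :: real) \<in> borel_measurable lborel"
    by measurable
  have "1 / cosh u \<le> 2 * exp (- u)" for u :: real
  proof -
    have "exp u \<le> 2 * cosh u" by (simp add: cosh_def)
    then show ?thesis by (simp add: exp_minus divide_simps)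
  qed
  then show "AE u in lborel. norm (indicator {0<..} u / cosh u :: real) \<le> norm (indicator {0<..} u *\<^sub>R (2 * exp (- (u * 1))) :: real)"
    by (intro AE_I2) (auto simp: indicator_def)
qed

lemma K_BS_sinc:
  "K_BS r z = (sinc z - (LBINT t:{0<..}. cos (z * cosh t) * (sinh t * cosh t / ((sinh t)\<^sup>2 + r\<^sup>2) - 1) * sinh t)) / pi"
proof -
  have "((\<lambda>z. sin z / z / pi) \<longlongrightarrow> 1 / pi) (at (0::real))"
    by (intro tendsto_divide sinc_at_0 tendsto_const) simp
  then have "((\<lambda>z. sin z / (pi * z)) \<longlongrightarrow> 1 / pi) (at (0::real))"
    by (simp add: mult.commute)
  then have "Lim (at 0) (\<lambda>z. sin z / (pi * z)) = 1 / pi"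
    by (intro tendsto_Lim) auto
  then have "cont_at_0 (\<lambda>z. sin z / (pi * z)) z = sinc z / pi"
    by (simp add: cont_at_0_def)
  then show ?thesis by (simp add: K_BS_def diff_divide_distrib)
qed

definition bs_limit :: "real \<Rightarrow> real \<Rightarrow> real \<Rightarrow> real" where
  "bs_limit r z t = cos (z * cosh t) * (sinh t * cosh t / ((sinh t)\<^sup>2 + r\<^sup>2) - 1) * sinh t"

text \<open>The substitution \<open>x = h * sinh u\<close> makes the integrands comparable with that of \<^const>\<open>K_BS\<close>.\<close>

definition bs_scaled :: "real \<Rightarrow> real \<Rightarrow> int \<Rightarrow> real \<Rightarrow> real" where
  "bs_scaled r h k u = bs_integrand r h k (h * sinh u) * cosh u * indicator {0..arsinh (pi / h)} u"

lemma bs_scaled_measurable: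
  assumes "0 \<le> r" "0 < h" "h \<le> 1" "r * h \<le> 1"
  shows "bs_scaled r h k \<in> borel_measurable lborel"
proof -
  have "continuous_on UNIV (\<lambda>u. bs_integrand r h k (h * sinh u) * cosh u)"
    by (intro continuous_intros continuous_on_compose2[OF continuous_bs_integrand[OF assms, of UNIV]]) auto
  then have [measurable]: "(\<lambda>u. bs_integrand r h k (h * sinh u) * cosh u) \<in> borel_measurable borel"
    by (rule borel_measurable_continuous_onI)
  show ?thesis
    unfolding bs_scaled_def[abs_def] by measurable
qed

text \<open>The factor cosh u of the substitution turns the decay 1 / cosh^2 u into the still
  integrable 1 / cosh u. The point u = 0 belongs to the range on the left but not to the one on the
  right.\<close>

lemma bs_scaled_bound:
  assumes "0 \<le> r" "0 < h" "h \<le> 1" "r * h \<le> 1" "u \<noteq> 0"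
  shows "\<bar>bs_scaled r h k u\<bar> \<le> (9 + 8 * r\<^sup>2) * (indicator {0<..} u / cosh u)"
proof (cases "u \<in> {0..arsinh (pi / h)}")
  case True
  then have u: "0 < u" using assms(5) by auto
  have "sinh u \<le> sinh (arsinh (pi / h))" unfolding sinh_real_le_iff using True by simp
  then have "sinh u \<le> pi / h" by (simp only: sinh_arsinh_real)
  then have "h * sinh u \<le> pi" using assms by (simp add: field_simps)
  then have "\<bar>bs_integrand r h k (h * sinh u)\<bar> \<le> (9 + 8 * r\<^sup>2) / (cosh u)\<^sup>2"
    using bs_integrand_bound[OF assms(1-4), of "sinh u" k] u by (simp add: cosh_square_eq add.commute)
  then have "\<bar>bs_integrand r h k (h * sinh u)\<bar> * cosh u \<le> (9 + 8 * r\<^sup>2) / (cosh u)\<^sup>2 * cosh u"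
    by (intro mult_right_mono) auto
  also have "\<dots> = (9 + 8 * r\<^sup>2) / cosh u" by (simp add: power2_eq_square)
  finally show ?thesis using True u by (simp add: bs_scaled_def abs_mult)
next
  case False
  then show ?thesis by (auto simp: bs_scaled_def indicator_def)
qed

lemma bs_entry_eq_LBINT:
  assumes "0 \<le> r" "0 < h" "h \<le> 1" "r * h \<le> 1"
  shows "bs_entry r h k = (sinc (of_int k * h) + (LINT u|lborel. bs_scaled r h k u)) / pi"
  using bs_entry_eq_integral[OF assms, of k] integral_bs_integrand_substitution[OF assms, of k]
  by (simp add: bs_scaled_def field_simps)

lemma AE_lborel_neq_0: "AE u in lborel. u \<noteq> (0::real)"
  using AE_lborel_singleton[of 0] by simp

lemma bs_entry_bound:
  assumes "0 \<le> r" "0 < h" "h \<le> 1" "r * h \<le> 1"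
  shows "\<bar>bs_entry r h k\<bar> \<le> (1 + (LINT u|lborel. (9 + 8 * r\<^sup>2) * (indicator {0<..} u / cosh u))) / pi"
proof -
  have w: "integrable lborel (\<lambda>u. (9 + 8 * r\<^sup>2) * (indicator {0<..} u / cosh u) :: real)"
    using cosh_integrable by (intro integrable_mult_right)
  have bound: "AE u in lborel. norm (bs_scaled r h k u) \<le> (9 + 8 * r\<^sup>2) * (indicator {0<..} u / cosh u)"
    using AE_lborel_neq_0 by eventually_elim (use bs_scaled_bound[OF assms] in auto)
  have "\<bar>LINT u|lborel. bs_scaled r h k u\<bar> \<le> (LINT u|lborel. (9 + 8 * r\<^sup>2) * (indicator {0<..} u / cosh u))"
  proof -
    have int: "integrable lborel (bs_scaled r h k)"
      by (rule Bochner_Integration.integrable_bound[OF w bs_scaled_measurable[OF assms]])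
         (use bound in \<open>eventually_elim, auto\<close>)
    have "\<bar>LINT u|lborel. bs_scaled r h k u\<bar> \<le> (LINT u|lborel. \<bar>bs_scaled r h k u\<bar>)"
      by (rule integral_abs_bound)
    also have "\<dots> \<le> (LINT u|lborel. (9 + 8 * r\<^sup>2) * (indicator {0<..} u / cosh u))"
      using bound by (intro integral_mono_AE w integrable_abs int) simp
    finally show ?thesis .
  qed
  moreover have "\<bar>sinc x\<bar> \<le> 1" for x :: real
    using abs_sin_x_le_abs_x[of x] by (simp add: divide_simps)
  ultimately have "\<bar>sinc (of_int k * h) + (LINT u|lborel. bs_scaled r h k u)\<bar>
     \<le> 1 + (LINT u|lborel. (9 + 8 * r\<^sup>2) * (indicator {0<..} u / cosh u))"
    by (meson abs_triangle_ineq add_mono order.trans)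
  then show ?thesis
    unfolding bs_entry_eq_LBINT[OF assms] abs_divide by (simp add: divide_right_mono)
qed


text \<open>The root is sin (\<theta> / 2) at x = h a; the limit 1 + a^2 is where k^2 = 1 + p^2
  reappears.\<close>

lemma half_angle_limit:
  assumes a: "0 < a"
  shows "((\<lambda>h. sqrt (1 - (cos (h / 2) * cos (h * a / 2))\<^sup>2) / h) \<longlongrightarrow> sqrt (1 + a\<^sup>2) / 2) (at_right 0)"
proof -
  have "((\<lambda>h. (1 - (cos (h / 2) * cos (h * a / 2))\<^sup>2) / h\<^sup>2) \<longlongrightarrow> (1 + a\<^sup>2) / 4) (at_right 0)"
    using a by (real_asymp simp: field_simps power2_eq_square)
  then have "((\<lambda>h. sqrt ((1 - (cos (h / 2) * cos (h * a / 2))\<^sup>2) / h\<^sup>2)) \<longlongrightarrow> sqrt ((1 + a\<^sup>2) / 4)) (at_right 0)"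
    by (rule tendsto_real_sqrt)
  moreover have "\<forall>\<^sub>F h in at_right 0. sqrt ((1 - (cos (h / 2) * cos (h * a / 2))\<^sup>2) / h\<^sup>2)
      = sqrt (1 - (cos (h / 2) * cos (h * a / 2))\<^sup>2) / h"
    using eventually_at_right_less[of "0::real"] by eventually_elim (simp add: real_sqrt_divide)
  ultimately have "((\<lambda>h. sqrt (1 - (cos (h / 2) * cos (h * a / 2))\<^sup>2) / h) \<longlongrightarrow> sqrt ((1 + a\<^sup>2) / 4)) (at_right 0)"
    by (rule Lim_transform_eventually)
  then show ?thesis by (simp add: real_sqrt_divide)
qed

text \<open>arccos has a vertical tangent at 1, the limit of its argument. The angle is therefore
  compared with its sine, whose limit is known, by way of sin y / y.\<close>

lemma bs_angle_limit:
  assumes a: "0 < a"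
  shows "((\<lambda>h. bs_angle h (h * a) / h) \<longlongrightarrow> sqrt (1 + a\<^sup>2)) (at_right 0)"
proof -
  define u where "u h = cos (h / 2) * cos (h * a / 2)" for h
  define y where "y h = arccos (u h)" for h
  have ev: "\<forall>\<^sub>F h in at_right 0. 0 < u h \<and> u h < 1 \<and> 0 < h"
  proof (intro eventually_conj eventually_at_right_less)
    show "\<forall>\<^sub>F h in at_right 0. 0 < u h" unfolding u_def using a by real_asymp
    have "\<forall>\<^sub>F h in at_right 0. h \<in> {0<..<1::real}" by (rule eventually_at_right_real) simp
    then show "\<forall>\<^sub>F h in at_right 0. u h < 1"
    proof eventually_elim
      case (elim h)
      then show ?case using cos_prod_bounds[of 0 h "h * a"] by (simp add: u_def)
    qed
  qed
  have y: "(y \<longlongrightarrow> 0) (at_right 0)"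
  proof -
    have "(u \<longlongrightarrow> 1) (at_right 0)" unfolding u_def by (auto intro!: tendsto_eq_intros)
    then have "((\<lambda>h. arccos (u h)) \<longlongrightarrow> arccos 1) (at_right 0)"
    proof (rule continuous_on_tendsto_compose[OF continuous_on_arccos'])
      show "\<forall>\<^sub>F h in at_right 0. u h \<in> {-1..1}" using ev by eventually_elim auto
    qed simp
    then show ?thesis by (simp add: y_def[abs_def])
  qed
  have y_pos: "\<forall>\<^sub>F h in at_right 0. y h \<noteq> 0"
    using ev
  proof eventually_elim
    case (elim h)
    have "cos (y h) = u h" using elim by (simp add: y_def)
    with elim show ?case by auto
  qed
  have sinc: "((\<lambda>h. sin (y h) / y h) \<longlongrightarrow> 1) (at_right 0)"
    by (rule filterlim_compose[OF sinc_at_0]) (use y y_pos in \<open>simp add: filterlim_at\<close>)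
  have sq: "((\<lambda>h. sqrt (1 - (u h)\<^sup>2) / h) \<longlongrightarrow> sqrt (1 + a\<^sup>2) / 2) (at_right 0)"
    unfolding u_def by (rule half_angle_limit[OF a])
  have "((\<lambda>h. 2 * (sqrt (1 - (u h)\<^sup>2) / h) / (sin (y h) / y h)) \<longlongrightarrow> 2 * (sqrt (1 + a\<^sup>2) / 2) / 1) (at_right 0)"
    by (intro tendsto_intros sq sinc) simp
  moreover have "\<forall>\<^sub>F h in at_right 0. 2 * (sqrt (1 - (u h)\<^sup>2) / h) / (sin (y h) / y h) = bs_angle h (h * a) / h"
    using ev y_pos
  proof eventually_elim
    case (elim h)
    have s: "sin (y h) = sqrt (1 - (u h)\<^sup>2)" using elim by (simp add: y_def sin_arccos)
    have "0 < 1 - (u h)\<^sup>2" using elim by (simp add: abs_square_less_1)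
    then have "sin (y h) \<noteq> 0" unfolding s by simp
    then show ?case unfolding s[symmetric] using elim by (simp add: bs_angle_def y_def u_def)
  qed
  ultimately have "((\<lambda>h. bs_angle h (h * a) / h) \<longlongrightarrow> 2 * (sqrt (1 + a\<^sup>2) / 2) / 1) (at_right 0)"
    by (rule Lim_transform_eventually)
  then show ?thesis by simp
qed

lemma bs_angle'_limit:
  assumes a: "0 < a"
  shows "((\<lambda>h. bs_angle' h (h * a)) \<longlongrightarrow> a / sqrt (1 + a\<^sup>2)) (at_right 0)"
proof -
  have "((\<lambda>h. cos (h / 2) * sin (h * a / 2) / h) \<longlongrightarrow> a / 2) (at_right 0)"
    using a by (real_asymp simp: field_simps)
  then have "((\<lambda>h. (cos (h / 2) * sin (h * a / 2) / h) / (sqrt (1 - (cos (h / 2) * cos (h * a / 2))\<^sup>2) / h))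
      \<longlongrightarrow> (a / 2) / (sqrt (1 + a\<^sup>2) / 2)) (at_right 0)"
    by (rule tendsto_divide[OF _ half_angle_limit[OF a]]) (simp add: add_nonneg_eq_0_iff)
  moreover have "\<forall>\<^sub>F h in at_right 0. (cos (h / 2) * sin (h * a / 2) / h) /
     (sqrt (1 - (cos (h / 2) * cos (h * a / 2))\<^sup>2) / h) = bs_angle' h (h * a)"
    using eventually_at_right_less[of "0::real"] by eventually_elim (simp add: bs_angle'_def)
  ultimately have "((\<lambda>h. bs_angle' h (h * a)) \<longlongrightarrow> (a / 2) / (sqrt (1 + a\<^sup>2) / 2)) (at_right 0)"
    by (rule Lim_transform_eventually)
  then show ?thesis by simp
qed

lemma bs_weight_limit:
  assumes a: "0 < a" and r: "0 \<le> r"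
  shows "((\<lambda>h. bs_weight (bs_beta r h) (h * a)) \<longlongrightarrow> a\<^sup>2 / (a\<^sup>2 + r\<^sup>2)) (at_right 0)"
proof (cases "r = 0")
  case True
  then show ?thesis using a by (simp add: bs_weight_def bs_beta_def)
next
  case False
  with r have "0 < r" by simp
  then show ?thesis
    unfolding bs_weight_def poisson_den_def bs_beta_def
    using a by (real_asymp simp: field_simps power2_eq_square)
qed


lemma bs_scaled_limit:
  assumes r: "0 \<le> r" and u: "0 < u"
    and h: "filterlim h (at_right 0) sequentially"
    and k: "(\<lambda>m. of_int (k m) * h m) \<longlonglongrightarrow> z"
  shows "(\<lambda>m. bs_scaled r (h m) (k m) u) \<longlonglongrightarrow> - bs_limit r z u"
proof -
  define a where "a = sinh u"
  have a: "0 < a" using u by (simp add: a_def)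
  have ca: "sqrt (1 + a\<^sup>2) = cosh u"
    using u by (simp add: a_def sinh_square_eq)
  have h0: "\<forall>\<^sub>F m in sequentially. 0 < h m"
    using h eventually_at_right_less[of "0::real"] by (rule eventually_compose_filterlim[rotated])
  \<comment> \<open>k \<theta> = (k h) (\<theta> / h), and the two factors converge to z and cosh
    u.\<close>
  have "(\<lambda>m. (of_int (k m) * h m) * (bs_angle (h m) (h m * a) / h m)) \<longlonglongrightarrow> z * cosh u"
    unfolding ca[symmetric] by (intro tendsto_mult k filterlim_compose[OF bs_angle_limit[OF a] h])
  then have ang: "(\<lambda>m. of_int (k m) * bs_angle (h m) (h m * a)) \<longlonglongrightarrow> z * cosh u"
    by (rule Lim_transform_eventually) (use h0 in \<open>eventually_elim, simp\<close>)
  have "(\<lambda>m. cos (of_int (k m) * bs_angle (h m) (h m * a)) *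
       (bs_angle' (h m) (h m * a) - bs_weight (bs_beta r (h m)) (h m * a)) * cosh u)
     \<longlonglongrightarrow> cos (z * cosh u) * (a / cosh u - a\<^sup>2 / (a\<^sup>2 + r\<^sup>2)) * cosh u"
    unfolding ca[symmetric]
    by (intro tendsto_intros ang[unfolded ca[symmetric]] filterlim_compose[OF bs_angle'_limit[OF a] h]
        filterlim_compose[OF bs_weight_limit[OF a r] h])
  also have "cos (z * cosh u) * (a / cosh u - a\<^sup>2 / (a\<^sup>2 + r\<^sup>2)) * cosh u = - bs_limit r z u"
  proof -
    have "cosh u \<noteq> 0" by simp
    then show ?thesis
      by (simp add: bs_limit_def a_def[symmetric] algebra_simps power2_eq_square)
  qed
  finally have lim: "(\<lambda>m. bs_integrand r (h m) (k m) (h m * a) * cosh u) \<longlonglongrightarrow> - bs_limit r z u"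
    by (simp add: bs_integrand_def)
  have "(h \<longlongrightarrow> 0) sequentially"
    using h by (simp add: filterlim_at)
  then have "(\<lambda>m. h m * a) \<longlonglongrightarrow> 0 * a" by (intro tendsto_intros)
  \<comment> \<open>The cutoff at x = pi eventually lies beyond u.\<close>
  then have "\<forall>\<^sub>F m in sequentially. h m * a < pi"
    by (rule order_tendstoD) simp
  with h0 have "\<forall>\<^sub>F m in sequentially. bs_integrand r (h m) (k m) (h m * a) * cosh u = bs_scaled r (h m) (k m) u"
  proof eventually_elim
    case (elim m)
    then have "sinh u \<le> pi / h m" by (simp add: a_def field_simps)
    then have "sinh u \<le> sinh (arsinh (pi / h m))" by simp
    then have "u \<le> arsinh (pi / h m)" unfolding sinh_real_le_iff .
    then show ?case using u by (simp add: bs_scaled_def a_def)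
  qed
  with lim show ?thesis by (rule Lim_transform_eventually)
qed

theorem bs_entry_tendsto:
  assumes r: "0 \<le> r" and h: "\<And>m. 0 < h m" "\<And>m. h m \<le> 1" "\<And>m. r * h m \<le> 1" "h \<longlonglongrightarrow> 0"
    and k: "(\<lambda>m. of_int (k m) * h m) \<longlonglongrightarrow> z"
  shows "(\<lambda>m. bs_entry r (h m) (k m)) \<longlonglongrightarrow> K_BS r z"
proof -
  have h': "filterlim h (at_right 0) sequentially"
    using h(1,4) less_imp_neq[OF h(1)] by (auto simp: filterlim_at)
  define w where "w u = (9 + 8 * r\<^sup>2) * (indicator {0<..} u / cosh u)" for u :: real
  have bs_limit_meas: "(\<lambda>u. - (indicator {0<..} u * bs_limit r z u)) \<in> borel_measurable lborel"
    unfolding bs_limit_def sinh_def cosh_def by measurable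
  have lim: "(\<lambda>m. LINT u|lborel. bs_scaled r (h m) (k m) u) \<longlonglongrightarrow> (LINT u|lborel. - (indicator {0<..} u * bs_limit r z u))"
  proof (rule integral_dominated_convergence[where w = w])
    show "integrable lborel w"
      unfolding w_def using cosh_integrable by (intro integrable_mult_right)
    show "bs_scaled r (h m) (k m) \<in> borel_measurable lborel" for m
      by (rule bs_scaled_measurable[OF r h(1-3)])
    show "AE u in lborel. norm (bs_scaled r (h m) (k m) u) \<le> w u" for m
      using AE_lborel_neq_0 by eventually_elim (use bs_scaled_bound[OF r h(1-3)] in \<open>auto simp: w_def\<close>)
    show "AE u in lborel. (\<lambda>m. bs_scaled r (h m) (k m) u) \<longlonglongrightarrow> - (indicator {0<..} u * bs_limit r z u)"
      using AE_lborel_neq_0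
    proof eventually_elim
      case (elim u)
      show ?case
      proof (cases "0 < u")
        case True
        then show ?thesis using bs_scaled_limit[OF r True h' k] by simp
      next
        case False
        then show ?thesis using elim by (simp add: bs_scaled_def)
      qed
    qed
  qed (rule bs_limit_meas)
  have "(\<lambda>m. sinc (of_int (k m) * h m)) \<longlonglongrightarrow> sinc z"
    by (rule isCont_tendsto_compose[OF isCont_sinc k])
  then have "(\<lambda>m. (sinc (of_int (k m) * h m) + (LINT u|lborel. bs_scaled r (h m) (k m) u)) / pi)
     \<longlonglongrightarrow> (sinc z + (LINT u|lborel. - (indicator {0<..} u * bs_limit r z u))) / pi"
    by (intro tendsto_intros lim) simp_all
  also have "(sinc z + (LINT u|lborel. - (indicator {0<..} u * bs_limit r z u))) / pi = K_BS r z"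
    unfolding K_BS_sinc by (simp add: set_lebesgue_integral_def bs_limit_def)
  finally show ?thesis
    unfolding bs_entry_eq_LBINT[OF r h(1-3)] .
qed

section \<open>The Fredholm determinant\<close>

text \<open>cos (h / 2)^(2 M^2) behaves like (1 - s^2 / (8 M^2))^(2 M^2), and so does the other
  power; each contributes exp (- s^2 / 4). Further \<beta> = 1 - r h + O(h^2) and sin (h / 2) = h /
  2 + O(h^3), where M h = s.\<close>

lemma closed_form_tendsto:
  fixes r s :: real
  assumes r: "0 \<le> r" and s: "0 < s"
  shows "(\<lambda>M::nat. cos (s / M / 2) ^ (2 * (M * M)) * cos (s / M / 2) ^ (2 * (M * (M - 1)))
      * bs_beta r (s / M) ^ (2 * M)
      * ((1 + r) / 2 * (1 + sin (s / M / 2)) ^ (2 * M) + (1 - r) / 2 * (1 - sin (s / M / 2)) ^ (2 * M)))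
    \<longlonglongrightarrow> exp (- s\<^sup>2 / 2 - 2 * r * s) * (cosh s + r * sinh s)"
proof -
  have 1: "(\<lambda>M::nat. cos (s / M / 2) ^ (2 * (M * M))) \<longlonglongrightarrow> exp (- (s * s / 4))"
    using s by real_asymp
  have 2: "(\<lambda>M::nat. cos (s / M / 2) ^ (2 * (M * (M - 1)))) \<longlonglongrightarrow> exp (- (s * s / 4))"
    using s by real_asymp
  have 3: "(\<lambda>M::nat. bs_beta r (s / M) ^ (2 * M)) \<longlonglongrightarrow> exp (- 2 * r * s)"
  proof (cases "r = 0")
    case True
    then show ?thesis by (simp add: bs_beta_def)
  next
    case False
    with r have "0 < r" by simp
    then show ?thesis unfolding bs_beta_def using s by real_asymp
  qed
  have 4: "(\<lambda>M::nat. (1 + sin (s / M / 2)) ^ (2 * M)) \<longlonglongrightarrow> exp s"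
    using s by real_asymp
  have 5: "(\<lambda>M::nat. (1 - sin (s / M / 2)) ^ (2 * M)) \<longlonglongrightarrow> exp (- s)"
    using s by real_asymp
  have "exp (- (s * s / 4)) * exp (- (s * s / 4)) * exp (- 2 * r * s) * ((1 + r) / 2 * exp s + (1 - r) / 2 * exp (- s))
     = exp (- s\<^sup>2 / 2 - 2 * r * s) * (cosh s + r * sinh s)"
  proof -
    have "(1 + r) / 2 * exp s + (1 - r) / 2 * exp (- s) = cosh s + r * sinh s"
      by (simp add: cosh_def sinh_def field_simps)
    moreover have "exp (- (s * s / 4)) * exp (- (s * s / 4)) * exp (- 2 * r * s) = exp (- s\<^sup>2 / 2 - 2 * r * s)"
      unfolding exp_add[symmetric] by (simp add: power2_eq_square)
    ultimately show ?thesis by simp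
  qed
  with tendsto_mult[OF tendsto_mult[OF tendsto_mult[OF 1 2] 3]
      tendsto_add[OF tendsto_mult[OF tendsto_const[of "(1 + r) / 2"] 4] tendsto_mult[OF tendsto_const[of "(1 - r) / 2"] 5]]]
  show ?thesis by simp
qed

lemma grid_index_tendsto:
  assumes T: "0 < T" and N: "\<And>m. 0 < N m" "filterlim N at_top sequentially" and x: "0 < x"
  shows "(\<lambda>m. real (grid_index T (N m) x) * (T / N m)) \<longlonglongrightarrow> x"
proof (rule tendsto_sandwich)
  have "(\<lambda>m. T / real (N m)) \<longlonglongrightarrow> 0"
    by (rule tendsto_divide_0[OF tendsto_const])
       (intro filterlim_at_top_imp_at_infinity filterlim_compose[OF filterlim_real_sequentially N(2)])
  then show "(\<lambda>m. x - T / N m) \<longlonglongrightarrow> x"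
    using tendsto_diff[OF tendsto_const[of x]] by fastforce
  show "\<forall>\<^sub>F m in sequentially. x - T / N m \<le> real (grid_index T (N m) x) * (T / N m)"
  proof (intro always_eventually allI)
    fix m
    show "x - T / N m \<le> real (grid_index T (N m) x) * (T / N m)"
      using grid_index_bounds(2)[OF T N(1)[of m] x] unfolding distrib_right by simp
  qed
  show "\<forall>\<^sub>F m in sequentially. real (grid_index T (N m) x) * (T / N m) \<le> x"
    using grid_index_bounds(1)[OF T N(1) x] by (intro always_eventually allI)
qed simp

theorem fredholm_det_K_BS:
  assumes r: "0 \<le> r" and s: "0 < s"
  shows "fredholm_det {0<..<2 * s} (\<lambda>x y. K_BS r (x - y))
    = exp (- s\<^sup>2 / 2 - 2 * r * s) * (cosh s + r * sinh s)"
proof -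
  \<comment> \<open>The offset makes h \<le> 1 and r h \<le> 1 for every m, not just
    eventually.\<close>
  define M where "M m = m + nat \<lceil>s + r * s\<rceil> + 1" for m :: nat
  define h where "h m = s / M m" for m
  define A where "A m i j = bs_entry r (h m) (int i - int j)" for m i j
  have M: "0 < M m" for m by (simp add: M_def)
  have M_ge: "s + r * s \<le> M m" for m
    unfolding M_def using real_nat_ceiling_ge[of "s + r * s"] by linarith
  have rs: "0 \<le> r * s" using r s by simp
  have h: "0 < h m" "h m \<le> 1" "r * h m \<le> 1" for m
    using s M[of m] M_ge[of m] rs by (auto simp: h_def divide_simps)
  have M_top: "filterlim M at_top sequentially"
    unfolding M_def by (rule filterlim_subseq) (simp add: strict_mono_def)
  \<comment> \<open>2M points on an interval of length 2s have spacing s / M.\<close>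
  have h_eq: "2 * s / real (M m + M m) = h m" for m
    using M[of m] by (simp add: h_def field_simps)
  have h_lim: "h \<longlonglongrightarrow> 0"
    unfolding h_def
    by (rule tendsto_divide_0[OF tendsto_const])
       (intro filterlim_at_top_imp_at_infinity filterlim_compose[OF filterlim_real_sequentially M_top])
  have lim: "(\<lambda>m. det_of (M m + M m) (\<lambda>i j. (if i = j then 1 else 0) - 2 * s / real (M m + M m) * A m i j))
     \<longlonglongrightarrow> fredholm_det {0<..<2 * s} (\<lambda>x y. K_BS r (x - y))"
  proof (rule det_tendsto_fredholm_det)
    show "\<bar>A m i j\<bar> \<le> (1 + (LINT u|lborel. (9 + 8 * r\<^sup>2) * (indicator {0<..} u / cosh u))) / pi" for m i j
      unfolding A_def by (rule bs_entry_bound[OF r h])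
    fix x y :: real
    assume xy: "x \<in> {0<..<2 * s}" "y \<in> {0<..<2 * s}"
    have N: "0 < M m + M m" "filterlim (\<lambda>m. M m + M m) at_top sequentially" for m
      using M[of m] by (auto intro: filterlim_at_top_mono[OF M_top])
    have g: "(\<lambda>m. real (grid_index (2 * s) (M m + M m) x) * h m) \<longlonglongrightarrow> x" if "0 < x" for x
      using grid_index_tendsto[of "2 * s" "\<lambda>m. M m + M m", OF _ N that] s unfolding h_eq by simp
    have "(\<lambda>m. real (grid_index (2 * s) (M m + M m) x) * h m - real (grid_index (2 * s) (M m + M m) y) * h m) \<longlonglongrightarrow> x - y"
      using xy by (intro tendsto_diff g) auto
    then have "(\<lambda>m. of_int (int (grid_index (2 * s) (M m + M m) x) - int (grid_index (2 * s) (M m + M m) y)) * h m) \<longlonglongrightarrow> x - y"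
      by (simp add: left_diff_distrib)
    then show "(\<lambda>m. A m (grid_index (2 * s) (M m + M m) x) (grid_index (2 * s) (M m + M m) y)) \<longlonglongrightarrow> K_BS r (x - y)"
      unfolding A_def by (rule bs_entry_tendsto[OF r h h_lim])
  qed (use s M in auto)
  have eq: "det_of (M m + M m) (\<lambda>i j. (if i = j then 1 else 0) - 2 * s / real (M m + M m) * A m i j)
     = cos (s / M m / 2) ^ (2 * (M m * M m)) * cos (s / M m / 2) ^ (2 * (M m * (M m - 1)))
      * bs_beta r (s / M m) ^ (2 * M m)
      * ((1 + r) / 2 * (1 + sin (s / M m / 2)) ^ (2 * M m) + (1 - r) / 2 * (1 - sin (s / M m / 2)) ^ (2 * M m))" for m
  proof -
    have "(if i = j then 1 else 0) - 2 * s / real (M m + M m) * A m i j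
       = bs_mean (bs_beta r (h m)) (\<lambda>x. cos ((real i - real j) * bs_angle (h m) x))" for i j
      unfolding h_eq A_def bs_entry_def using h(1)[of m] by simp
    then show ?thesis
      using toeplitz_det[OF bs_beta_bounds[OF r h, of m] sin_cos_squared_add2 sin_half_bounds(1,3)[OF r h, of m] r
          bs_beta_eq[OF r h, of m] cos_bs_angle[OF r h, of m]]
      by (simp add: h_def)
  qed
  have "(\<lambda>m. cos (s / M m / 2) ^ (2 * (M m * M m)) * cos (s / M m / 2) ^ (2 * (M m * (M m - 1)))
      * bs_beta r (s / M m) ^ (2 * M m)
      * ((1 + r) / 2 * (1 + sin (s / M m / 2)) ^ (2 * M m) + (1 - r) / 2 * (1 - sin (s / M m / 2)) ^ (2 * M m)))
     \<longlonglongrightarrow> exp (- s\<^sup>2 / 2 - 2 * r * s) * (cosh s + r * sinh s)"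
    by (rule filterlim_compose[OF closed_form_tendsto[OF r s] M_top])
  then show ?thesis
    by (rule LIMSEQ_unique[OF lim[unfolded eq]])
qed

section \<open>The kernel as a sine integral\<close>

lemma LBINT_FTC_to_infinity:
  fixes F f :: "real \<Rightarrow> real"
  assumes F: "\<And>x. a < x \<Longrightarrow> (F has_real_derivative f x) (at x)" and f: "\<And>x. a < x \<Longrightarrow> isCont f x"
    and A: "(F \<longlongrightarrow> A) (at_right a)" and B: "(F \<longlongrightarrow> B) at_top"
    and int: "set_integrable lborel {a<..} f"
  shows "(LBINT x:{a<..}. f x) = B - A"
proof -
  have "(LBINT x=ereal a..\<infinity>. f x) = B - A"
  proof (rule interval_integral_FTC_integrable)
    show "(F has_vector_derivative f x) (at x)" if "ereal a < ereal x" for x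
      using F that by (simp add: has_real_derivative_iff_has_vector_derivative[symmetric])
    show "isCont f x" if "ereal a < ereal x" for x using f that by simp
    show "set_integrable lborel (einterval (ereal a) \<infinity>) f" using int by simp
    show "((F \<circ> real_of_ereal) \<longlongrightarrow> A) (at_right (ereal a))" using A by (simp add: ereal_tendsto_simps)
    show "((F \<circ> real_of_ereal) \<longlongrightarrow> B) (at_left \<infinity>)" using B by (simp add: ereal_tendsto_simps)
  qed simp
  then show ?thesis by (simp add: interval_integral_to_infinity_eq)
qed

lemma LBINT_FTC_nonneg_to_infinity:
  fixes F f :: "real \<Rightarrow> real"
  assumes F: "\<And>x. a < x \<Longrightarrow> (F has_real_derivative f x) (at x)" and f: "\<And>x. a < x \<Longrightarrow> isCont f x"
    and A: "(F \<longlongrightarrow> A) (at_right a)" and B: "(F \<longlongrightarrow> B) at_top"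
    and nonneg: "\<And>x. a < x \<Longrightarrow> 0 \<le> f x"
  shows "set_integrable lborel {a<..} f" "(LBINT x:{a<..}. f x) = B - A"
proof -
  have "set_integrable lborel (einterval (ereal a) \<infinity>) f"
  proof (rule interval_integral_FTC_nonneg(1))
    show "DERIV F x :> f x" if "ereal a < ereal x" for x using F that by simp
    show "isCont f x" if "ereal a < ereal x" for x using f that by simp
    show "AE x in lborel. ereal a < ereal x \<longrightarrow> ereal x < \<infinity> \<longrightarrow> 0 \<le> f x" using nonneg by simp
    show "((F \<circ> real_of_ereal) \<longlongrightarrow> A) (at_right (ereal a))" using A by (simp add: ereal_tendsto_simps)
    show "((F \<circ> real_of_ereal) \<longlongrightarrow> B) (at_left \<infinity>)" using B by (simp add: ereal_tendsto_simps)
  qed simp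
  then show *: "set_integrable lborel {a<..} f" by simp
  show "(LBINT x:{a<..}. f x) = B - A"
    by (rule LBINT_FTC_to_infinity[OF F f A B *])
qed

lemma isCont_LINT:
  fixes F :: "real \<Rightarrow> 'a \<Rightarrow> real"
  assumes cont: "\<And>t. t \<in> space M \<Longrightarrow> isCont (\<lambda>z. F z t) z"
    and meas: "\<And>z. F z \<in> borel_measurable M" and w: "integrable M w"
    and bound: "\<And>z t. t \<in> space M \<Longrightarrow> \<bar>F z t\<bar> \<le> w t"
  shows "isCont (\<lambda>z. LINT t|M. F z t) z"
  unfolding continuous_at_sequentially comp_def
proof (intro allI impI)
  fix X assume X: "X \<longlonglongrightarrow> z"
  show "(\<lambda>n. LINT t|M. F (X n) t) \<longlonglongrightarrow> (LINT t|M. F z t)"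
  proof (rule integral_dominated_convergence[OF meas meas w])
    show "AE t in M. (\<lambda>n. F (X n) t) \<longlonglongrightarrow> F z t"
      using X cont by (intro AE_I2 isCont_tendsto_compose[where g = "\<lambda>z. F z _"])
    show "AE t in M. norm (F (X n) t) \<le> w t" for n using bound by (intro AE_I2) simp
  qed
qed

text \<open>By the mean value theorem the bound on the derivative dominates all difference
  quotients.\<close>

lemma DERIV_LINT:
  fixes F F' :: "real \<Rightarrow> 'a \<Rightarrow> real"
  assumes deriv: "\<And>z t. t \<in> space M \<Longrightarrow> ((\<lambda>z. F z t) has_real_derivative F' z t) (at z)"
    and int: "\<And>z. integrable M (F z)" and meas: "F' z \<in> borel_measurable M" and w: "integrable M w"
    and bound: "\<And>z t. t \<in> space M \<Longrightarrow> \<bar>F' z t\<bar> \<le> w t"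
  shows "((\<lambda>z. LINT t|M. F z t) has_real_derivative (LINT t|M. F' z t)) (at z)"
  unfolding DERIV_def tendsto_at_iff_sequentially comp_def
proof (intro allI impI)
  fix X :: "nat \<Rightarrow> real" assume X: "\<forall>i. X i \<in> UNIV - {0}" "X \<longlonglongrightarrow> 0"
  have [measurable]: "F z \<in> borel_measurable M" for z using int by (rule borel_measurable_integrable)
  have "(\<lambda>n. LINT t|M. (F (z + X n) t - F z t) / X n) \<longlonglongrightarrow> (LINT t|M. F' z t)"
  proof (rule integral_dominated_convergence[OF meas _ w])
    show "(\<lambda>t. (F (z + X n) t - F z t) / X n) \<in> borel_measurable M" for n by measurable
    show "AE t in M. (\<lambda>n. (F (z + X n) t - F z t) / X n) \<longlonglongrightarrow> F' z t"
    proof (rule AE_I2)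
      fix t assume "t \<in> space M"
      from deriv[OF this, of z] X show "(\<lambda>n. (F (z + X n) t - F z t) / X n) \<longlonglongrightarrow> F' z t"
        unfolding DERIV_def tendsto_at_iff_sequentially comp_def by blast
    qed
    show "AE t in M. norm ((F (z + X n) t - F z t) / X n) \<le> w t" for n
    proof (rule AE_I2)
      fix t assume t: "t \<in> space M"
      have "norm (F (z + X n) t - F z t) \<le> w t * norm (z + X n - z)"
        by (rule field_differentiable_bound[where S = UNIV and f' = "\<lambda>z. F' z t"])
           (use deriv[OF t] bound[OF t] in auto)
      then show "norm ((F (z + X n) t - F z t) / X n) \<le> w t"
        using X(1) by (simp add: divide_le_eq)
    qed
  qed
  then show "(\<lambda>n. ((LINT t|M. F (z + X n) t) - (LINT t|M. F z t)) / X n) \<longlonglongrightarrow> (LINT t|M. F' z t)"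
    using int by (simp add: Bochner_Integration.integral_diff)
qed

text \<open>The bound on \<^const>\<open>bs_scaled\<close> is uniform in \<open>h\<close> and passes to the limit.\<close>

lemma bs_limit_bound:
  assumes r: "0 \<le> r" and t: "0 < t"
  shows "\<bar>bs_limit r z t\<bar> \<le> (9 + 8 * r\<^sup>2) / cosh t"
proof -
  define h where "h m = 1 / (real m + 1 + r)" for m
  have h: "0 < h m" "h m \<le> 1" "r * h m \<le> 1" for m using r by (auto simp: h_def divide_simps)
  have "h \<longlonglongrightarrow> 0" unfolding h_def using r by real_asymp
  then have "filterlim h (at_right 0) sequentially"
    using h(1) less_imp_neq[OF h(1)] by (auto simp: filterlim_at)
  then have "(\<lambda>m. bs_scaled r (h m) 0 t) \<longlonglongrightarrow> - bs_limit r 0 t"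
    by (intro bs_scaled_limit r t) auto
  then have "(\<lambda>m. \<bar>bs_scaled r (h m) 0 t\<bar>) \<longlonglongrightarrow> \<bar>- bs_limit r 0 t\<bar>" by (rule tendsto_rabs)
  then have "\<bar>- bs_limit r 0 t\<bar> \<le> (9 + 8 * r\<^sup>2) / cosh t"
    by (rule LIMSEQ_le_const2) (use bs_scaled_bound[OF r h, of t] t in auto)
  moreover have "\<bar>bs_limit r z t\<bar> \<le> \<bar>bs_limit r 0 t\<bar>"
    unfolding bs_limit_def abs_mult by (intro mult_right_mono) auto
  ultimately show ?thesis by simp
qed

lemma bs_limit_measurable [measurable]: "bs_limit r z \<in> borel_measurable borel"
  unfolding bs_limit_def sinh_def cosh_def by measurable

lemma cosh_bound_integrable: "integrable lborel (\<lambda>t. C * (indicator {0<..} t / cosh t) :: real)"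
  using cosh_integrable by (intro integrable_mult_right)

lemma bs_limit_integrable:
  assumes r: "0 \<le> r"
  shows "set_integrable lborel {0<..} (bs_limit r z)"
  unfolding set_integrable_def
proof (rule Bochner_Integration.integrable_bound[OF cosh_bound_integrable[of "9 + 8 * r\<^sup>2"]])
  show "AE t in lborel. norm (indicator {0<..} t *\<^sub>R bs_limit r z t) \<le> norm ((9 + 8 * r\<^sup>2) * (indicator {0<..} t / cosh t))"
    using bs_limit_bound[OF r] by (intro AE_I2) (auto simp: indicator_def)
qed measurable

lemma K_BS_eq: "K_BS r z = (sinc z - (LBINT t:{0<..}. bs_limit r z t)) / pi"
  unfolding K_BS_sinc bs_limit_def ..

lemma isCont_K_BS:
  assumes r: "0 \<le> r"
  shows "isCont (K_BS r) z"
proof -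
  have "isCont (\<lambda>z. LINT t|lborel. indicator {0<..} t *\<^sub>R bs_limit r z t) z"
  proof (rule isCont_LINT[OF _ _ cosh_bound_integrable[of "9 + 8 * r\<^sup>2"]])
    show "isCont (\<lambda>z. indicator {0<..} t *\<^sub>R bs_limit r z t) z" for t
      unfolding bs_limit_def by (intro continuous_intros)
    show "\<bar>indicator {0<..} t *\<^sub>R bs_limit r z t\<bar> \<le> (9 + 8 * r\<^sup>2) * (indicator {0<..} t / cosh t)" for z t
      using bs_limit_bound[OF r] by (auto simp: indicator_def)
  qed measurable
  then show ?thesis
    unfolding K_BS_eq[abs_def] set_lebesgue_integral_def
    by (intro continuous_intros isCont_sinc) auto
qed

text \<open>The derivative of the bracket in the integrand of \<open>K_BS\<close>, as integration by
  parts produces it.\<close>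

definition bs_density :: "real \<Rightarrow> real \<Rightarrow> real" where
  "bs_density r t = (r\<^sup>2 * (cosh t)\<^sup>2 + (r\<^sup>2 - 1) * (sinh t)\<^sup>2) / ((sinh t)\<^sup>2 + r\<^sup>2)\<^sup>2"

lemma bs_density_measurable [measurable]: "bs_density r \<in> borel_measurable borel"
  unfolding bs_density_def sinh_def cosh_def by measurable

context
  fixes r :: real
  assumes r: "0 < r"
begin

lemma sinh_square_add_pos: "0 < (sinh t)\<^sup>2 + r\<^sup>2"
  using r by (intro add_nonneg_pos) auto

lemma bs_quotient_deriv:
  "((\<lambda>t. sinh t * cosh t / ((sinh t)\<^sup>2 + r\<^sup>2) - 1) has_real_derivative bs_density r t) (at t)"
proof -
  have "((\<lambda>t. sinh t * cosh t / ((sinh t)\<^sup>2 + r\<^sup>2) - 1) has_real_derivative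
     ((cosh t * cosh t + sinh t * sinh t) * ((sinh t)\<^sup>2 + r\<^sup>2) - sinh t * cosh t * (2 * sinh t * cosh t))
       / ((sinh t)\<^sup>2 + r\<^sup>2)\<^sup>2) (at t)"
    using sinh_square_add_pos[of t] by (auto intro!: derivative_eq_intros simp: power2_eq_square algebra_simps)
  also have "(cosh t * cosh t + sinh t * sinh t) * ((sinh t)\<^sup>2 + r\<^sup>2) - sinh t * cosh t * (2 * sinh t * cosh t)
     = r\<^sup>2 * (cosh t)\<^sup>2 + (r\<^sup>2 - 1) * (sinh t)\<^sup>2"
  proof -
    define S C where "S = (sinh t)\<^sup>2" and "C = (cosh t)\<^sup>2"
    have C: "C = S + 1" by (simp add: S_def C_def cosh_square_eq)
    have "(cosh t * cosh t + sinh t * sinh t) * ((sinh t)\<^sup>2 + r\<^sup>2) - sinh t * cosh t * (2 * sinh t * cosh t)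
       = (C + S) * (S + r\<^sup>2) - 2 * S * C"
      by (simp add: S_def C_def power2_eq_square)
    also have "\<dots> = r\<^sup>2 * C + (r\<^sup>2 - 1) * S" unfolding C by (simp add: algebra_simps)
    finally show ?thesis by (simp add: S_def C_def)
  qed
  finally show ?thesis by (simp add: bs_density_def)
qed

text \<open>The denominator is controlled by sinh^2 t + r^2 \<ge> \<mu> cosh^2 t with \<mu> = min 1
  r^2, which leaves 1 / cosh^2 t \<le> 1 / cosh t.\<close>

lemma bs_density_bound: "\<bar>bs_density r t\<bar> \<le> (2 * r\<^sup>2 + 1) / (min 1 (r\<^sup>2))\<^sup>2 / cosh t"
proof -
  define \<mu> where "\<mu> = min 1 (r\<^sup>2)"
  have \<mu>: "0 < \<mu>" "\<mu> \<le> 1" "\<mu> \<le> r\<^sup>2" using r by (auto simp: \<mu>_def)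
  have c: "1 \<le> (cosh t)\<^sup>2" using cosh_real_ge_1[of t] by (simp add: one_le_power)
  have s: "(sinh t)\<^sup>2 \<le> (cosh t)\<^sup>2" by (simp add: sinh_square_eq)
  have "\<bar>r\<^sup>2 * (cosh t)\<^sup>2 + (r\<^sup>2 - 1) * (sinh t)\<^sup>2\<bar> \<le> r\<^sup>2 * (cosh t)\<^sup>2 + \<bar>r\<^sup>2 - 1\<bar> * (sinh t)\<^sup>2"
    using abs_triangle_ineq[of "r\<^sup>2 * (cosh t)\<^sup>2" "(r\<^sup>2 - 1) * (sinh t)\<^sup>2"] by (simp add: abs_mult)
  also have "\<dots> \<le> r\<^sup>2 * (cosh t)\<^sup>2 + (r\<^sup>2 + 1) * (cosh t)\<^sup>2"
  proof -
    have "\<bar>r\<^sup>2 - 1\<bar> \<le> r\<^sup>2 + 1" using zero_le_power2[of r] by linarith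
    then show ?thesis using s by (intro add_left_mono mult_mono) simp_all
  qed
  also have "\<dots> = (2 * r\<^sup>2 + 1) * (cosh t)\<^sup>2" by (simp add: algebra_simps)
  finally have num: "\<bar>r\<^sup>2 * (cosh t)\<^sup>2 + (r\<^sup>2 - 1) * (sinh t)\<^sup>2\<bar> \<le> (2 * r\<^sup>2 + 1) * (cosh t)\<^sup>2" .
  have "\<mu> * (cosh t)\<^sup>2 = \<mu> * (sinh t)\<^sup>2 + \<mu>" by (simp add: cosh_square_eq algebra_simps)
  also have "\<dots> \<le> 1 * (sinh t)\<^sup>2 + r\<^sup>2" using \<mu> by (intro add_mono mult_right_mono) auto
  finally have den: "(\<mu> * (cosh t)\<^sup>2)\<^sup>2 \<le> ((sinh t)\<^sup>2 + r\<^sup>2)\<^sup>2"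
    using \<mu> by (intro power_mono) auto
  have "\<bar>bs_density r t\<bar> \<le> (2 * r\<^sup>2 + 1) * (cosh t)\<^sup>2 / (\<mu> * (cosh t)\<^sup>2)\<^sup>2"
    unfolding bs_density_def abs_divide abs_power2
    using num den \<mu> by (intro frac_le) auto
  also have "\<dots> = (2 * r\<^sup>2 + 1) / \<mu>\<^sup>2 / (cosh t)\<^sup>2" by (simp add: power2_eq_square)
  also have "\<dots> \<le> (2 * r\<^sup>2 + 1) / \<mu>\<^sup>2 / cosh t"
    using \<mu> cosh_real_ge_1[of t] by (intro divide_left_mono) (auto simp: power2_eq_square)
  finally show ?thesis by (simp add: \<mu>_def)
qed

lemma bs_density_integrable: "set_integrable lborel {0<..} (\<lambda>t. sin (z * cosh t) * bs_density r t)"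
  unfolding set_integrable_def
proof (rule Bochner_Integration.integrable_bound[OF cosh_bound_integrable[of "(2 * r\<^sup>2 + 1) / (min 1 (r\<^sup>2))\<^sup>2"]])
  have "\<bar>sin (z * cosh t) * bs_density r t\<bar> \<le> \<bar>bs_density r t\<bar>" for t
    unfolding abs_mult by (intro mult_left_le_one_le) auto
  then have "\<bar>sin (z * cosh t) * bs_density r t\<bar> \<le> (2 * r\<^sup>2 + 1) / (min 1 (r\<^sup>2))\<^sup>2 / cosh t" for t
    using bs_density_bound[of t] order.trans by blast
  then show "AE t in lborel. norm (indicator {0<..} t *\<^sub>R (sin (z * cosh t) * bs_density r t))
     \<le> norm ((2 * r\<^sup>2 + 1) / (min 1 (r\<^sup>2))\<^sup>2 * (indicator {0<..} t / cosh t))"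
    by (intro AE_I2) (auto simp: indicator_def)
qed measurable

lemma bs_quotient_at_top: "((\<lambda>t. sinh t * cosh t / ((sinh t)\<^sup>2 + r\<^sup>2) - 1) \<longlongrightarrow> 0) at_top"
  unfolding sinh_field_def cosh_field_def using r by real_asymp (simp add: power2_eq_square)

text \<open>z sinh t cos (z cosh t) is the derivative of sin (z cosh t). For r > 0 the bracket
  equals - 1 at t = 0, so the boundary value there is - sin z, which cancels the sine term of the
  kernel.\<close>

lemma K_BS_by_parts:
  assumes z: "z \<noteq> 0"
  shows "K_BS r z = 1 / (pi * z) * (LBINT t:{0<..}. sin (z * cosh t) * bs_density r t)"
proof -
  let ?G = "\<lambda>t. sinh t * cosh t / ((sinh t)\<^sup>2 + r\<^sup>2) - 1"
  have int1: "set_integrable lborel {0<..} (\<lambda>t. z * bs_limit r z t)"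
    using bs_limit_integrable[of r z] r by (intro set_integrable_mult_right) auto
  have "(LBINT t:{0<..}. z * bs_limit r z t + sin (z * cosh t) * bs_density r t) = 0 - (- sin z)"
  proof (rule LBINT_FTC_to_infinity)
    show "((\<lambda>t. sin (z * cosh t) * ?G t) has_real_derivative z * bs_limit r z t + sin (z * cosh t) * bs_density r t) (at t)" for t
    proof -
      have "((\<lambda>t. sin (z * cosh t)) has_real_derivative cos (z * cosh t) * (z * sinh t)) (at t)"
        by (auto intro!: derivative_eq_intros)
      from DERIV_mult[OF this bs_quotient_deriv] show ?thesis
        by (rule DERIV_cong) (simp add: bs_limit_def mult_ac)
    qed
    show "isCont (\<lambda>t. z * bs_limit r z t + sin (z * cosh t) * bs_density r t) t" for t
      using sinh_square_add_pos[of t] unfolding bs_limit_def bs_density_def by (intro continuous_intros) auto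
    show "((\<lambda>t. sin (z * cosh t) * ?G t) \<longlongrightarrow> - sin z) (at_right 0)"
      using r by (auto intro!: tendsto_eq_intros)
    show "((\<lambda>t. sin (z * cosh t) * ?G t) \<longlongrightarrow> 0) at_top"
    proof (rule Lim_null_comparison)
      show "((\<lambda>t. \<bar>?G t\<bar>) \<longlongrightarrow> 0) at_top" using tendsto_rabs[OF bs_quotient_at_top] by simp
      show "\<forall>\<^sub>F t in at_top. norm (sin (z * cosh t) * ?G t) \<le> \<bar>?G t\<bar>"
        unfolding real_norm_def abs_mult by (intro always_eventually allI mult_left_le_one_le) auto
    qed
    show "set_integrable lborel {0<..} (\<lambda>t. z * bs_limit r z t + sin (z * cosh t) * bs_density r t)"
      by (intro set_integral_add int1 bs_density_integrable)
  qed
  then have "z * (LBINT t:{0<..}. bs_limit r z t) + (LBINT t:{0<..}. sin (z * cosh t) * bs_density r t) = sin z"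
    using set_integral_add(2)[OF int1 bs_density_integrable[of z]] by simp
  then have "(LBINT t:{0<..}. bs_limit r z t) = (sin z - (LBINT t:{0<..}. sin (z * cosh t) * bs_density r t)) / z"
    using z by (simp add: field_simps)
  then show ?thesis using z unfolding K_BS_eq by (simp add: diff_divide_distrib)
qed

text \<open>At z = 0 the right-hand side is a limit; it exists because the kernel is continuous
  there and agrees with the quotient elsewhere.\<close>

theorem K_BS_eq_cont_at_0:
  "K_BS r z = cont_at_0 (\<lambda>z. 1 / (pi * z) * (LBINT t:{0<..}. sin (z * cosh t) * bs_density r t)) z"
proof (cases "z = 0")
  case False
  then show ?thesis using K_BS_by_parts[OF False] by (simp add: cont_at_0_def)
next
  case True
  have "(K_BS r \<longlongrightarrow> K_BS r 0) (at 0)"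
    using isCont_K_BS[of r 0] r by (simp add: isCont_def)
  then have "((\<lambda>z. 1 / (pi * z) * (LBINT t:{0<..}. sin (z * cosh t) * bs_density r t)) \<longlongrightarrow> K_BS r 0) (at 0)"
    by (rule Lim_transform_eventually) (auto simp: eventually_at_filter K_BS_by_parts)
  then have "Lim (at 0) (\<lambda>z. 1 / (pi * z) * (LBINT t:{0<..}. sin (z * cosh t) * bs_density r t)) = K_BS r 0"
    by (intro tendsto_Lim) auto
  then show ?thesis using True by (simp only: cont_at_0_def simp_thms if_True)
qed

end

section \<open>Uniqueness of Laplace transforms\<close>

lemma exp_bounded_integrable:
  fixes f :: "real \<Rightarrow> real"
  assumes "f \<in> borel_measurable borel" "\<And>z. 0 < z \<Longrightarrow> \<bar>f z\<bar> \<le> B"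
  shows "set_integrable lborel {0<..} (\<lambda>z. exp (- z) * f z)"
  unfolding set_integrable_def
proof (rule Bochner_Integration.integrable_bound)
  show "integrable lborel (\<lambda>z. B * (indicator {0<..} z *\<^sub>R exp (- (z * 1))) :: real)"
    using integrable_I0i_exp_mscale[of 1] by (intro integrable_mult_right) (simp add: set_integrable_def)
  have [measurable]: "f \<in> borel_measurable borel" by fact
  show "(\<lambda>z. indicator {0<..} z *\<^sub>R (exp (- z) * f z)) \<in> borel_measurable lborel" by measurable
  have "\<bar>f z\<bar> \<le> \<bar>B\<bar>" if "0 < z" for z using assms(2)[OF that] by linarith
  then show "AE z in lborel. norm (indicator {0<..} z *\<^sub>R (exp (- z) * f z)) \<le> norm (B * (indicator {0<..} z *\<^sub>R exp (- (z * 1))))"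
    by (intro AE_I2) (auto simp: indicator_def abs_mult mult_mono mult.commute)
qed

lemma LBINT_exp_minus: "(LBINT z:{0<..}. exp (- z)) = (1::real)"
  using LBINT_I0i_exp_mscale[of 1] by (simp add: interval_lebesgue_integral_0_infty)

lemma polynomial_exp_orthogonal:
  fixes g :: "real \<Rightarrow> real"
  assumes g: "g \<in> borel_measurable borel" "\<And>z. 0 < z \<Longrightarrow> \<bar>g z\<bar> \<le> B"
    and zero: "\<And>n::nat. (LBINT z:{0<..}. exp (- z) * (exp (- z) ^ n * g z)) = 0"
  shows "(LBINT z:{0<..}. exp (- z) * ((\<Sum>i\<le>n. a i * exp (- z) ^ i) * g z)) = 0"
proof -
  have [measurable]: "g \<in> borel_measurable borel" by fact
  have int: "set_integrable lborel {0<..} (\<lambda>z. exp (- z) * (exp (- z) ^ i * g z))" for i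
  proof (rule exp_bounded_integrable)
    show "(\<lambda>z. exp (- z) ^ i * g z) \<in> borel_measurable borel" by measurable
    fix z :: real assume z: "0 < z"
    have "exp (- z) ^ i * \<bar>g z\<bar> \<le> 1 * \<bar>g z\<bar>"
      using z by (intro mult_right_mono power_le_one) auto
    then show "\<bar>exp (- z) ^ i * g z\<bar> \<le> B" using g(2)[OF z] by (simp add: abs_mult)
  qed
  have "(LBINT z:{0<..}. exp (- z) * ((\<Sum>i\<le>n. a i * exp (- z) ^ i) * g z))
      = (LBINT z. (\<Sum>i\<le>n. a i * (indicator {0<..} z *\<^sub>R (exp (- z) * (exp (- z) ^ i * g z)))))"
    unfolding set_lebesgue_integral_def
    by (intro Bochner_Integration.integral_cong refl) (simp add: sum_distrib_left sum_distrib_right mult_ac)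
  also have "\<dots> = (\<Sum>i\<le>n. LBINT z. a i * (indicator {0<..} z *\<^sub>R (exp (- z) * (exp (- z) ^ i * g z))))"
    using int by (intro Bochner_Integration.integral_sum integrable_mult_right) (simp add: set_integrable_def)
  also have "\<dots> = (\<Sum>i\<le>n. a i * (LBINT z:{0<..}. exp (- z) * (exp (- z) ^ i * g z)))"
    by (simp add: set_lebesgue_integral_def)
  finally show ?thesis by (simp add: zero)
qed

text \<open>Substituting x = e^(-z) turns the transform at equally spaced points into the moments of
  a function on [0, 1], and a continuous function with vanishing moments is zero by Weierstrass. The
  factor e^(- p z) makes it continuous at x = 0 although \<open>D\<close> may grow
  exponentially.\<close>

theorem Laplace_transform_unique:
  fixes D :: "real \<Rightarrow> real" and p :: nat
  assumes cont: "continuous_on UNIV D"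
    and decay: "((\<lambda>z. exp (- real p * z) * D z) \<longlongrightarrow> 0) at_top"
    and zero: "\<And>n::nat. (LBINT z:{0<..}. exp (- (real n + real p + 1) * z) * D z) = 0"
    and z: "0 < z"
  shows "D z = 0"
proof -
  define g where "g z = exp (- real p * z) * D z" for z
  \<comment> \<open>\<open>g\<close> in the variable x = e^(-z), extended by its limit to x = 0, the
    image of z at infinity.\<close>
  define \<psi> where "\<psi> x = (if x \<le> 0 then 0 else g (- ln x))" for x
  have g_cont: "continuous_on A g" for A
    unfolding g_def[abs_def] using cont by (intro continuous_intros) (rule continuous_on_subset, auto)
  have [measurable]: "g \<in> borel_measurable borel"
    using g_cont by (rule borel_measurable_continuous_onI)
  have \<psi>_exp: "\<psi> (exp (- z)) = g z" for z by (simp add: \<psi>_def)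
  have \<psi>_cont: "continuous_on {0..1} \<psi>"
    unfolding continuous_on_def
  proof
    fix x :: real assume x: "x \<in> {0..1}"
    show "(\<psi> \<longlongrightarrow> \<psi> x) (at x within {0..1})"
    proof (cases "x = 0")
      case True
      have "filterlim (\<lambda>x::real. - ln x) at_top (at_right 0)"
        using ln_at_0 by (simp add: filterlim_uminus_at_bot)
      then have "((\<lambda>x. g (- ln x)) \<longlongrightarrow> 0) (at_right 0)"
        using decay unfolding g_def by (rule filterlim_compose[rotated])
      then have "(\<psi> \<longlongrightarrow> 0) (at_right 0)"
        by (rule Lim_transform_eventually) (auto simp: \<psi>_def eventually_at_filter)
      then have "(\<psi> \<longlongrightarrow> 0) (at 0 within {0..1})"
        by (simp add: at_within_Icc_at_right)
      then show ?thesis using True by (simp add: \<psi>_def)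
    next
      case False
      with x have pos: "0 < x" by simp
      have "isCont g (- ln x)" using g_cont[of UNIV] by (simp add: continuous_on_eq_continuous_at)
      then have "isCont (\<lambda>x. g (- ln x)) x"
        using pos by (intro isCont_o2[of x "\<lambda>x. - ln x" g]) (auto intro!: continuous_intros)
      then have "((\<lambda>x. g (- ln x)) \<longlongrightarrow> \<psi> x) (at x)" using pos by (simp add: isCont_def \<psi>_def)
      moreover have "\<forall>\<^sub>F y in at x. 0 < y" by (rule order_tendstoD(1)[OF tendsto_ident_at pos])
      then have "\<forall>\<^sub>F y in at x. g (- ln y) = \<psi> y" by eventually_elim (simp add: \<psi>_def)
      ultimately have "(\<psi> \<longlongrightarrow> \<psi> x) (at x)" by (rule Lim_transform_eventually)
      then show ?thesis by (rule tendsto_within_subset) simp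
    qed
  qed
  obtain B where B: "\<And>x. x \<in> {0..1} \<Longrightarrow> \<bar>\<psi> x\<bar> \<le> B"
  proof -
    have "bounded (\<psi> ` {0..1})"
      by (rule compact_imp_bounded[OF compact_continuous_image[OF \<psi>_cont compact_Icc]])
    then obtain b where "\<forall>y\<in>\<psi> ` {0..1}. norm y \<le> b" unfolding bounded_iff by blast
    then have "\<bar>\<psi> x\<bar> \<le> b" if "x \<in> {0..1}" for x using that by simp
    then show ?thesis using that by blast
  qed
  have gB: "\<bar>g z\<bar> \<le> B" if "0 < z" for z using B[of "exp (- z)"] that by (simp add: \<psi>_exp)
  have B0: "0 \<le> B" using gB[of 1] by linarith
  have int_sq: "set_integrable lborel {0<..} (\<lambda>z. exp (- z) * (g z * g z))"
  proof (rule exp_bounded_integrable)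
    show "\<bar>g z * g z\<bar> \<le> B * B" if "0 < z" for z
      unfolding abs_mult using gB[OF that] B0 by (intro mult_mono) auto
  qed measurable
  \<comment> \<open>For a polynomial q uniformly e-close to \<psi>, orthogonality replaces the
    integrand g^2 by (g - q) g, which is at most e B.\<close>
  have le: "(LBINT z:{0<..}. exp (- z) * (g z * g z)) \<le> e * B" if e: "0 < e" for e
  proof -
    obtain q where q: "real_polynomial_function q" "\<And>x. x \<in> {0..1} \<Longrightarrow> \<bar>\<psi> x - q x\<bar> < e"
      using Stone_Weierstrass_real_polynomial_function[OF compact_Icc \<psi>_cont e] by metis
    then obtain a n where q_eq: "q = (\<lambda>x. \<Sum>i\<le>n. a i * x ^ i)"
      unfolding real_polynomial_function_iff_sum by auto
    have [measurable]: "(\<lambda>z. q (exp (- z))) \<in> borel_measurable borel"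
      unfolding q_eq by measurable
    have close: "\<bar>g z - q (exp (- z))\<bar> \<le> e" if "0 < z" for z
      using q(2)[of "exp (- z)"] that by (simp add: \<psi>_exp less_imp_le)
    have "(LBINT z:{0<..}. exp (- z) * (q (exp (- z)) * g z)) = 0"
      unfolding q_eq
    proof (rule polynomial_exp_orthogonal[OF _ gB])
      have "exp (- z) * (exp (- z) ^ n * g z) = exp (- (real n + real p + 1) * z) * D z" for n z
      proof -
        have "exp (- z) * (exp (- z) ^ n * exp (- real p * z)) = exp (- (real n + real p + 1) * z)"
          unfolding exp_of_nat_mult[symmetric] exp_add[symmetric]
          by (rule arg_cong[where f = exp]) (simp add: algebra_simps)
        then show ?thesis unfolding g_def by (metis mult.assoc)
      qed
      then show "(LBINT z:{0<..}. exp (- z) * (exp (- z) ^ n * g z)) = 0" for n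
        using zero[of n] by simp
    qed measurable
    moreover have int_q: "set_integrable lborel {0<..} (\<lambda>z. exp (- z) * (q (exp (- z)) * g z))"
    proof (rule exp_bounded_integrable)
      show "\<bar>q (exp (- z)) * g z\<bar> \<le> (B + e) * B" if "0 < z" for z
        unfolding abs_mult using gB[OF that] close[OF that] B0 by (intro mult_mono) auto
    qed measurable
    ultimately have "(LBINT z:{0<..}. exp (- z) * (g z * g z))
       = (LBINT z:{0<..}. exp (- z) * (g z * g z) - exp (- z) * (q (exp (- z)) * g z))"
      using int_sq by (simp add: set_integral_diff)
    also have "\<dots> \<le> (LBINT z:{0<..}. e * B * exp (- z))"
    proof (rule set_integral_mono)
      show "set_integrable lborel {0<..} (\<lambda>z. exp (- z) * (g z * g z) - exp (- z) * (q (exp (- z)) * g z))"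
        using int_sq int_q by (rule set_integral_diff)
      show "set_integrable lborel {0<..} (\<lambda>z. e * B * exp (- z))"
        using integrable_I0i_exp_mscale[of 1] by (intro set_integrable_mult_right) simp
      fix z :: real assume z: "z \<in> {0<..}"
      have "(g z - q (exp (- z))) * g z \<le> e * B"
      proof -
        have "\<bar>g z - q (exp (- z))\<bar> * \<bar>g z\<bar> \<le> e * B"
          using gB close z e by (intro mult_mono) auto
        then show ?thesis by (simp add: abs_mult[symmetric])
      qed
      then have "exp (- z) * ((g z - q (exp (- z))) * g z) \<le> exp (- z) * (e * B)"
        by (intro mult_left_mono) auto
      then show "exp (- z) * (g z * g z) - exp (- z) * (q (exp (- z)) * g z) \<le> e * B * exp (- z)"
        by (simp add: algebra_simps)
    qed
    also have "\<dots> = e * B" by (simp add: LBINT_exp_minus)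
    finally show ?thesis .
  qed
  have "(LBINT z:{0<..}. exp (- z) * (g z * g z)) \<le> 0"
  proof (rule field_le_epsilon)
    fix e :: real assume e: "0 < e"
    have "(LBINT z:{0<..}. exp (- z) * (g z * g z)) \<le> e / (B + 1) * B"
      using e B0 by (intro le) simp
    also have "\<dots> \<le> e" using e B0 by (simp add: field_simps)
    finally show "(LBINT z:{0<..}. exp (- z) * (g z * g z)) \<le> 0 + e" by simp
  qed
  moreover have "0 \<le> (LBINT z:{0<..}. exp (- z) * (g z * g z))"
    unfolding set_lebesgue_integral_def by (intro integral_nonneg_AE AE_I2) simp
  ultimately have "(LBINT z:{0<..}. exp (- z) * (g z * g z)) = 0"
    by (rule antisym)
  then have "(LBINT z. indicator {0<..} z *\<^sub>R (exp (- z) * (g z * g z))) = 0"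
    unfolding set_lebesgue_integral_def .
  then have "AE z in lborel. indicator {0<..} z *\<^sub>R (exp (- z) * (g z * g z)) = 0"
    using int_sq by (subst (asm) integral_nonneg_eq_0_iff_AE) (auto simp: set_integrable_def)
  \<comment> \<open>The set where \<open>g\<close> is nonzero is open, and an open null set is
    empty.\<close>
  then have "AE z in lborel. z \<notin> {z. 0 < z \<and> g z \<noteq> 0}"
    by eventually_elim (auto simp: indicator_def)
  moreover have op: "open {z. 0 < z \<and> g z \<noteq> 0}"
    using g_cont[of UNIV] by (intro open_Collect_conj open_Collect_neq open_Collect_less continuous_intros)
  ultimately have "{z. 0 < z \<and> g z \<noteq> 0} \<in> null_sets lborel"
    by (subst AE_iff_null_sets) auto
  then have "negligible {z. 0 < z \<and> g z \<noteq> 0}"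
    unfolding negligible_iff_null_sets by (rule null_sets_completionI)
  with open_not_negligible[OF op] have "{z. 0 < z \<and> g z \<noteq> 0} = {}" by blast
  with z have "g z = 0" by blast
  then show ?thesis by (simp add: g_def)
qed

section \<open>Power series of the Bessel kernel\<close>

text \<open>Coefficients of J_1 (z) / z in powers of z^2.\<close>

definition bessel_coeff :: "nat \<Rightarrow> real" where
  "bessel_coeff k = (- 1) ^ k / (fact k * fact (k + 1)) / 2 * (1 / 4) ^ k"

definition bessel_int_coeff :: "nat \<Rightarrow> real" where
  "bessel_int_coeff k = bessel_coeff k / (2 * real k + 1)"

text \<open>J_1 (z) / z as an entire function, with the value 1/2 at 0.\<close>

definition bessel_quot :: "real \<Rightarrow> real" where
  "bessel_quot z = (\<Sum>k. bessel_coeff k * (z\<^sup>2) ^ k)"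

text \<open>The antiderivative of \<open>bessel_quot\<close> that vanishes at 0; the factor z is
  kept outside so that a power series in z^2 remains.\<close>

definition bessel_quot_int :: "real \<Rightarrow> real" where
  "bessel_quot_int z = z * (\<Sum>k. bessel_int_coeff k * (z\<^sup>2) ^ k)"

lemma fact_double_le: "fact (2 * k) \<le> (4 ^ k * fact k * fact k :: real)"
proof (induction k)
  case (Suc k)
  have "fact (2 * Suc k) = (2 * real k + 2) * (2 * real k + 1) * fact (2 * k)"
    by (simp add: algebra_simps)
  also have "\<dots> \<le> (2 * real k + 2) * (2 * real k + 2) * (4 ^ k * fact k * fact k)"
    using Suc by (intro mult_mono) auto
  also have "\<dots> = 4 ^ Suc k * fact (Suc k) * fact (Suc k)"
    by (simp add: algebra_simps)
  finally show ?case .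
qed simp

text \<open>Comparison with the series of cosh, which settles summability everywhere and later the
  exponential growth rate.\<close>

lemma bessel_coeff_bound: "\<bar>bessel_coeff k\<bar> \<le> 1 / fact (2 * k)"
proof -
  have "1 * (fact k :: real) \<le> 2 * fact (k + 1)"
    by (intro mult_mono fact_mono) auto
  then have "(4 ^ k * fact k) * (fact k :: real) \<le> (4 ^ k * fact k) * (2 * fact (k + 1))"
    by (intro mult_left_mono) auto
  with fact_double_le[of k] have "fact (2 * k) \<le> 4 ^ k * fact k * (2 * fact (k + 1) :: real)"
    by linarith
  then have "1 / (4 ^ k * fact k * (2 * fact (k + 1))) \<le> 1 / (fact (2 * k) :: real)"
    by (intro divide_left_mono) auto
  moreover have "\<bar>bessel_coeff k\<bar> = 1 / (4 ^ k * fact k * (2 * fact (k + 1)))"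
    unfolding bessel_coeff_def abs_mult abs_divide power_abs by (simp add: power_divide)
  ultimately show ?thesis by simp
qed

lemma bessel_int_coeff_bound: "\<bar>bessel_int_coeff k\<bar> \<le> 1 / fact (2 * k)"
proof -
  have "\<bar>bessel_int_coeff k\<bar> \<le> \<bar>bessel_coeff k\<bar> / 1"
    unfolding bessel_int_coeff_def abs_divide by (intro divide_left_mono) auto
  then show ?thesis using bessel_coeff_bound[of k] by simp
qed

lemma summable_coeff:
  assumes "\<And>k. \<bar>c k\<bar> \<le> 1 / fact (2 * k)"
  shows "summable (\<lambda>k. \<bar>c k * w ^ k\<bar>)" "summable (\<lambda>k. c k * w ^ k :: real)"
proof -
  have "\<bar>c k * w ^ k\<bar> \<le> inverse (fact k) * \<bar>w\<bar> ^ k" for k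
  proof -
    have "1 / fact (2 * k) \<le> 1 / (fact k :: real)"
      by (intro divide_left_mono fact_mono) auto
    then have "\<bar>c k\<bar> * \<bar>w\<bar> ^ k \<le> 1 / fact k * \<bar>w\<bar> ^ k"
      using assms[of k] by (intro mult_right_mono) auto
    then show ?thesis by (simp add: abs_mult power_abs divide_inverse)
  qed
  then show *: "summable (\<lambda>k. \<bar>c k * w ^ k\<bar>)"
    by (intro summable_comparison_test'[OF summable_exp[of "\<bar>w\<bar>"]]) simp
  then show "summable (\<lambda>k. c k * w ^ k)" by (rule summable_rabs_cancel)
qed

lemma cosh_sums_even: "(\<lambda>k. z ^ (2 * k) / fact (2 * k)) sums cosh (z :: real)"
proof -
  have "(\<lambda>k. if even (2 * k) then z ^ (2 * k) /\<^sub>R fact (2 * k) else 0) sums cosh z"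
    by (subst sums_mono_reindex[of "\<lambda>k. 2 * k" "\<lambda>n. if even n then z ^ n /\<^sub>R fact n else 0"])
       (auto simp: strict_mono_def cosh_converges elim!: evenE)
  then show ?thesis by (simp add: divide_inverse mult.commute)
qed

text \<open>Crude, since it ignores all cancellation in the series, but the uniqueness of Laplace
  transforms asks only for a growth rate.\<close>

lemma abs_bessel_quot_int_le: "\<bar>bessel_quot_int z\<bar> \<le> \<bar>z\<bar> * cosh z"
proof -
  have "\<bar>\<Sum>k. bessel_int_coeff k * (z\<^sup>2) ^ k\<bar> \<le> (\<Sum>k. \<bar>bessel_int_coeff k * (z\<^sup>2) ^ k\<bar>)"
    by (rule summable_rabs[OF summable_coeff(1)[OF bessel_int_coeff_bound]])
  also have "\<dots> \<le> (\<Sum>k. z ^ (2 * k) / fact (2 * k))"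
  proof (rule suminf_le[OF _ summable_coeff(1)[OF bessel_int_coeff_bound] sums_summable[OF cosh_sums_even]])
    fix k
    have "\<bar>bessel_int_coeff k\<bar> * z ^ (2 * k) \<le> 1 / fact (2 * k) * z ^ (2 * k)"
      using bessel_int_coeff_bound[of k] by (intro mult_right_mono) auto
    then show "\<bar>bessel_int_coeff k * (z\<^sup>2) ^ k\<bar> \<le> z ^ (2 * k) / fact (2 * k)"
      by (simp add: abs_mult power_mult)
  qed
  also have "\<dots> = cosh z" using cosh_sums_even by (rule sums_unique[symmetric])
  finally show ?thesis unfolding bessel_quot_int_def abs_mult by (intro mult_left_mono) auto
qed

lemma bessel_J_1_eq: "bessel_J 1 z = z * bessel_quot z"
proof -
  have "z * (bessel_coeff k * (z\<^sup>2) ^ k) = (- 1) ^ k / (fact k * fact (k + 1)) * (z / 2) ^ (2 * k + 1)" for k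
  proof -
    have "(z / 2) ^ (2 * k) = ((1 / 4) * z\<^sup>2) ^ k"
      by (simp add: power_mult power_divide)
    then have *: "(z / 2) ^ (2 * k + 1) = z / 2 * ((1 / 4) ^ k * (z\<^sup>2) ^ k)"
      by (simp only: power_mult_distrib power_add power_one_right mult.commute)
    have "z * (s / 2 * p * q) = s * (z / 2 * (p * q))" for s p q :: real by simp
    then show ?thesis unfolding bessel_coeff_def * .
  qed
  then show ?thesis
    unfolding bessel_J_def bessel_quot_def
    using suminf_mult[OF summable_coeff(2)[OF bessel_coeff_bound], of z "z\<^sup>2"] by simp
qed

text \<open>In w = z^2 the derivative of z S (z^2) is S + 2 w S', which multiplies the k-th
  coefficient by 2k + 1, the divisor in \<open>bessel_int_coeff\<close>.\<close>

lemma bessel_quot_int_deriv: "(bessel_quot_int has_real_derivative bessel_quot z) (at z)"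
proof -
  define S where "S w = (\<Sum>k. bessel_int_coeff k * w ^ k)" for w
  define S' where "S' w = (\<Sum>k. diffs bessel_int_coeff k * w ^ k)" for w
  have sum: "summable (\<lambda>k. bessel_int_coeff k * w ^ k)" for w
    by (rule summable_coeff(2)[OF bessel_int_coeff_bound])
  have S: "(S has_real_derivative S' w) (at w)" for w
    unfolding S_def[abs_def] S'_def by (rule termdiffs_strong_converges_everywhere[OF sum])
  have S'_sums: "(\<lambda>k. of_nat k * bessel_int_coeff k * w ^ k) sums (w * S' w)" for w
  proof -
    have "summable (\<lambda>k. diffs bessel_int_coeff k * w ^ k)"
      by (rule termdiff_converges_all[OF sum])
    then have "(\<lambda>k. w * (of_nat k * bessel_int_coeff k * w ^ (k - Suc 0))) sums (w * S' w)"
      unfolding S'_def by (intro sums_mult diffs_equiv)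
    moreover have "w * (of_nat k * bessel_int_coeff k * w ^ (k - Suc 0)) = of_nat k * bessel_int_coeff k * w ^ k" for k
      by (cases k) auto
    ultimately show ?thesis by simp
  qed
  have "(\<lambda>k. bessel_int_coeff k * w ^ k + 2 * (of_nat k * bessel_int_coeff k * w ^ k)) sums (S w + 2 * (w * S' w))" for w
    unfolding S_def by (intro sums_add sums_mult S'_sums summable_sums sum)
  moreover have "bessel_int_coeff k * w ^ k + 2 * (of_nat k * bessel_int_coeff k * w ^ k) = bessel_coeff k * w ^ k" for k w
  proof -
    have "bessel_coeff k = (2 * real k + 1) * bessel_int_coeff k" by (simp add: bessel_int_coeff_def)
    then show ?thesis by (simp add: algebra_simps)
  qed
  ultimately have "(\<lambda>k. bessel_coeff k * w ^ k) sums (S w + 2 * (w * S' w))" for w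
    by simp
  then have eq: "bessel_quot z = S (z\<^sup>2) + 2 * (z\<^sup>2 * S' (z\<^sup>2))"
    unfolding bessel_quot_def by (rule sums_unique[symmetric])
  have "((\<lambda>z. z * S (z\<^sup>2)) has_real_derivative S (z\<^sup>2) + (S' (z\<^sup>2) * (2 * z)) * z) (at z)"
    by (auto intro!: derivative_eq_intros DERIV_chain'[OF _ S])
  then show ?thesis
    unfolding bessel_quot_int_def[abs_def] S_def[symmetric] eq by (simp add: power2_eq_square mult_ac)
qed

lemma isCont_bessel_quot: "isCont bessel_quot z"
proof -
  have "isCont (\<lambda>w. \<Sum>k. bessel_coeff k * w ^ k) w" for w
    by (rule DERIV_isCont[OF termdiffs_strong_converges_everywhere[OF summable_coeff(2)[OF bessel_coeff_bound]]])
  moreover have "isCont (\<lambda>z. z\<^sup>2) z" by (intro continuous_intros)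
  ultimately show ?thesis
    unfolding bessel_quot_def[abs_def] by (rule isCont_o2[rotated])
qed

section \<open>Laplace transform of the power series\<close>

lemma has_bochner_integral_power_exp:
  fixes a :: real
  assumes a: "0 < a"
  shows "has_bochner_integral lborel (\<lambda>z. indicator {0<..} z * (z ^ n * exp (- a * z))) (fact n / a ^ Suc n)"
proof -
  have 1: "has_bochner_integral lborel (\<lambda>x. x ^ n * exp (- x) * indicator {0<..} x) (fact n :: real)"
    by (rule has_bochner_integral_I0i_power_exp_m)
  have "has_bochner_integral lborel (\<lambda>x. (0 + a * x) ^ n * exp (- (0 + a * x)) * indicator {0<..} (0 + a * x)) (fact n /\<^sub>R \<bar>a\<bar>)"
    by (rule lborel_has_bochner_integral_real_affine_iff[THEN iffD1, OF _ 1]) (use a in simp)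
  then have "has_bochner_integral lborel (\<lambda>x. ((0 + a * x) ^ n * exp (- (0 + a * x)) * indicator {0<..} (0 + a * x)) * (1 / a ^ n))
     ((fact n /\<^sub>R \<bar>a\<bar>) * (1 / a ^ n))"
    by (rule has_bochner_integral_mult_left) 
  moreover have "((0 + a * x) ^ n * exp (- (0 + a * x)) * indicator {0<..} (0 + a * x)) * (1 / a ^ n)
     = indicator {0<..} x * (x ^ n * exp (- a * x))" for x
    using a by (auto simp: indicator_def zero_less_mult_iff power_mult_distrib)
  moreover have "(fact n /\<^sub>R \<bar>a\<bar>) * (1 / a ^ n) = fact n / a ^ Suc n"
    using a by (simp add: divide_inverse)
  ultimately show ?thesis by simp
qed

lemma gbinomial_minus_half:
  "(- 1 / 2 :: real) gchoose k = (- 1) ^ k * (fact (2 * k) / (4 ^ k * fact k * fact k))"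
proof (induction k)
  case (Suc k)
  have "(- 1 / 2 :: real) gchoose Suc k = (- 1) ^ k * (fact (2 * k) / (4 ^ k * fact k * fact k)) * ((- 1 / 2 - real k) / (real k + 1))"
    unfolding gbinomial_Suc_rec Suc ..
  also have "\<dots> = (- 1) ^ Suc k * (fact (2 * Suc k) / (4 ^ Suc k * fact (Suc k) * fact (Suc k)))"
  proof -
    have "fact (2 * Suc k) = (2 * real k + 2) * (2 * real k + 1) * fact (2 * k)"
      by (simp add: algebra_simps)
    then have "(fact (2 * Suc k) / (4 ^ Suc k * fact (Suc k) * fact (Suc k)) :: real)
       = (2 * (real k + 1) * (2 * real k + 1) * fact (2 * k)) / (4 * (real k + 1) * (real k + 1) * (4 ^ k * fact k * fact k))"
      by (simp add: algebra_simps)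
    also have "\<dots> = fact (2 * k) / (4 ^ k * fact k * fact k) * ((1 / 2 + real k) / (real k + 1))"
    proof -
      have cancel: "2 * K * (2 * m + 1) * F / (4 * K * K * P) = F / P * ((1 / 2 + m) / K)" if "K \<noteq> 0" for K m F P :: real
      proof -
        have "2 * K * (2 * m + 1) * F = (4 * K) * (F * (1 / 2 + m))" by (simp add: algebra_simps)
        moreover have "4 * K * K * P = (4 * K) * (P * K)" by simp
        ultimately have "2 * K * (2 * m + 1) * F / (4 * K * K * P) = (F * (1 / 2 + m)) / (P * K)"
          using that by (simp only: mult_divide_mult_cancel_left mult_eq_0_iff zero_neq_numeral) simp
        then show ?thesis by simp
      qed
      show ?thesis by (rule cancel) simp
    qed
    finally have *: "(fact (2 * Suc k) / (4 ^ Suc k * fact (Suc k) * fact (Suc k)) :: real)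
       = fact (2 * k) / (4 ^ k * fact k * fact k) * ((1 / 2 + real k) / (real k + 1))" .
    have neg: "(- 1 / 2 - real k) / (real k + 1) = - ((1 / 2 + real k) / (real k + 1))"
      unfolding minus_divide_left by (rule arg_cong[where f = "\<lambda>x. x / (real k + 1)"]) simp
    have "(- 1) ^ k * c * (- d) = (- 1) ^ Suc k * (c * d)" for c d :: real by simp
    then show ?thesis unfolding * neg .
  qed
  finally show ?case .
qed simp

text \<open>The Laplace transform of z^(2k + 2) contributes (2k + 2)!, and this turns the series
  into the binomial series of (1 + 1 / a^2)^(-1/2).\<close>

lemma bessel_int_coeff_fact:
  "bessel_int_coeff k * fact (2 * k + 2) = (- 1 / 2) gchoose k"
proof -
  have f1: "fact (2 * k + 2) = 2 * (real k + 1) * (2 * real k + 1) * fact (2 * k)"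
    by (simp add: algebra_simps)
  have f2: "fact (k + 1) = (real k + 1) * fact k" by (simp add: algebra_simps)
  have "bessel_int_coeff k * fact (2 * k + 2)
     = (- 1) ^ k * ((2 * (real k + 1) * (2 * real k + 1) * fact (2 * k)) / (fact k * ((real k + 1) * fact k) * 2 * 4 ^ k * (2 * real k + 1)))"
    unfolding bessel_int_coeff_def bessel_coeff_def f1 f2 by (simp add: power_divide)
  also have "(2 * (real k + 1) * (2 * real k + 1) * fact (2 * k)) / (fact k * ((real k + 1) * fact k) * 2 * 4 ^ k * (2 * real k + 1))
     = fact (2 * k) / (4 ^ k * fact k * fact k)"
    by (simp add: divide_simps)
  finally show ?thesis unfolding gbinomial_minus_half .
qed

text \<open>Termwise integration. The integrals of the absolute values are dominated by a geometric
  series in 1 / a^2, whence a > 1.\<close>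

theorem Laplace_bessel_quot_int:
  assumes a: "1 < a"
  shows "set_integrable lborel {0<..} (\<lambda>z. exp (- a * z) * (z * bessel_quot_int z))"
    "(LBINT z:{0<..}. exp (- a * z) * (z * bessel_quot_int z)) = 1 / a ^ 3 * (1 + 1 / a\<^sup>2) powr (- 1 / 2)"
proof -
  define u where "u k z = bessel_int_coeff k * (indicator {0<..} z * (z ^ (2 * k + 2) * exp (- a * z)))" for k z
  have hbi: "has_bochner_integral lborel (u k) (bessel_int_coeff k * (fact (2 * k + 2) / a ^ Suc (2 * k + 2)))" for k
    unfolding u_def[abs_def] using a by (intro has_bochner_integral_mult_right has_bochner_integral_power_exp) simp
  have hbi_abs: "has_bochner_integral lborel (\<lambda>z. norm (u k z)) (\<bar>bessel_int_coeff k\<bar> * (fact (2 * k + 2) / a ^ Suc (2 * k + 2)))" for k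
  proof -
    have "norm (u k z) = \<bar>bessel_int_coeff k\<bar> * (indicator {0<..} z * (z ^ (2 * k + 2) * exp (- a * z)))" for z
      by (auto simp: u_def abs_mult indicator_def)
    then show ?thesis
      using a by (simp only:) (intro has_bochner_integral_mult_right has_bochner_integral_power_exp, simp)
  qed
  have int: "integrable lborel (u k)" for k using hbi by (rule integrable.intros)
  have u_alt: "u k z = indicator {0<..} z * (exp (- a * z) * z\<^sup>2) * (bessel_int_coeff k * (z\<^sup>2) ^ k)" for k z
    by (simp add: u_def power_add power_mult_distrib power_mult power2_eq_square mult_ac)
  have summable_u: "AE z in lborel. summable (\<lambda>k. norm (u k z))"
  proof (rule AE_I2)
    fix z :: real
    have "summable (\<lambda>k. norm (indicator {0<..} z * (exp (- a * z) * z\<^sup>2)) * \<bar>bessel_int_coeff k * (z\<^sup>2) ^ k\<bar>)"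
      by (intro summable_mult summable_coeff(1)[OF bessel_int_coeff_bound])
    then show "summable (\<lambda>k. norm (u k z))" unfolding u_alt norm_mult real_norm_def abs_mult .
  qed
  have suminf_u: "(\<Sum>k. u k z) = indicator {0<..} z * (exp (- a * z) * (z * bessel_quot_int z))" for z
    unfolding u_alt bessel_quot_int_def
    using suminf_mult[OF summable_coeff(2)[OF bessel_int_coeff_bound], of "indicator {0<..} z * (exp (- a * z) * z\<^sup>2)" "z\<^sup>2"]
    by (simp add: power2_eq_square mult_ac)
  have b: "\<bar>1 / a\<^sup>2\<bar> < 1" using a by (simp add: divide_simps one_less_power)
  have gsum: "(\<lambda>k. ((- 1 / 2) gchoose k) * (1 / a\<^sup>2) ^ k) sums (1 + 1 / a\<^sup>2) powr (- 1 / 2)"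
    by (rule Generalised_Binomial_Theorem.gen_binomial_real[OF b])
  have val: "bessel_int_coeff k * (fact (2 * k + 2) / a ^ Suc (2 * k + 2)) = 1 / a ^ 3 * (((- 1 / 2) gchoose k) * (1 / a\<^sup>2) ^ k)" for k
  proof -
    have "a ^ Suc (2 * k + 2) = a ^ 3 * (a\<^sup>2) ^ k"
    proof -
      have "Suc (2 * k + 2) = 3 + 2 * k" by simp
      then show ?thesis by (simp only: power_add power_mult)
    qed
    then show ?thesis
      unfolding bessel_int_coeff_fact[symmetric] by (simp add: power_divide)
  qed
  have summable_abs: "summable (\<lambda>k. LINT z|lborel. norm (u k z))"
  proof -
    have le_geom: "(LINT z|lborel. norm (u k z)) \<le> 1 / a ^ 3 * (1 / a\<^sup>2) ^ k" for k
    proof -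
      have g: "\<bar>(- 1 / 2 :: real) gchoose k\<bar> \<le> 1"
        using fact_double_le[of k] unfolding gbinomial_minus_half abs_mult power_abs by (simp add: divide_simps)
      have eq: "(LINT z|lborel. norm (u k z)) = \<bar>1 / a ^ 3 * (((- 1 / 2) gchoose k) * (1 / a\<^sup>2) ^ k)\<bar>"
        unfolding val[symmetric] using has_bochner_integral_integral_eq[OF hbi_abs[of k]] a by (simp add: abs_mult)
      have le: "\<bar>p * (g * q)\<bar> \<le> p * q" if "0 \<le> p" "0 \<le> q" "\<bar>g\<bar> \<le> 1" for p q g :: real
      proof -
        have "\<bar>p * (g * q)\<bar> = p * (\<bar>g\<bar> * q)" using that by (simp add: abs_mult)
        also have "\<dots> \<le> p * (1 * q)" using that by (intro mult_left_mono mult_right_mono) auto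
        finally show ?thesis by simp
      qed
      show ?thesis unfolding eq by (rule le[OF _ _ g]) (use a in auto)
    qed
    show ?thesis
    proof (rule summable_comparison_test')
      show "summable (\<lambda>k. 1 / a ^ 3 * (1 / a\<^sup>2) ^ k)"
        using b by (intro summable_mult summable_geometric) simp
      have "0 \<le> (LINT z|lborel. norm (u k z))" for k by (rule Bochner_Integration.integral_nonneg) simp
      then show "norm (LINT z|lborel. norm (u k z)) \<le> 1 / a ^ 3 * (1 / a\<^sup>2) ^ k" for k
        using le_geom[of k] by (simp only: real_norm_def abs_of_nonneg)
    qed
  qed
  show "set_integrable lborel {0<..} (\<lambda>z. exp (- a * z) * (z * bessel_quot_int z))"
    using integrable_suminf[OF int summable_u summable_abs] unfolding suminf_u set_integrable_def by simp
  have "(LINT z|lborel. (\<Sum>k. u k z)) = (\<Sum>k. integral\<^sup>L lborel (u k))"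
    by (rule integral_suminf[OF int summable_u summable_abs])
  also have "\<dots> = (\<Sum>k. 1 / a ^ 3 * (((- 1 / 2) gchoose k) * (1 / a\<^sup>2) ^ k))"
    unfolding has_bochner_integral_integral_eq[OF hbi] val ..
  also have "\<dots> = 1 / a ^ 3 * (1 + 1 / a\<^sup>2) powr (- 1 / 2)"
    by (rule sums_unique[OF sums_mult[OF gsum], symmetric])
  finally show "(LBINT z:{0<..}. exp (- a * z) * (z * bessel_quot_int z)) = 1 / a ^ 3 * (1 + 1 / a\<^sup>2) powr (- 1 / 2)"
    unfolding suminf_u set_lebesgue_integral_def by simp
qed

section \<open>The Bessel kernel\<close>

lemma bs_density_1: "bs_density 1 t = 1 / (cosh t)\<^sup>2"
proof -
  have "(sinh t)\<^sup>2 + 1 = (cosh t)\<^sup>2" by (simp add: cosh_square_eq)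
  then show ?thesis by (simp add: bs_density_def power2_eq_square)
qed

definition sin_integrand :: "real \<Rightarrow> real \<Rightarrow> real" where
  "sin_integrand z t = indicator {0<..} t * (sin (z * cosh t) / (cosh t)\<^sup>2)"

definition cos_integrand :: "real \<Rightarrow> real \<Rightarrow> real" where
  "cos_integrand z t = indicator {0<..} t * (cos (z * cosh t) / cosh t)"

text \<open>pi z times \<open>K_BS 1 z\<close> for z \<noteq> 0, by the sine form of the
  kernel.\<close>

definition sin_int :: "real \<Rightarrow> real" where
  "sin_int z = (LINT t|lborel. sin_integrand z t)"

definition cos_int :: "real \<Rightarrow> real" where
  "cos_int z = (LINT t|lborel. cos_integrand z t)"

lemma sin_integrand_measurable [measurable]: "sin_integrand z \<in> borel_measurable borel"
  unfolding sin_integrand_def by measurable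

lemma cos_integrand_measurable [measurable]: "cos_integrand z \<in> borel_measurable borel"
  unfolding cos_integrand_def by measurable

lemma cos_integrand_bound: "\<bar>cos_integrand z t\<bar> \<le> indicator {0<..} t / cosh t"
  by (auto simp: cos_integrand_def indicator_def divide_right_mono)

lemma sin_integrand_bound: "\<bar>sin_integrand z t\<bar> \<le> indicator {0<..} t / cosh t"
proof -
  have "\<bar>sin (z * cosh t)\<bar> / (cosh t)\<^sup>2 \<le> 1 / cosh t"
    using cosh_real_ge_1[of t] by (intro frac_le) (auto simp: power2_eq_square)
  then show ?thesis by (auto simp: sin_integrand_def indicator_def)
qed

lemma cos_integrand_integrable: "integrable lborel (cos_integrand z)"
  by (rule Bochner_Integration.integrable_bound[OF cosh_integrable])
     (auto intro!: AE_I2 order.trans[OF cos_integrand_bound])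

lemma sin_integrand_integrable: "integrable lborel (sin_integrand z)"
  by (rule Bochner_Integration.integrable_bound[OF cosh_integrable])
     (auto intro!: AE_I2 order.trans[OF sin_integrand_bound])

definition cosh_const :: real where
  "cosh_const = (LINT t|lborel. indicator {0<..} t / cosh t)"

lemma sin_int_bound: "\<bar>sin_int z\<bar> \<le> cosh_const"
proof -
  have "\<bar>sin_int z\<bar> \<le> (LINT t|lborel. \<bar>sin_integrand z t\<bar>)"
    unfolding sin_int_def by (rule integral_abs_bound)
  also have "\<dots> \<le> cosh_const"
    unfolding cosh_const_def
    by (intro integral_mono cosh_integrable integrable_abs sin_integrand_integrable sin_integrand_bound)
  finally show ?thesis .
qed

lemma sin_int_deriv: "(sin_int has_real_derivative cos_int z) (at z)"
  unfolding sin_int_def[abs_def] cos_int_def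
proof (rule DERIV_LINT[OF _ _ _ cosh_integrable])
  show "((\<lambda>z. sin_integrand z t) has_real_derivative cos_integrand z t) (at z)" for z t
  proof -
    have "((\<lambda>z. sin (z * cosh t)) has_real_derivative cos (z * cosh t) * cosh t) (at z)"
      by (auto intro!: derivative_eq_intros)
    from DERIV_cmult[OF this, of "indicator {0<..} t / (cosh t)\<^sup>2"] show ?thesis
      by (simp add: sin_integrand_def cos_integrand_def power2_eq_square)
  qed
qed (use sin_integrand_integrable cos_integrand_bound in auto)

lemma K_BS_1_eq: "z \<noteq> 0 \<Longrightarrow> K_BS 1 z = sin_int z / (pi * z)"
  using K_BS_by_parts[of 1 z]
  by (simp add: bs_density_1 set_lebesgue_integral_def sin_int_def sin_integrand_def)

section \<open>Laplace transform of the sine integral\<close>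

lemma LBINT_exp_sin:
  fixes a b :: real
  assumes a: "0 < a" and b: "0 < b"
  shows "(LBINT z:{0<..}. exp (- a * z) * sin (b * z)) = b / (a\<^sup>2 + b\<^sup>2)"
proof -
  have pos: "0 < a\<^sup>2 + b\<^sup>2" using zero_less_power[OF a, of 2] zero_le_power2[of b] by linarith
  define F where "F z = - (exp (- a * z) * (a * sin (b * z) + b * cos (b * z)) / (a\<^sup>2 + b\<^sup>2))" for z
  have "(LBINT z:{0<..}. exp (- a * z) * sin (b * z)) = 0 - (- (b / (a\<^sup>2 + b\<^sup>2)))"
  proof (rule LBINT_FTC_to_infinity)
    show "(F has_real_derivative exp (- a * z) * sin (b * z)) (at z)" for z
    proof -
      have "((\<lambda>z. - (exp (- a * z) * (a * sin (b * z) + b * cos (b * z)))) has_real_derivative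
         exp (- a * z) * sin (b * z) * (a\<^sup>2 + b\<^sup>2)) (at z)"
        by (auto intro!: derivative_eq_intros simp: algebra_simps power2_eq_square)
      from DERIV_cdivide[OF this, of "a\<^sup>2 + b\<^sup>2"] pos a show ?thesis
        unfolding F_def[abs_def] by simp
    qed
    show "isCont (\<lambda>z. exp (- a * z) * sin (b * z)) z" for z by (intro continuous_intros)
    show "(F \<longlongrightarrow> - (b / (a\<^sup>2 + b\<^sup>2))) (at_right 0)"
      unfolding F_def using pos by (auto intro!: tendsto_eq_intros)
    show "(F \<longlongrightarrow> 0) at_top"
    proof (rule Lim_null_comparison)
      show "((\<lambda>z. exp (- a * z) * ((a + b) / (a\<^sup>2 + b\<^sup>2))) \<longlongrightarrow> 0) at_top"
      proof -
        have "((\<lambda>z. exp (- a * z)) \<longlongrightarrow> 0) at_top" using a by real_asymp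
        from tendsto_mult_right[OF this, of "(a + b) / (a\<^sup>2 + b\<^sup>2)"] show ?thesis by simp
      qed
      have "norm (F z) \<le> exp (- a * z) * ((a + b) / (a\<^sup>2 + b\<^sup>2))" for z
      proof -
        have "\<bar>a * sin (b * z) + b * cos (b * z)\<bar> \<le> \<bar>a * sin (b * z)\<bar> + \<bar>b * cos (b * z)\<bar>"
          by (rule abs_triangle_ineq)
        also have "\<dots> \<le> a * 1 + b * 1"
          using a b unfolding abs_mult by (intro add_mono mult_mono) auto
        finally have "\<bar>a * sin (b * z) + b * cos (b * z)\<bar> \<le> a + b" by simp
        then have "exp (- a * z) * (\<bar>a * sin (b * z) + b * cos (b * z)\<bar> / (a\<^sup>2 + b\<^sup>2))
          \<le> exp (- a * z) * ((a + b) / (a\<^sup>2 + b\<^sup>2))"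
          using pos by (intro mult_left_mono divide_right_mono) auto
        then show ?thesis using pos by (simp add: F_def abs_mult)
      qed
      then show "\<forall>\<^sub>F z in at_top. norm (F z) \<le> exp (- a * z) * ((a + b) / (a\<^sup>2 + b\<^sup>2))"
        by (intro always_eventually allI)
    qed
    show "set_integrable lborel {0<..} (\<lambda>z. exp (- a * z) * sin (b * z))"
      unfolding set_integrable_def
    proof (rule Bochner_Integration.integrable_bound)
      show "integrable lborel (\<lambda>z. indicator {0<..} z *\<^sub>R exp (- (z * a)) :: real)"
        using integrable_I0i_exp_mscale[OF a] by (simp add: set_integrable_def)
      show "AE z in lborel. norm (indicator {0<..} z *\<^sub>R (exp (- a * z) * sin (b * z))) \<le> norm (indicator {0<..} z *\<^sub>R exp (- (z * a)) :: real)"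
        by (intro AE_I2) (auto simp: indicator_def abs_mult mult.commute mult_left_le_one_le)
    qed measurable
  qed
  then show ?thesis by simp
qed

text \<open>Partial fractions in cosh^2 t. With S = sinh t both parts are differentials of
  arctangents, since cosh^2 t = 1 + S^2 and a^2 + cosh^2 t = A^2 + S^2.\<close>

lemma LBINT_cosh_rational:
  fixes a :: real
  assumes a: "0 < a"
  shows "(LBINT t:{0<..}. 1 / (cosh t)\<^sup>2 * (cosh t / (a\<^sup>2 + (cosh t)\<^sup>2)))
     = pi / 2 * (1 - 1 / sqrt (1 + a\<^sup>2)) / a\<^sup>2"
proof -
  define A where "A = sqrt (1 + a\<^sup>2)"
  have A: "0 < A" "A\<^sup>2 = 1 + a\<^sup>2" by (auto simp: A_def add_pos_nonneg)
  define F where "F t = (arctan (sinh t) - arctan (sinh t / A) / A) / a\<^sup>2" for t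
  have "(LBINT t:{0<..}. 1 / (cosh t)\<^sup>2 * (cosh t / (a\<^sup>2 + (cosh t)\<^sup>2))) = (pi / 2 - pi / 2 / A) / a\<^sup>2 - 0"
  proof (rule LBINT_FTC_nonneg_to_infinity(2))
    have den: "a\<^sup>2 + (cosh t)\<^sup>2 \<noteq> 0" for t using a by (simp add: add_nonneg_eq_0_iff)
    show "(F has_real_derivative 1 / (cosh t)\<^sup>2 * (cosh t / (a\<^sup>2 + (cosh t)\<^sup>2))) (at t)" for t
    proof -
      have "(F has_real_derivative (cosh t / (1 + (sinh t)\<^sup>2) - (cosh t / A) / (1 + (sinh t / A)\<^sup>2) / A) / a\<^sup>2) (at t)"
        unfolding F_def[abs_def] using A a by (auto intro!: derivative_eq_intros simp: divide_inverse)
      also have "1 + (sinh t)\<^sup>2 = (cosh t)\<^sup>2" by (simp add: cosh_square_eq)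
      also have "(cosh t / A) / (1 + (sinh t / A)\<^sup>2) / A = cosh t / (a\<^sup>2 + (cosh t)\<^sup>2)"
      proof -
        have "A * (1 + (sinh t / A)\<^sup>2) * A = A\<^sup>2 + (sinh t)\<^sup>2"
        proof -
          have "A * (1 + (sinh t / A)\<^sup>2) * A = A * A + (A * (sinh t / A)) * (A * (sinh t / A))"
            by (simp only: power2_eq_square distrib_left distrib_right mult_1_right mult.assoc mult.left_commute mult.commute)
          also have "A * (sinh t / A) = sinh t" using A by simp
          finally show ?thesis by (simp add: power2_eq_square)
        qed
        also have "\<dots> = a\<^sup>2 + (cosh t)\<^sup>2" unfolding A(2) by (simp add: cosh_square_eq)
        finally show ?thesis by (simp add: mult.commute mult.left_commute)
      qed
      also have "(cosh t / (cosh t)\<^sup>2 - cosh t / (a\<^sup>2 + (cosh t)\<^sup>2)) / a\<^sup>2 = 1 / (cosh t)\<^sup>2 * (cosh t / (a\<^sup>2 + (cosh t)\<^sup>2))"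
      proof -
        have "cosh t / (cosh t)\<^sup>2 - cosh t / (a\<^sup>2 + (cosh t)\<^sup>2)
          = (cosh t * (a\<^sup>2 + (cosh t)\<^sup>2) - cosh t * (cosh t)\<^sup>2) / ((cosh t)\<^sup>2 * (a\<^sup>2 + (cosh t)\<^sup>2))"
          using den by (subst diff_frac_eq) auto
        also have "cosh t * (a\<^sup>2 + (cosh t)\<^sup>2) - cosh t * (cosh t)\<^sup>2 = cosh t * a\<^sup>2" by (simp add: algebra_simps)
        finally show ?thesis using a by simp
      qed
      finally show ?thesis .
    qed
    show "isCont (\<lambda>t. 1 / (cosh t)\<^sup>2 * (cosh t / (a\<^sup>2 + (cosh t)\<^sup>2))) t" for t
      using den[of t] by (intro continuous_intros) auto
    show "(F \<longlongrightarrow> 0) (at_right 0)" unfolding F_def using A a by (auto intro!: tendsto_eq_intros)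
    have s: "filterlim (sinh :: real \<Rightarrow> real) at_top at_top"
      by (rule sinh_real_at_top)
    have "((\<lambda>t. arctan (sinh t)) \<longlongrightarrow> pi / 2) at_top"
      by (rule filterlim_compose[OF tendsto_arctan_at_top s])
    moreover have "((\<lambda>t. arctan (sinh t / A)) \<longlongrightarrow> pi / 2) at_top"
    proof (rule filterlim_compose[OF tendsto_arctan_at_top])
      show "filterlim (\<lambda>t. sinh t / A) at_top at_top"
        using filterlim_tendsto_pos_mult_at_top[OF tendsto_const[of "1 / A"] _ s] A by simp
    qed
    ultimately show "(F \<longlongrightarrow> (pi / 2 - pi / 2 / A) / a\<^sup>2) at_top"
      unfolding F_def using A a by (intro tendsto_intros) auto
    show "0 \<le> 1 / (cosh t)\<^sup>2 * (cosh t / (a\<^sup>2 + (cosh t)\<^sup>2))" for t by (intro mult_nonneg_nonneg divide_nonneg_nonneg) auto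
  qed
  then show ?thesis by (simp add: A_def right_diff_distrib)
qed

text \<open>Fubini, with exp (- a z) / cosh t dominating the double integrand. Integrating over z
  first leaves the Laplace transform of a sine, cosh t / (a^2 + cosh^2 t), hence an elementary
  integral in t.\<close>

theorem Laplace_sin_int:
  fixes a :: real
  assumes a: "0 < a"
  shows "set_integrable lborel {0<..} (\<lambda>z. exp (- a * z) * sin_int z)"
    "(LBINT z:{0<..}. exp (- a * z) * sin_int z) = pi / 2 * (1 - 1 / sqrt (1 + a\<^sup>2)) / a\<^sup>2"
proof -
  define H where "H z t = indicator {0<..} z * exp (- a * z) * sin_integrand z t" for z t
  have sin_int_cont: "continuous_on UNIV sin_int"
    using DERIV_continuous_on[OF sin_int_deriv] has_field_derivative_at_within by blast
  then have [measurable]: "sin_int \<in> borel_measurable borel" by (rule borel_measurable_continuous_onI)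
  have [measurable]: "(\<lambda>(z, t). H z t) \<in> borel_measurable (lborel \<Otimes>\<^sub>M lborel)"
    unfolding H_def sin_integrand_def by measurable
  have bound: "integrable lborel (\<lambda>z. cosh_const * (indicator {0<..} z *\<^sub>R exp (- (z * a))) :: real)"
    using integrable_I0i_exp_mscale[OF a] by (intro integrable_mult_right) (simp add: set_integrable_def)
  have Hint: "integrable lborel (H z)" for z
    unfolding H_def[abs_def] by (intro integrable_mult_right sin_integrand_integrable)
  have Hpair: "integrable (lborel \<Otimes>\<^sub>M lborel) (\<lambda>(z, t). H z t)"
  proof (rule lborel_pair.Fubini_integrable)
    show "integrable lborel (\<lambda>z. LINT t|lborel. norm (case (z, t) of (z, t) \<Rightarrow> H z t))"
    proof (rule Bochner_Integration.integrable_bound[OF bound])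
      show "AE z in lborel. norm (LINT t|lborel. norm (case (z, t) of (z, t) \<Rightarrow> H z t))
         \<le> norm (cosh_const * (indicator {0<..} z *\<^sub>R exp (- (z * a))))"
      proof (rule AE_I2)
        fix z :: real
        have "norm (H z t) = indicator {0<..} z * exp (- a * z) * \<bar>sin_integrand z t\<bar>" for t
          by (simp add: H_def abs_mult)
        moreover have "(LINT t|lborel. \<bar>sin_integrand z t\<bar>) \<le> cosh_const"
          unfolding cosh_const_def
          by (intro integral_mono cosh_integrable integrable_abs sin_integrand_integrable sin_integrand_bound)
        then have "indicator {0<..} z * exp (- a * z) * (LINT t|lborel. \<bar>sin_integrand z t\<bar>)
           \<le> indicator {0<..} z * exp (- a * z) * cosh_const"
          by (intro mult_left_mono) auto
        moreover have "0 \<le> (LINT t|lborel. \<bar>sin_integrand z t\<bar>)" by (intro Bochner_Integration.integral_nonneg) simp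
        moreover have "0 \<le> cosh_const" using sin_int_bound[of 0] by linarith
        ultimately show "norm (LINT t|lborel. norm (case (z, t) of (z, t) \<Rightarrow> H z t))
         \<le> norm (cosh_const * (indicator {0<..} z *\<^sub>R exp (- (z * a))))"
          by (simp add: abs_mult mult_ac)
      qed
    qed measurable
    show "AE z in lborel. integrable lborel (\<lambda>t. case (z, t) of (z, t) \<Rightarrow> H z t)"
      using Hint by (intro AE_I2) simp
  qed measurable
  have inner: "(LINT t|lborel. H z t) = indicator {0<..} z *\<^sub>R (exp (- a * z) * sin_int z)" for z
    by (simp add: H_def sin_int_def)
  show "set_integrable lborel {0<..} (\<lambda>z. exp (- a * z) * sin_int z)"
    using lborel_pair.integrable_fst[OF Hpair] unfolding inner set_integrable_def .
  have outer: "(LINT z|lborel. H z t) = indicator {0<..} t *\<^sub>R (1 / (cosh t)\<^sup>2 * (cosh t / (a\<^sup>2 + (cosh t)\<^sup>2)))" for t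
  proof -
    have "(LINT z|lborel. H z t) = (LINT z|lborel. (indicator {0<..} t / (cosh t)\<^sup>2) *
       (indicator {0<..} z *\<^sub>R (exp (- a * z) * sin (cosh t * z))))"
      by (intro Bochner_Integration.integral_cong refl) (simp add: H_def sin_integrand_def mult_ac)
    also have "\<dots> = (indicator {0<..} t / (cosh t)\<^sup>2) * (cosh t / (a\<^sup>2 + (cosh t)\<^sup>2))"
      using LBINT_exp_sin[OF a cosh_real_pos[of t]] by (simp add: set_lebesgue_integral_def)
    finally show ?thesis by simp
  qed
  have "(LBINT z:{0<..}. exp (- a * z) * sin_int z) = (LINT z|lborel. LINT t|lborel. H z t)"
    by (simp add: set_lebesgue_integral_def inner)
  also have "\<dots> = (LINT t|lborel. LINT z|lborel. H z t)"
    by (rule lborel_pair.Fubini_integral[OF Hpair, symmetric])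
  also have "\<dots> = (LBINT t:{0<..}. 1 / (cosh t)\<^sup>2 * (cosh t / (a\<^sup>2 + (cosh t)\<^sup>2)))"
    unfolding outer set_lebesgue_integral_def ..
  also have "\<dots> = pi / 2 * (1 - 1 / sqrt (1 + a\<^sup>2)) / a\<^sup>2"
    by (rule LBINT_cosh_rational[OF a])
  finally show "(LBINT z:{0<..}. exp (- a * z) * sin_int z) = pi / 2 * (1 - 1 / sqrt (1 + a\<^sup>2)) / a\<^sup>2" .
qed

text \<open>The Laplace transforms agree for a > 1: the binomial closed form a^(-3) (1 + 1 /
  a^2)^(-1/2) is 1 / (a^2 sqrt (1 + a^2)), the term subtracted from 1 / a^2 in the transform of
  \<open>sin_int\<close>.\<close>

theorem sin_int_eq:
  assumes z: "0 < z"
  shows "sin_int z = pi / 2 * (z - z * bessel_quot_int z)"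
proof -
  define D where "D z = sin_int z - (pi / 2 * z - pi / 2 * (z * bessel_quot_int z))" for z
  have isCont_sin_int: "isCont sin_int z" for z by (rule DERIV_isCont[OF sin_int_deriv])
  have isCont_quot_int: "isCont bessel_quot_int z" for z by (rule DERIV_isCont[OF bessel_quot_int_deriv])
  have "D z = 0"
  \<comment> \<open>p = 3 beats the growth z^2 cosh z of the crude bound and keeps the sample points
    n + 4 beyond 1.\<close>
  proof (rule Laplace_transform_unique[where p = 3, OF _ _ _ z])
    show "continuous_on UNIV D"
      unfolding D_def[abs_def]
      by (intro continuous_at_imp_continuous_on ballI continuous_intros isCont_sin_int isCont_quot_int)
    show "((\<lambda>z. exp (- real 3 * z) * D z) \<longlongrightarrow> 0) at_top"
    proof (rule Lim_null_comparison)
      define C where "C = cosh_const + 1"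
      have C: "0 < C" using sin_int_bound[of 0] by (simp add: C_def)
      show "((\<lambda>z. exp (- 3 * z) * (C + (2 * z + 2 * (z * (z * ((exp z + exp (- z)) / 2)))))) \<longlongrightarrow> 0) at_top"
        using C by real_asymp
      have le: "norm (exp (- real 3 * z) * D z) \<le> exp (- 3 * z) * (C + (2 * z + 2 * (z * (z * ((exp z + exp (- z)) / 2)))))"
        if z: "0 \<le> z" for z
      proof -
        have "\<bar>z * bessel_quot_int z\<bar> \<le> z * (z * cosh z)"
          unfolding abs_mult using abs_bessel_quot_int_le[of z] z by (intro mult_mono) auto
        then have 1: "\<bar>pi / 2 * (z * bessel_quot_int z)\<bar> \<le> 2 * (z * (z * cosh z))"
          unfolding abs_mult[of "pi / 2"] using pi_less_4 z by (intro mult_mono) auto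
        have 2: "\<bar>pi / 2 * z\<bar> \<le> 2 * z"
          unfolding abs_mult using pi_less_4 z by (intro mult_mono) auto
        have "\<bar>D z\<bar> \<le> C + (2 * z + 2 * (z * (z * cosh z)))"
          using 1 2 sin_int_bound[of z] unfolding D_def C_def by linarith
        then have "exp (- 3 * z) * \<bar>D z\<bar> \<le> exp (- 3 * z) * (C + (2 * z + 2 * (z * (z * cosh z))))"
          by (intro mult_left_mono) auto
        then show ?thesis by (simp add: abs_mult cosh_field_def)
      qed
      show "\<forall>\<^sub>F z in at_top. norm (exp (- real 3 * z) * D z) \<le> exp (- 3 * z) * (C + (2 * z + 2 * (z * (z * ((exp z + exp (- z)) / 2)))))"
        by (rule eventually_mono[OF eventually_ge_at_top[of 0] le])
    qed
    fix n :: nat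
    define a where "a = real n + real 3 + 1"
    have a: "1 < a" by (simp add: a_def)
    have lin: "has_bochner_integral lborel (\<lambda>z. indicator {0<..} z * (z ^ 1 * exp (- a * z))) (fact 1 / a ^ Suc 1)"
      using a by (intro has_bochner_integral_power_exp) simp
    have lin_int: "set_integrable lborel {0<..} (\<lambda>z. exp (- a * z) * z)"
      using integrable.intros[OF lin] by (simp add: set_integrable_def mult_ac)
    have lin_val: "(LBINT z:{0<..}. exp (- a * z) * z) = 1 / a\<^sup>2"
      using has_bochner_integral_integral_eq[OF lin] by (simp add: set_lebesgue_integral_def mult_ac power2_eq_square)
    have sin: "set_integrable lborel {0<..} (\<lambda>z. exp (- a * z) * sin_int z)"
      using Laplace_sin_int(1) a by simp
    have quot: "set_integrable lborel {0<..} (\<lambda>z. exp (- a * z) * (z * bessel_quot_int z))"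
      using Laplace_bessel_quot_int(1) a by simp
    have "(LBINT z:{0<..}. exp (- a * z) * D z) = (LBINT z:{0<..}. exp (- a * z) * sin_int z
       - (pi / 2 * (exp (- a * z) * z) - pi / 2 * (exp (- a * z) * (z * bessel_quot_int z))))"
      unfolding D_def by (simp add: algebra_simps)
    also have "\<dots> = (LBINT z:{0<..}. exp (- a * z) * sin_int z)
       - (pi / 2 * (LBINT z:{0<..}. exp (- a * z) * z) - pi / 2 * (LBINT z:{0<..}. exp (- a * z) * (z * bessel_quot_int z)))"
      by (simp only: set_integral_diff set_integral_mult_right set_integrable_mult_right sin quot lin_int)
    also have "\<dots> = pi / 2 * (1 - 1 / sqrt (1 + a\<^sup>2)) / a\<^sup>2
       - (pi / 2 * (1 / a\<^sup>2) - pi / 2 * (1 / a ^ 3 * (1 + 1 / a\<^sup>2) powr (- 1 / 2)))"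
      using Laplace_sin_int(2)[of a] Laplace_bessel_quot_int(2)[of a] lin_val a by simp
    also have "1 / a ^ 3 * (1 + 1 / a\<^sup>2) powr (- 1 / 2) = 1 / sqrt (1 + a\<^sup>2) / a\<^sup>2"
    proof -
      have powr: "(1 + 1 / a\<^sup>2) powr (- 1 / 2) = 1 / sqrt (1 + 1 / a\<^sup>2)"
        using powr_minus_divide[of "1 + 1 / a\<^sup>2" "1 / 2"] by (simp add: powr_half_sqrt add_nonneg_nonneg)
      have "1 + 1 / a\<^sup>2 = (1 + a\<^sup>2) / a\<^sup>2" using a by (simp add: field_simps)
      then have "sqrt (1 + 1 / a\<^sup>2) = sqrt ((1 + a\<^sup>2) / a\<^sup>2)" by (simp only:)
      also have "\<dots> = sqrt (1 + a\<^sup>2) / a" using a by (simp add: real_sqrt_divide)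
      finally have p: "(1 + 1 / a\<^sup>2) powr (- 1 / 2) = 1 / (sqrt (1 + a\<^sup>2) / a)"
        unfolding powr by (simp only:)
      show ?thesis unfolding p using a by (simp add: power3_eq_cube power2_eq_square)
    qed
    also have "pi / 2 * (1 - 1 / sqrt (1 + a\<^sup>2)) / a\<^sup>2 - (pi / 2 * (1 / a\<^sup>2) - pi / 2 * (1 / sqrt (1 + a\<^sup>2) / a\<^sup>2)) = 0"
      by (simp add: right_diff_distrib diff_divide_distrib)
    finally show "(LBINT z:{0<..}. exp (- (real n + real 3 + 1) * z) * D z) = 0"
      unfolding a_def .
  qed
  then show ?thesis by (simp add: D_def right_diff_distrib)
qed

lemma K_BS_1_bessel:
  assumes z: "0 < z"
  shows "K_BS 1 z = (1 - bessel_quot_int z) / 2"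
proof -
  have "sin_int z = (pi * z) * ((1 - bessel_quot_int z) / 2)"
    unfolding sin_int_eq[OF z] by (simp add: right_diff_distrib)
  then show ?thesis using K_BS_1_eq[of z] z by simp
qed

section \<open>Decay at infinity for r = 1\<close>

lemma sinh_ge_self:
  assumes "0 \<le> x"
  shows "x \<le> sinh (x :: real)"
proof -
  have "sinh 0 - 0 \<le> sinh x - x"
  proof (rule DERIV_nonneg_imp_nondecreasing[OF assms, of "\<lambda>x. sinh x - x"])
    fix y :: real
    have "((\<lambda>x. sinh x - x) has_real_derivative cosh y - 1) (at y)"
      by (auto intro!: derivative_eq_intros)
    then show "\<exists>d. ((\<lambda>x. sinh x - x) has_real_derivative d) (at y) \<and> 0 \<le> d"
      using cosh_real_ge_1[of y] by (intro exI[of _ "cosh y - 1"]) simp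
  qed
  then show ?thesis by simp
qed

lemma K_BS_1_deriv:
  assumes z: "0 < z"
  shows "(K_BS 1 has_real_derivative - (bessel_quot z / 2)) (at z)"
proof (rule has_field_derivative_transform_within_open[where S = "{0<..}"])
  show "((\<lambda>z. (1 - bessel_quot_int z) / 2) has_real_derivative - (bessel_quot z / 2)) (at z)"
    by (auto intro!: derivative_eq_intros bessel_quot_int_deriv)
qed (use z K_BS_1_bessel in auto)

text \<open>Decay by oscillation. The phase cosh t is stationary at t = 0, so the integral is split
  at a = 1 / sqrt z: the head is at most its length a, and integration by parts bounds the tail by 2
  / (a z).\<close>

lemma cos_int_bound:
  assumes z: "1 \<le> z"
  shows "\<bar>cos_int z\<bar> \<le> 3 / sqrt z"
proof -
  define a where "a = 1 / sqrt z"
  have a: "0 < a" using z by (simp add: a_def)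
  \<comment> \<open>cos (z cosh t) / cosh t is \<open>P t\<close> / z times the derivative of sin (z
    cosh t).\<close>
  define P where "P t = 1 / (sinh t * cosh t)" for t :: real
  define P' where "P' t = ((cosh t)\<^sup>2 + (sinh t)\<^sup>2) / (sinh t * cosh t)\<^sup>2" for t :: real
  have sinh_pos: "0 < sinh t" if "a < t" for t using that a by simp
  have P_deriv: "((\<lambda>t. - P t) has_real_derivative P' t) (at t)" if "a < t" for t
    unfolding P_def P'_def using sinh_pos[OF that]
    by (auto intro!: derivative_eq_intros simp: power2_eq_square divide_simps)
  have P'_cont: "isCont P' t" if "a < t" for t
    unfolding P'_def using sinh_pos[OF that] by (intro continuous_intros) auto
  have P_at_a: "((\<lambda>t. P t) \<longlongrightarrow> P a) (at_right a)"
  proof -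
    have "isCont P a" unfolding P_def using a by (intro continuous_intros) auto
    then show ?thesis unfolding isCont_def by (rule tendsto_within_subset) simp
  qed
  have P_top: "(P \<longlongrightarrow> 0) at_top"
    unfolding P_def sinh_field_def cosh_field_def by real_asymp
  \<comment> \<open>\<open>P\<close> decreases to 0, so its total variation on the tail is
    \<open>P a\<close>.\<close>
  have P'_int: "set_integrable lborel {a<..} P'" "(LBINT t:{a<..}. P' t) = 0 - (- P a)"
    by (rule LBINT_FTC_nonneg_to_infinity[OF P_deriv P'_cont tendsto_minus[OF P_at_a]];
        use tendsto_minus[OF P_top] in \<open>simp add: P'_def\<close>)+
  have P_a: "0 \<le> P a" "P a \<le> 1 / a"
  proof -
    have "a * 1 \<le> sinh a * cosh a"
      using a cosh_real_ge_1[of a] by (intro mult_mono) (auto simp: sinh_ge_self)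
    then show "0 \<le> P a" "P a \<le> 1 / a" using a by (auto simp: P_def intro!: divide_left_mono)
  qed
  have int_cos: "set_integrable lborel A (\<lambda>t. cos (z * cosh t) / cosh t)" if "A \<subseteq> {0<..}" "A \<in> sets lborel" for A
  proof -
    have "set_integrable lborel {0<..} (\<lambda>t. cos (z * cosh t) / cosh t)"
      using cos_integrand_integrable[of z] by (simp add: set_integrable_def cos_integrand_def[abs_def])
    from set_integrable_subset[OF this that(2,1)] show ?thesis .
  qed
  have int_sin: "set_integrable lborel {a<..} (\<lambda>t. sin (z * cosh t) * P' t)"
    unfolding set_integrable_def
  proof (rule Bochner_Integration.integrable_bound[OF P'_int(1)[unfolded set_integrable_def]])
    show "(\<lambda>t. indicator {a<..} t *\<^sub>R (sin (z * cosh t) * P' t)) \<in> borel_measurable lborel"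
      unfolding P'_def sinh_def cosh_def by measurable
    show "AE t in lborel. norm (indicator {a<..} t *\<^sub>R (sin (z * cosh t) * P' t)) \<le> norm (indicator {a<..} t *\<^sub>R P' t)"
      by (intro AE_I2) (auto simp: indicator_def abs_mult mult_left_le_one_le)
  qed
  have "(LBINT t:{a<..}. z * (cos (z * cosh t) / cosh t) - sin (z * cosh t) * P' t) = 0 - sin (z * cosh a) * P a"
  proof (rule LBINT_FTC_to_infinity)
    fix t assume t: "a < t"
    have "((\<lambda>t. sin (z * cosh t)) has_real_derivative cos (z * cosh t) * (z * sinh t)) (at t)"
      by (auto intro!: derivative_eq_intros)
    from DERIV_mult[OF this DERIV_minus[OF P_deriv[OF t]]]
    show "((\<lambda>t. sin (z * cosh t) * P t) has_real_derivative z * (cos (z * cosh t) / cosh t) - sin (z * cosh t) * P' t) (at t)"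
      using sinh_pos[OF t] by (simp add: P_def mult_ac)
    show "isCont (\<lambda>t. z * (cos (z * cosh t) / cosh t) - sin (z * cosh t) * P' t) t"
      using P'_cont[OF t] by (intro continuous_intros) auto
  next
    show "((\<lambda>t. sin (z * cosh t) * P t) \<longlongrightarrow> sin (z * cosh a) * P a) (at_right a)"
      by (intro tendsto_intros P_at_a)
    show "((\<lambda>t. sin (z * cosh t) * P t) \<longlongrightarrow> 0) at_top"
    proof (rule Lim_null_comparison)
      show "((\<lambda>t. \<bar>P t\<bar>) \<longlongrightarrow> 0) at_top" using tendsto_rabs[OF P_top] by simp
      show "\<forall>\<^sub>F t in at_top. norm (sin (z * cosh t) * P t) \<le> \<bar>P t\<bar>"
        unfolding real_norm_def abs_mult by (intro always_eventually allI mult_left_le_one_le) auto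
    qed
    show "set_integrable lborel {a<..} (\<lambda>t. z * (cos (z * cosh t) / cosh t) - sin (z * cosh t) * P' t)"
      using a by (intro set_integral_diff set_integrable_mult_right int_cos int_sin) auto
  qed
  then have parts: "z * (LBINT t:{a<..}. cos (z * cosh t) / cosh t) = (LBINT t:{a<..}. sin (z * cosh t) * P' t) - sin (z * cosh a) * P a"
  proof -
    have "set_integrable lborel {a<..} (\<lambda>t. cos (z * cosh t) / cosh t)" using a by (intro int_cos) auto
    then have "set_integrable lborel {a<..} (\<lambda>t. z * (cos (z * cosh t) / cosh t))"
      by (rule set_integrable_mult_right)
    from set_integral_diff(2)[OF this int_sin]
    have "(LBINT t:{a<..}. z * (cos (z * cosh t) / cosh t) - sin (z * cosh t) * P' t)
        = z * (LBINT t:{a<..}. cos (z * cosh t) / cosh t) - (LBINT t:{a<..}. sin (z * cosh t) * P' t)"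
      by (simp only: set_integral_mult_right)
    moreover assume "(LBINT t:{a<..}. z * (cos (z * cosh t) / cosh t) - sin (z * cosh t) * P' t) = 0 - sin (z * cosh a) * P a"
    ultimately show ?thesis by linarith
  qed
  have "\<bar>LBINT t:{a<..}. sin (z * cosh t) * P' t\<bar> \<le> P a"
  proof -
    have "\<bar>LBINT t:{a<..}. sin (z * cosh t) * P' t\<bar> \<le> (LBINT t:{a<..}. \<bar>sin (z * cosh t) * P' t\<bar>)"
      using set_integral_norm_bound[OF int_sin] by simp
    also have "\<dots> \<le> (LBINT t:{a<..}. P' t)"
    proof (rule set_integral_mono[OF set_integrable_abs[OF int_sin] P'_int(1)])
      fix t
      have "0 \<le> P' t" by (simp add: P'_def)
      then show "\<bar>sin (z * cosh t) * P' t\<bar> \<le> P' t" by (simp add: abs_mult mult_left_le_one_le)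
    qed
    finally show ?thesis using P'_int(2) by simp
  qed
  moreover have "\<bar>sin (z * cosh a) * P a\<bar> \<le> P a"
    using P_a unfolding abs_mult by (simp add: mult_left_le_one_le)
  ultimately have "\<bar>z * (LBINT t:{a<..}. cos (z * cosh t) / cosh t)\<bar> \<le> 2 * (1 / a)"
    unfolding parts using P_a by linarith
  then have "z * \<bar>LBINT t:{a<..}. cos (z * cosh t) / cosh t\<bar> \<le> 2 * sqrt z"
    using z by (simp add: abs_mult a_def)
  then have tail: "\<bar>LBINT t:{a<..}. cos (z * cosh t) / cosh t\<bar> \<le> 2 / sqrt z"
  proof -
    assume *: "z * \<bar>LBINT t:{a<..}. cos (z * cosh t) / cosh t\<bar> \<le> 2 * sqrt z"
    have "z = sqrt z * sqrt z" using z by simp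
    with * have "sqrt z * (sqrt z * \<bar>LBINT t:{a<..}. cos (z * cosh t) / cosh t\<bar>) \<le> sqrt z * 2"
      by (metis mult.assoc mult.commute)
    then have "sqrt z * \<bar>LBINT t:{a<..}. cos (z * cosh t) / cosh t\<bar> \<le> 2"
      using z by simp
    then show ?thesis using z by (simp add: field_simps)
  qed
  have head: "\<bar>LBINT t:{0<..a}. cos (z * cosh t) / cosh t\<bar> \<le> 1 / sqrt z"
  proof -
    have int0: "set_integrable lborel {0<..a} (\<lambda>t. cos (z * cosh t) / cosh t)" by (rule int_cos) auto
    have "\<bar>LBINT t:{0<..a}. cos (z * cosh t) / cosh t\<bar> \<le> (LBINT t:{0<..a}. \<bar>cos (z * cosh t) / cosh t\<bar>)"
      using set_integral_norm_bound[OF int0] by simp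
    also have "\<dots> \<le> (LBINT t:{0<..a}. 1)"
    proof (rule set_integral_mono[OF set_integrable_abs[OF int0]])
      show "set_integrable lborel {0<..a} (\<lambda>t. 1 :: real)" using a by (simp add: set_integrable_def)
      show "\<bar>cos (z * cosh t) / cosh t\<bar> \<le> 1" for t
        using cosh_real_ge_1[of t] by (simp add: divide_le_eq order.trans[OF abs_cos_le_one])
    qed
    also have "\<dots> = a" using a by (simp add: set_lebesgue_integral_def)
    finally show ?thesis by (simp add: a_def)
  qed
  have "cos_int z = (LBINT t:{0<..a} \<union> {a<..}. cos (z * cosh t) / cosh t)"
  proof -
    have "{0<..a} \<union> {a<..} = {0<..}" using a by auto
    then show ?thesis by (simp add: cos_int_def cos_integrand_def set_lebesgue_integral_def)
  qed
  also have "\<dots> = (LBINT t:{0<..a}. cos (z * cosh t) / cosh t) + (LBINT t:{a<..}. cos (z * cosh t) / cosh t)"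
    using a by (intro set_integral_Un int_cos) auto
  finally show ?thesis using head tail by (simp add: abs_le_iff)
qed


text \<open>The derivative of \<open>K_BS 1\<close> is computed a second time, from the sine form,
  where the bounds on \<open>cos_int\<close> and \<open>sin_int\<close> apply. The exponent 3/2
  exceeds 1, as integrability at infinity requires.\<close>

lemma bessel_quot_bound:
  assumes z: "1 \<le> z"
  shows "\<bar>bessel_quot z\<bar> \<le> (6 + 2 * cosh_const) * (1 / (z * sqrt z))"
proof -
  have z0: "0 < z" using z by simp
  have "((\<lambda>z. sin_int z / (pi * z)) has_real_derivative (cos_int z * (pi * z) - sin_int z * pi) / (pi * z * (pi * z))) (at z)"
    using z by (auto intro!: derivative_eq_intros sin_int_deriv)
  then have "(K_BS 1 has_real_derivative (cos_int z * (pi * z) - sin_int z * pi) / (pi * z * (pi * z))) (at z)"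
    by (rule has_field_derivative_transform_within_open[where S = "{0<..}"]) (use z0 K_BS_1_eq in auto)
  from DERIV_unique[OF this K_BS_1_deriv[OF z0]]
  have "bessel_quot z = - (2 * ((cos_int z * (pi * z) - sin_int z * pi) / (pi * z * (pi * z))))"
    by simp
  also have "(cos_int z * (pi * z) - sin_int z * pi) / (pi * z * (pi * z)) = (cos_int z / z - sin_int z / z\<^sup>2) / pi"
    using z by (simp add: power2_eq_square field_simps)
  finally have quot: "bessel_quot z = - (2 * ((cos_int z / z - sin_int z / z\<^sup>2) / pi))" .
  have "\<bar>- (2 * (y / pi))\<bar> = 2 * (\<bar>y\<bar> / pi)" for y :: real by (simp add: abs_mult)
  then have eq: "\<bar>bessel_quot z\<bar> = 2 * (\<bar>cos_int z / z - sin_int z / z\<^sup>2\<bar> / pi)"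
    unfolding quot .
  have "\<bar>cos_int z / z\<bar> \<le> 3 * (1 / (z * sqrt z))"
  proof -
    have "\<bar>cos_int z\<bar> / z \<le> 3 / sqrt z / z"
      using z by (intro divide_right_mono cos_int_bound) auto
    then show ?thesis using z by (simp add: mult.commute)
  qed
  moreover have "\<bar>sin_int z / z\<^sup>2\<bar> \<le> cosh_const * (1 / (z * sqrt z))"
  proof -
    have "sqrt z \<le> z" using z by (intro real_le_lsqrt) (auto simp: power2_eq_square)
    then have "z * sqrt z \<le> z\<^sup>2" using z by (simp add: power2_eq_square)
    then have "\<bar>sin_int z\<bar> / z\<^sup>2 \<le> cosh_const / (z * sqrt z)"
      using z sin_int_bound[of z] by (intro frac_le) auto
    then show ?thesis by simp
  qed
  ultimately have "\<bar>cos_int z / z - sin_int z / z\<^sup>2\<bar> \<le> (3 + cosh_const) * (1 / (z * sqrt z))"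
    unfolding distrib_right by linarith
  moreover have "X / pi \<le> X" if "0 \<le> X" for X
    using mult_left_mono[of 1 pi X] that pi_gt3 by (simp add: divide_le_eq)
  ultimately have "\<bar>cos_int z / z - sin_int z / z\<^sup>2\<bar> / pi \<le> (3 + cosh_const) * (1 / (z * sqrt z))"
    using abs_ge_zero order.trans by blast
  then have "\<bar>bessel_quot z\<bar> \<le> 2 * ((3 + cosh_const) * (1 / (z * sqrt z)))"
    unfolding eq by (rule mult_left_mono) simp
  then show ?thesis by (simp only: distrib_left mult.assoc[symmetric]) simp
qed

text \<open>Continuity on (0, 1], and a multiple of z^(-3/2) as majorant beyond 1.\<close>

lemma bessel_quot_integrable: "set_integrable lborel {0<..} bessel_quot"
proof -
  have cont: "continuous_on A bessel_quot" for A
    by (intro continuous_at_imp_continuous_on ballI isCont_bessel_quot)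
  have [measurable]: "bessel_quot \<in> borel_measurable borel"
    using cont by (rule borel_measurable_continuous_onI)
  have int1: "set_integrable lborel {0<..1} bessel_quot"
    using borel_integrable_atLeastAtMost'[OF cont[of "{0..1}"]] by (rule set_integrable_subset) auto
  have sqrt_int: "set_integrable lborel {1<..} (\<lambda>z. 1 / (z * sqrt z))"
  proof (rule LBINT_FTC_nonneg_to_infinity(1)[where F = "\<lambda>z. - 2 / sqrt z" and A = "- 2 / sqrt 1" and B = 0])
    show "((\<lambda>z. - 2 / sqrt z) has_real_derivative 1 / (z * sqrt z)) (at z)" if "1 < z" for z
      using that by (auto intro!: derivative_eq_intros simp: divide_simps)
    show "isCont (\<lambda>z. 1 / (z * sqrt z)) z" if "1 < z" for z
      using that by (intro continuous_intros) auto
    show "((\<lambda>z. - 2 / sqrt z) \<longlongrightarrow> - 2 / sqrt 1) (at_right 1)"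
      by (auto intro!: tendsto_eq_intros)
    show "((\<lambda>z::real. - 2 / sqrt z) \<longlongrightarrow> 0) at_top" by real_asymp
  qed auto
  have "set_integrable lborel {1<..} bessel_quot"
    unfolding set_integrable_def
  proof (rule Bochner_Integration.integrable_bound)
    show "integrable lborel (\<lambda>z. (6 + 2 * cosh_const) * (indicator {1<..} z *\<^sub>R (1 / (z * sqrt z))))"
      using sqrt_int unfolding set_integrable_def by (rule integrable_mult_right)
    show "AE z in lborel. norm (indicator {1<..} z *\<^sub>R bessel_quot z) \<le> norm ((6 + 2 * cosh_const) * (indicator {1<..} z *\<^sub>R (1 / (z * sqrt z))))"
    proof (rule AE_I2)
      fix z
      show "norm (indicator {1<..} z *\<^sub>R bessel_quot z) \<le> norm ((6 + 2 * cosh_const) * (indicator {1<..} z *\<^sub>R (1 / (z * sqrt z))))"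
      proof (cases "1 < z")
        case True
        then show ?thesis
          using order.trans[OF bessel_quot_bound[of z] abs_ge_self] by simp
      qed simp
    qed
  qed measurable
  with int1 have "set_integrable lborel ({0<..1} \<union> {1<..}) bessel_quot"
    by (intro set_integrable_Un) auto
  moreover have "{0<..1} \<union> {1<..} = {0::real<..}" by auto
  ultimately show ?thesis by simp
qed

lemma K_BS_even: "K_BS r (- z) = K_BS r z"
  unfolding K_BS_eq bs_limit_def by simp

text \<open>Fundamental theorem on the open half-line; continuity of the kernel supplies the limit
  at the endpoint, also for z = 0, and boundedness of \<open>sin_int\<close> gives decay like 1 /
  t.\<close>

theorem K_BS_1_eq_integral: "K_BS 1 z = (LBINT t:{\<bar>z\<bar>..}. bessel_J 1 t / (2 * t))"
proof -
  define x where "x = \<bar>z\<bar>"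
  have x: "0 \<le> x" by (simp add: x_def)
  have "continuous_on UNIV bessel_quot"
    by (intro continuous_at_imp_continuous_on ballI isCont_bessel_quot)
  then have [measurable]: "bessel_quot \<in> borel_measurable borel"
    by (rule borel_measurable_continuous_onI)
  have "(LBINT t:{x<..}. bessel_quot t / 2) = 0 - (- K_BS 1 x)"
  proof (rule LBINT_FTC_to_infinity)
    show "((\<lambda>t. - K_BS 1 t) has_real_derivative bessel_quot t / 2) (at t)" if "x < t" for t
      using DERIV_minus[OF K_BS_1_deriv[of t]] that x by simp
    show "isCont (\<lambda>t. bessel_quot t / 2) t" for t
      by (intro continuous_intros isCont_bessel_quot) simp
    have "(K_BS 1 \<longlongrightarrow> K_BS 1 x) (at x)" using isCont_K_BS[of 1 x] by (simp add: isCont_def)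
    then have "(K_BS 1 \<longlongrightarrow> K_BS 1 x) (at_right x)" by (rule tendsto_within_subset) simp
    then show "((\<lambda>t. - K_BS 1 t) \<longlongrightarrow> - K_BS 1 x) (at_right x)" by (rule tendsto_minus)
    show "((\<lambda>t. - K_BS 1 t) \<longlongrightarrow> 0) at_top"
    proof (rule Lim_null_comparison)
      have "((\<lambda>t. cosh_const / pi * (1 / t)) \<longlongrightarrow> cosh_const / pi * 0) at_top"
        by (intro tendsto_intros tendsto_divide_0[OF tendsto_const] filterlim_at_top_imp_at_infinity filterlim_ident)
      then show "((\<lambda>t. cosh_const / pi * (1 / t)) \<longlongrightarrow> 0) at_top" by simp
      have "norm (- K_BS 1 t) \<le> cosh_const / pi * (1 / t)" if t: "0 < t" for t
      proof -
        have "\<bar>sin_int t\<bar> / (pi * t) \<le> cosh_const / (pi * t)"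
          using t by (intro divide_right_mono sin_int_bound) auto
        then show ?thesis using K_BS_1_eq[of t] t by (simp add: abs_mult)
      qed
      then show "\<forall>\<^sub>F t in at_top. norm (- K_BS 1 t) \<le> cosh_const / pi * (1 / t)"
        by (rule eventually_mono[OF eventually_gt_at_top])
    qed
    show "set_integrable lborel {x<..} (\<lambda>t. bessel_quot t / 2)"
    proof (rule set_integrable_subset)
      show "set_integrable lborel {0<..} (\<lambda>t. bessel_quot t / 2)"
        using bessel_quot_integrable by (rule set_integrable_divide)
    qed (use x in auto)
  qed
  then have "K_BS 1 x = (LBINT t:{x<..}. bessel_quot t / 2)" by simp
  also have "\<dots> = (LBINT t:{x..}. bessel_J 1 t / (2 * t))"
    unfolding set_lebesgue_integral_def
  proof (rule integral_cong_AE)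
    show "(\<lambda>t. indicator {x..} t *\<^sub>R (bessel_J 1 t / (2 * t))) \<in> borel_measurable lborel"
      unfolding bessel_J_1_eq by measurable
    \<comment> \<open>The endpoint is a null set; for x = 0 the quotient on the right is 0 / 0
      there.\<close>
    have "AE t in lborel. t \<noteq> x" using AE_lborel_singleton[of x] by simp
    then show "AE t in lborel. indicator {x<..} t *\<^sub>R (bessel_quot t / 2) = indicator {x..} t *\<^sub>R (bessel_J 1 t / (2 * t))"
      by eventually_elim (use x in \<open>auto simp: indicator_def bessel_J_1_eq simp del: One_nat_def\<close>)
  qed measurable
  finally show ?thesis
    using K_BS_even[of 1 z] by (cases "0 \<le> z") (simp_all add: x_def)
qed

theorem theorem1p1:
  "(\<forall>r\<ge>0. \<forall>s>0. fredholm_det {0<..<2 * s} (\<lambda>x y. K_BS r (x - y))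
        = exp (- s\<^sup>2 / 2 - 2 * r * s) * (cosh s + r * sinh s))
   \<and> (\<forall>r>0. \<forall>z. K_BS r z = cont_at_0 (\<lambda>z. 1 / (pi * z) *
        (LBINT t:{0<..}. sin (z * cosh t) *
           ((r\<^sup>2 * (cosh t)\<^sup>2 + (r\<^sup>2 - 1) * (sinh t)\<^sup>2) / ((sinh t)\<^sup>2 + r\<^sup>2)\<^sup>2))) z)
   \<and> (\<forall>z. K_BS 1 z = (LBINT t:{\<bar>z\<bar>..}. bessel_J 1 t / (2 * t)))"
proof (intro conjI allI impI)
  show "fredholm_det {0<..<2 * s} (\<lambda>x y. K_BS r (x - y))
      = exp (- s\<^sup>2 / 2 - 2 * r * s) * (cosh s + r * sinh s)" if "0 \<le> r" "0 < s" for r s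
    by (rule fredholm_det_K_BS[OF that])
  show "K_BS r z = cont_at_0 (\<lambda>z. 1 / (pi * z) *
      (LBINT t:{0<..}. sin (z * cosh t) *
         ((r\<^sup>2 * (cosh t)\<^sup>2 + (r\<^sup>2 - 1) * (sinh t)\<^sup>2) / ((sinh t)\<^sup>2 + r\<^sup>2)\<^sup>2))) z" if "0 < r" for r z
    by (rule K_BS_eq_cont_at_0[OF that, unfolded bs_density_def])
  show "K_BS 1 z = (LBINT t:{\<bar>z\<bar>..}. bessel_J 1 t / (2 * t))" for z
    by (rule K_BS_1_eq_integral)
qed

end
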